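(* Fix $\epsilon>0$. Consider a sequence of problem sizes $(k,n,N)$ that grows proportionally, i.e., for $(\delta,\rho)\in[0,1]^2$, $\frac{n}{N}\to\delta$ and $\frac{k}{n}\to\rho$ as $n\to\infty$. Sample each $n\times N$ matrix $A$ from the Gaussian ensemble. Then $$\mathrm{Prob}\big(L(k,n,N;A)<\mathcal{L}(\delta,\rho)+\epsilon\big)\to 1\quad\text{and}\quad \mathrm{Prob}\big(U(k,n,N;A)<\mathcal{U}(\delta,\rho)+\epsilon\big)\to 1$$ exponentially in $n$.
   Context: Gaussian ensemble: the entries of the $n\times N$ matrix $A$ are i.i.d. normal $\mathcal{N}(0,n^{-1})$ (mean $0$, variance $1/n$). Let $\chi^N(k)=\{x\in\mathbb{R}^N:\|x\|_0\le k\}$, where $\|x\|_0$ is the number of nonzero entries of $x$. The asymmetric restricted isometry (RIP) constants of an $n\times N$ matrix $A$ are $$L(k,n,N;A):=\min\{c\ge 0:\ (1-c)\|x\|_2^2\le\|Ax\|_2^2\ \text{ for all }x\in\chi^N(k)\},$$ $$U(k,n,N;A):=\min\{c\ge 0:\ (1+c)\|x\|_2^2\ge\|Ax\|_2^2\ \text{ for all }x\in\chi^N(k)\}.$$ Let $H(p):=p\log(1/p)+(1-p)\log(1/(1-p))$ be the Shannon entropy with natural logarithms, and $$\psi_{min}(\lambda,\rho):=H(\rho)+\tfrac12\left[(1-\rho)\log\lambda+1-\rho+\rho\log\rho-\lambda\right],$$ $$\psi_{max}(\lambda,\rho):=\tfrac12\left[(1+\rho)\log\lambda+1+\rho-\rho\log\rho-\lambda\right].$$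 Define $\lambda^{min}(\delta,\rho)$ as the solution $\lambda$ of $\delta\psi_{min}(\lambda,\rho)+H(\rho\delta)=0$ with $\lambda\le 1-\rho$, and $\lambda^{max}(\delta,\rho)$ as the solution $\lambda$ of $\delta\psi_{max}(\lambda,\rho)+H(\rho\delta)=0$ with $\lambda\ge 1+\rho$. Define $$\mathcal{L}(\delta,\rho):=1-\lambda^{min}(\delta,\rho),\qquad \mathcal{U}(\delta,\rho):=\min_{\nu\in[\rho,1]}\lambda^{max}(\delta,\nu)-1.$$ A probability converges to its limit "exponentially in $n$" if its distance to the limit is bounded by a constant multiple of $e^{-n\beta}$ for some fixed $\beta>0$.
   Formalization: The case δ = 0 is excluded, since there the equations defining λ^min and λ^max read 0 = 0 and determine no solution; at ρ = 1, where λ^min has no solution in the range 0 < λ ≤ 1−ρ, it is taken to be its limit 0, so 𝓛(δ,1) = 1. *)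

theory Defs
  imports "HOL-Probability.Probability" "Jordan_Normal_Form.Matrix"
begin

text \<open>Matrices and vectors of varying size are those of \<^theory>\<open>Jordan_Normal_Form.Matrix\<close>.\<close>

definition l2_norm :: "real vec \<Rightarrow> real" where
  "l2_norm x = L2_set (vec_index x) {..<dim_vec x}"

definition l0_norm :: "real vec \<Rightarrow> nat" where
  "l0_norm x = card {i. i < dim_vec x \<and> vec_index x i \<noteq> 0}"

definition sparse_vecs :: "nat \<Rightarrow> nat \<Rightarrow> real vec set" where
  "sparse_vecs N k = {x \<in> carrier_vec N. l0_norm x \<le> k}"

text \<open>The sizes \<open>n\<close> and \<open>N\<close> are the dimensions of the matrix, so they are not separate arguments.\<close>

definition rip_L :: "nat \<Rightarrow> real mat \<Rightarrow> real" where
  "rip_L k A = (LEAST c. 0 \<le> c \<and>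
     (\<forall>x \<in> sparse_vecs (dim_col A) k. (1 - c) * (l2_norm x)\<^sup>2 \<le> (l2_norm (A *\<^sub>v x))\<^sup>2))"

definition rip_U :: "nat \<Rightarrow> real mat \<Rightarrow> real" where
  "rip_U k A = (LEAST c. 0 \<le> c \<and>
     (\<forall>x \<in> sparse_vecs (dim_col A) k. (1 + c) * (l2_norm x)\<^sup>2 \<ge> (l2_norm (A *\<^sub>v x))\<^sup>2))"

text \<open>The second parameter of \<^const>\<open>normal_density\<close> is the standard deviation,
  so the variance of the entries is \<open>1 / n\<close>.\<close>

definition gaussian_ensemble :: "'w measure \<Rightarrow> nat \<Rightarrow> nat \<Rightarrow> ('w \<Rightarrow> real mat) \<Rightarrow> bool" where
  "gaussian_ensemble M n N A \<longleftrightarrow>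
     prob_space M \<and>
     (\<forall>\<omega> \<in> space M. A \<omega> \<in> carrier_mat n N) \<and>
     prob_space.indep_vars M (\<lambda>_. borel) (\<lambda>ij \<omega>. A \<omega> $$ ij) ({..<n} \<times> {..<N}) \<and>
     (\<forall>i<n. \<forall>j<N. distributed M lborel (\<lambda>\<omega>. A \<omega> $$ (i, j)) (normal_density 0 (sqrt (1 / real n))))"

text \<open>In the following formulas \<open>0 * ln 0 = 0\<close> and \<open>0 * ln (1 / 0) = 0\<close>, which is the usual
  convention for the entropy at the endpoints.\<close>

definition shannon_entropy :: "real \<Rightarrow> real" where
  "shannon_entropy p = p * ln (1 / p) + (1 - p) * ln (1 / (1 - p))"

definition psi_min :: "real \<Rightarrow> real \<Rightarrow> real" where
  "psi_min l \<rho> = shannon_entropy \<rho> + 1/2 * ((1 - \<rho>) * ln l + 1 - \<rho> + \<rho> * ln \<rho> - l)"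

definition psi_max :: "real \<Rightarrow> real \<Rightarrow> real" where
  "psi_max l \<rho> = 1/2 * ((1 + \<rho>) * ln l + 1 + \<rho> - \<rho> * ln \<rho> - l)"

text \<open>The defining equations below determine a solution only for \<open>\<delta> > 0\<close>; for \<open>\<delta> = 0\<close> they
  read \<open>0 = 0\<close>. The condition \<open>0 < l\<close> is the domain of the logarithm. For \<open>\<rho> = 1\<close> the range
  \<open>0 < l \<le> 1 - \<rho>\<close> is empty, and \<open>lambda_min\<close> is extended by its limit \<open>0\<close> as \<open>\<rho>\<close> tends to \<open>1\<close>.\<close>

definition lambda_min :: "real \<Rightarrow> real \<Rightarrow> real" where
  "lambda_min \<delta> \<rho> = (if \<rho> = 1 then 0 else
     (THE l. 0 < l \<and> l \<le> 1 - \<rho> \<and> \<delta> * psi_min l \<rho> + shannon_entropy (\<rho> * \<delta>) = 0))"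

definition lambda_max :: "real \<Rightarrow> real \<Rightarrow> real" where
  "lambda_max \<delta> \<rho> = (THE l. 1 + \<rho> \<le> l \<and> \<delta> * psi_max l \<rho> + shannon_entropy (\<rho> * \<delta>) = 0)"

definition bound_L :: "real \<Rightarrow> real \<Rightarrow> real" where
  "bound_L \<delta> \<rho> = 1 - lambda_min \<delta> \<rho>"

definition bound_U :: "real \<Rightarrow> real \<Rightarrow> real" where
  "bound_U \<delta> \<rho> = (LEAST l. l \<in> lambda_max \<delta> ` {\<rho>..1}) - 1"

text \<open>Problem sizes form a sequence indexed by \<open>m\<close>; the rate is measured in \<open>n m\<close>, not in \<open>m\<close>.\<close>

definition converges_exponentially :: "(nat \<Rightarrow> nat) \<Rightarrow> (nat \<Rightarrow> real) \<Rightarrow> real \<Rightarrow> bool" where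
  "converges_exponentially n p l \<longleftrightarrow>
     (\<exists>\<beta>>0. \<exists>C. \<forall>m. \<bar>p m - l\<bar> \<le> C * exp (- (real (n m) * \<beta>)))"

end

theory Submission
  imports Defs "HOL-Real_Asymp.Real_Asymp"
begin

text \<open>Only two moment comparisons replace the eigenvalue densities of Wishart matrices. Let \<open>B\<close> be an
  \<open>n \<times> k\<close> matrix and \<open>x\<close> a vector, both standard Gaussian and independent. If \<open>B\<close> expands some unit vector
  to squared length at least \<open>T\<close>, then \<open>|B x|\<^sup>2 \<ge> \<langle>x, w\<rangle>\<^sup>2\<close> for a fixed \<open>w\<close> with \<open>|w|\<^sup>2 \<ge> T\<close>, so the
  \<open>p\<close>-th moment of \<open>|B x|\<^sup>2\<close> over \<open>x\<close> is at least \<open>T ^ p\<close> times a Gaussian moment; comparing with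
  the moment over both \<open>B\<close> and \<open>x\<close> bounds the probability of this event.
  If \<open>B\<close> contracts some unit vector \<open>v\<close> to squared length at most \<open>T\<close>, then for every unit vector \<open>u\<close> the
  squared distance of \<open>B u\<close> from the image of the complement of \<open>u\<close> is at most \<open>T / \<langle>u, v\<rangle>\<^sup>2\<close>, and the negative
  moments of this distance over \<open>B\<close> are those of a chi-square variable. With \<open>2 * p / n\<close> tending to
  \<open>\<lambda> - 1\<close>, respectively \<open>1 - \<rho> - \<lambda>\<close>, convexity of \<open>x * ln x\<close> gives exponents below \<open>psi_max\<close> and \<open>psi_min\<close>, and a union
  bound over the supports adds the entropy term.\<close>

unbundle no vec_syntax

section \<open>Gaussian product measures\<close>

text \<open>The bad direction depends on the matrix. Instead of a net on the sphere or a measurable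
  choice of singular vectors, an independent Gaussian \<open>x\<close> is averaged out: the
  direction enters only through an even moment of a linear form in \<open>x\<close>, a function of
  its length alone, and the bad event lies in a superlevel set of a measurable functional of
  \<open>B\<close>. The price is the ratio of the p-th moment of |x|^2 to the 2p-th moment of one
  coordinate; it takes the place of the size of a net. The orders of the moments are in general not
  the optimal ones, which solve quadratic equations. They turn \<open>1 + 2 * p / n\<close>,
  respectively \<open>1 - \<rho> - 2 * p / n\<close>, into \<lambda>. In the contraction case the
  distance is a minimum over a subspace that varies with \<open>B\<close>. A quotient of two
  integrals over the fibre stands in for its Laplace transform, so that Fubini and affine
  substitutions suffice, without orthonormal bases or determinants. \<open>B u\<close> can be
  replaced by a fresh Gaussian vector independent of \<open>B\<close> on the complement of
  \<open>u\<close>, and integrating against a power of \<open>s\<close> produces the negative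
  moments.\<close>

definition std_gauss :: "real measure" where
  "std_gauss = density lborel std_normal_density"

abbreviation gauss_PiM :: "'i set \<Rightarrow> ('i \<Rightarrow> real) measure" where
  "gauss_PiM I \<equiv> PiM I (\<lambda>_. std_gauss)"

abbreviation lborel_PiM :: "'i set \<Rightarrow> ('i \<Rightarrow> real) measure" where
  "lborel_PiM I \<equiv> PiM I (\<lambda>_. lborel)"

abbreviation sqsum :: "'i set \<Rightarrow> ('i \<Rightarrow> real) \<Rightarrow> real" where
  "sqsum I x \<equiv> \<Sum>i\<in>I. (x i)\<^sup>2"

abbreviation matsq :: "'a set \<Rightarrow> 'b set \<Rightarrow> ('a \<times> 'b \<Rightarrow> real) \<Rightarrow> ('b \<Rightarrow> real) \<Rightarrow> real" where
  "matsq I J B x \<equiv> \<Sum>i\<in>I. (\<Sum>j\<in>J. B (i, j) * x j)\<^sup>2"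

lemma prob_space_std_gauss: "prob_space std_gauss"
  unfolding std_gauss_def by (rule prob_space_normal_density) simp

lemma sets_std_gauss [measurable_cong, simp]: "sets std_gauss = sets borel"
  by (simp add: std_gauss_def)

lemma space_std_gauss [simp]: "space std_gauss = UNIV"
  by (simp add: std_gauss_def)

interpretation std_gauss: prob_space std_gauss
  by (rule prob_space_std_gauss)

interpretation gauss_product: product_sigma_finite "\<lambda>_. std_gauss"
  by standard

interpretation lborel_product: product_sigma_finite "\<lambda>_. lborel :: real measure"
  by standard

lemma prob_space_gauss_PiM: "prob_space (gauss_PiM I)"
  by (intro prob_space_PiM prob_space_std_gauss)

text \<open>Completing the square turns the integrand into a constant multiple of the normal density
  with mean \<open>b / D\<close> and variance \<open>1 / D\<close>, whose total mass is one. The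
  bound on \<open>a\<close> makes \<open>D\<close> positive.\<close>

lemma nn_integral_std_gauss_exp_quadratic:
  fixes a b :: real
  assumes "a < 1/2"
  shows "(\<integral>\<^sup>+x. ennreal (exp (a * x\<^sup>2 + b * x)) \<partial>std_gauss)
    = ennreal ((1 - 2 * a) powr (-1/2) * exp (b\<^sup>2 / (2 * (1 - 2 * a))))"
proof -
  define D where "D = 1 - 2 * a"
  have D: "D > 0" using assms by (simp add: D_def)
  let ?C = "D powr (-1/2) * exp (b\<^sup>2 / (2 * D))"
  define \<sigma> where "\<sigma> = 1 / sqrt D"
  have \<sigma>: "\<sigma> > 0" "\<sigma>\<^sup>2 = 1 / D" using D by (auto simp: \<sigma>_def power_divide)
  have eq: "std_normal_density x * exp (a * x\<^sup>2 + b * x) = ?C * normal_density (b / D) \<sigma> x" for x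
  proof -
    have e: "- x\<^sup>2 / 2 + (a * x\<^sup>2 + b * x) = b\<^sup>2 / (2 * D) + - (x - b / D)\<^sup>2 / (2 * \<sigma>\<^sup>2)"
    proof -
      have a: "a * x\<^sup>2 = x\<^sup>2 / 2 - D * x\<^sup>2 / 2" by (simp add: D_def field_simps)
      have "(x - b / D)\<^sup>2 * D = D * x\<^sup>2 - 2 * b * x + b\<^sup>2 / D"
        using D by (simp add: power2_diff power_divide power2_eq_square field_simps)
      then have "- (x - b / D)\<^sup>2 / (2 * \<sigma>\<^sup>2) = - (D * x\<^sup>2 - 2 * b * x + b\<^sup>2 / D) / 2"
        using D by (simp add: \<sigma>(2))
      moreover have "b\<^sup>2 / (2 * D) = b\<^sup>2 / D / 2" by simp
      ultimately show ?thesis using a by argo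
    qed
    have "sqrt (2 * pi * \<sigma>\<^sup>2) = sqrt (2 * pi) / sqrt D"
      using D by (simp only: \<sigma>(2) real_sqrt_divide[symmetric]) simp
    moreover have "D powr (-1/2) = 1 / sqrt D"
      using D powr_minus_divide[of D "1/2"] by (simp add: powr_half_sqrt)
    ultimately have s: "1 / sqrt (2 * pi) = D powr (-1/2) * (1 / sqrt (2 * pi * \<sigma>\<^sup>2))"
      using D by simp
    have "std_normal_density x * exp (a * x\<^sup>2 + b * x)
        = 1 / sqrt (2 * pi) * (exp (- x\<^sup>2 / 2) * exp (a * x\<^sup>2 + b * x))"
      unfolding std_normal_density_def by (simp only: mult.assoc)
    also have "\<dots> = 1 / sqrt (2 * pi) * exp (- x\<^sup>2 / 2 + (a * x\<^sup>2 + b * x))"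
      by (simp only: exp_add)
    also have "\<dots> = ?C * normal_density (b / D) \<sigma> x"
      unfolding e s normal_density_def by (simp add: exp_add[symmetric] mult_ac)
    finally show ?thesis .
  qed
  have "(\<integral>\<^sup>+x. ennreal (exp (a * x\<^sup>2 + b * x)) \<partial>std_gauss)
      = (\<integral>\<^sup>+x. ennreal (std_normal_density x * exp (a * x\<^sup>2 + b * x)) \<partial>lborel)"
    unfolding std_gauss_def by (subst nn_integral_density) (auto simp: ennreal_mult)
  also have "\<dots> = (\<integral>\<^sup>+x. ennreal ?C * ennreal (normal_density (b / D) \<sigma> x) \<partial>lborel)"
    unfolding eq by (simp add: ennreal_mult)
  also have "\<dots> = ennreal ?C * (\<integral>\<^sup>+x. ennreal (normal_density (b / D) \<sigma> x) \<partial>lborel)"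
    by (intro nn_integral_cmult) auto
  also have "(\<integral>\<^sup>+x. ennreal (normal_density (b / D) \<sigma> x) \<partial>lborel) = 1"
    using \<sigma>(1) by (subst nn_integral_eq_integral) auto
  finally show ?thesis by (simp add: D_def)
qed

text \<open>Averaging preserves the Gaussian shape in \<open>u\<close> and only weakens the rate
  from \<open>s\<close> to \<open>s / (1 + 2 * s)\<close>. In the lower tail the old rate is
  restored by a dilation with factor \<open>sqrt (1 + 2 * s)\<close>.\<close>

lemma nn_integral_std_gauss_exp_shift:
  fixes s u :: real
  assumes "s > 0"
  shows "(\<integral>\<^sup>+x. ennreal (exp (- s * (x + u)\<^sup>2)) \<partial>std_gauss)
    = ennreal ((1 + 2 * s) powr (-1/2) * exp (- (s / (1 + 2 * s)) * u\<^sup>2))"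
proof -
  have "(\<integral>\<^sup>+x. ennreal (exp (- s * (x + u)\<^sup>2)) \<partial>std_gauss)
      = (\<integral>\<^sup>+x. ennreal (exp (- s * u\<^sup>2)) * ennreal (exp ((-s) * x\<^sup>2 + (- 2 * s * u) * x)) \<partial>std_gauss)"
    by (intro nn_integral_cong)
       (auto simp: ennreal_mult[symmetric] exp_add[symmetric] power2_eq_square algebra_simps)
  also have "\<dots> = ennreal (exp (- s * u\<^sup>2)) *
      (\<integral>\<^sup>+x. ennreal (exp ((-s) * x\<^sup>2 + (- 2 * s * u) * x)) \<partial>std_gauss)"
    by (intro nn_integral_cmult) auto
  also have "\<dots> = ennreal (exp (- s * u\<^sup>2) * ((1 + 2 * s) powr (-1/2) *
      exp ((- 2 * s * u)\<^sup>2 / (2 * (1 + 2 * s)))))"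
    using assms by (subst nn_integral_std_gauss_exp_quadratic) (auto simp: ennreal_mult)
  also have "exp (- s * u\<^sup>2) * ((1 + 2 * s) powr (-1/2) * exp ((- 2 * s * u)\<^sup>2 / (2 * (1 + 2 * s))))
      = (1 + 2 * s) powr (-1/2) * exp (- s * u\<^sup>2 + (- 2 * s * u)\<^sup>2 / (2 * (1 + 2 * s)))"
    by (simp only: exp_add mult_ac)
  also have "- s * u\<^sup>2 + (- 2 * s * u)\<^sup>2 / (2 * (1 + 2 * s)) = - (s / (1 + 2 * s)) * u\<^sup>2"
    using assms by (simp add: field_simps power2_eq_square)
  finally show ?thesis .
qed

lemma nn_integral_gauss_PiM_prod:
  fixes f :: "'i \<Rightarrow> real \<Rightarrow> real"
  assumes "finite I" "\<And>i. i \<in> I \<Longrightarrow> f i \<in> borel_measurable borel" "\<And>i x. i \<in> I \<Longrightarrow> f i x \<ge> 0"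
    and "\<And>i. i \<in> I \<Longrightarrow> (\<integral>\<^sup>+x. ennreal (f i x) \<partial>std_gauss) = ennreal (c i)" "\<And>i. i \<in> I \<Longrightarrow> c i \<ge> 0"
  shows "(\<integral>\<^sup>+x. ennreal (\<Prod>i\<in>I. f i (x i)) \<partial>gauss_PiM I) = ennreal (\<Prod>i\<in>I. c i)"
proof -
  have "(\<integral>\<^sup>+x. ennreal (\<Prod>i\<in>I. f i (x i)) \<partial>gauss_PiM I)
    = (\<integral>\<^sup>+x. (\<Prod>i\<in>I. ennreal (f i (x i))) \<partial>gauss_PiM I)"
    using assms by (intro nn_integral_cong) (simp add: prod_ennreal)
  also have "\<dots> = (\<Prod>i\<in>I. (\<integral>\<^sup>+x. ennreal (f i x) \<partial>std_gauss))"
    using assms by (intro gauss_product.product_nn_integral_prod) auto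
  also have "\<dots> = ennreal (\<Prod>i\<in>I. c i)"
    using assms by (simp add: prod_ennreal)
  finally show ?thesis .
qed

lemma nn_integral_gauss_exp_sum_squares:
  assumes "finite I" "s < 1/2"
  shows "(\<integral>\<^sup>+x. ennreal (exp (s * (sqsum I x))) \<partial>gauss_PiM I)
    = ennreal ((1 - 2 * s) powr (- real (card I) / 2))"
proof -
  have "(\<integral>\<^sup>+x. ennreal (\<Prod>i\<in>I. exp (s * (x i)\<^sup>2)) \<partial>gauss_PiM I)
    = ennreal (\<Prod>i\<in>I. (1 - 2 * s) powr (-1/2))"
    using assms nn_integral_std_gauss_exp_quadratic[of s 0]
    by (intro nn_integral_gauss_PiM_prod) auto
  then show ?thesis
    using assms by (simp add: exp_sum sum_distrib_left powr_power)
qed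

lemma nn_integral_gauss_exp_linear:
  assumes "finite I"
  shows "(\<integral>\<^sup>+x. ennreal (exp (\<Sum>i\<in>I. c i * x i)) \<partial>gauss_PiM I)
    = ennreal (exp ((sqsum I c) / 2))"
proof -
  have "(\<integral>\<^sup>+x. ennreal (\<Prod>i\<in>I. exp (c i * x i)) \<partial>gauss_PiM I)
    = ennreal (\<Prod>i\<in>I. exp ((c i)\<^sup>2 / 2))"
    using assms nn_integral_std_gauss_exp_quadratic[of 0]
    by (intro nn_integral_gauss_PiM_prod) auto
  then show ?thesis
    using assms by (simp add: exp_sum sum_divide_distrib)
qed

lemma nn_integral_gauss_exp_shifted_squares:
  assumes "finite I" "s > 0"
  shows "(\<integral>\<^sup>+x. ennreal (exp (- s * (\<Sum>i\<in>I. (x i + u i)\<^sup>2))) \<partial>gauss_PiM I)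
    = ennreal ((1 + 2 * s) powr (- real (card I) / 2) * exp (- (s / (1 + 2 * s)) * (sqsum I u)))"
proof -
  have "(\<integral>\<^sup>+x. ennreal (\<Prod>i\<in>I. exp (- s * (x i + u i)\<^sup>2)) \<partial>gauss_PiM I)
    = ennreal (\<Prod>i\<in>I. (1 + 2 * s) powr (-1/2) * exp (- (s / (1 + 2 * s)) * (u i)\<^sup>2))"
    using assms nn_integral_std_gauss_exp_shift[of s]
    by (intro nn_integral_gauss_PiM_prod) auto
  moreover have "(\<Prod>i\<in>I. exp (- s * (x i + u i)\<^sup>2)) = exp (- s * (\<Sum>i\<in>I. (x i + u i)\<^sup>2))" for x
    using assms(1) by (simp only: exp_sum sum_distrib_left)
  moreover have "(\<Prod>i\<in>I. (1 + 2 * s) powr (-1/2) * exp (- (s / (1 + 2 * s)) * (u i)\<^sup>2))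
    = (1 + 2 * s) powr (- real (card I) / 2) * exp (- (s / (1 + 2 * s)) * (sqsum I u))"
    using assms by (simp only: prod.distrib prod_constant exp_sum[symmetric] sum_distrib_left[symmetric])
      (simp add: powr_power)
  ultimately show ?thesis by simp
qed

section \<open>Moments of chi-square and normal variables\<close>

definition xlnx :: "real \<Rightarrow> real" where
  "xlnx x = x * ln x"

text \<open>This is \<open>(d + 2 * p) powr ((d + 2 * p) / 2) * d powr (- d / 2) * exp (-
  p)\<close>, an upper bound for the p-th moment of a chi-square variable with \<open>d\<close>
  degrees of freedom.\<close>

abbreviation chi_moment :: "nat \<Rightarrow> nat \<Rightarrow> real" where
  "chi_moment d p \<equiv> exp ((xlnx (real d + 2 * real p) - xlnx (real d)) / 2 - real p)"

text \<open>The Stirling value \<open>(2 * p) ^ p * exp (- p)\<close> of the 2p-th moment of a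
  standard normal variable, lowered by a linear factor so as to be a true lower bound.\<close>

abbreviation normal_moment :: "nat \<Rightarrow> real" where
  "normal_moment p \<equiv> exp (xlnx (2 * real p) / 2 - real p) / (2 * real p + 1)"

text \<open>This is \<open>1 + y \<le> exp y\<close> at \<open>y = s * t / p - 1\<close>, raised to
  the power \<open>p\<close>.\<close>

lemma power_le_exp_mult:
  fixes s t :: real
  assumes "s > 0" "t \<ge> 0" "p > 0"
  shows "t ^ p \<le> (real p / s) ^ p * exp (s * t - real p)"
proof -
  have "s * t / real p \<le> exp (s * t / real p - 1)"
    using exp_ge_add_one_self[of "s * t / real p - 1"] by simp
  then have "(s * t / real p) ^ p \<le> exp (s * t / real p - 1) ^ p"
    using assms by (intro power_mono) auto
  also have "\<dots> = exp (s * t - real p)"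
    using assms by (simp add: exp_of_nat_mult[symmetric] right_diff_distrib)
  finally have "(real p / s) ^ p * (s * t / real p) ^ p \<le> (real p / s) ^ p * exp (s * t - real p)"
    using assms by (intro mult_left_mono) auto
  then show ?thesis
    using assms by (simp add: power_mult_distrib[symmetric])
qed

text \<open>Optimising the exponential moment bound over \<open>s\<close> leads to \<open>s = p / (d + 2 * p)\<close>.\<close>

lemma nn_integral_power_le_of_chi_square_mgf:
  fixes Y :: "'a \<Rightarrow> real" and d p :: nat
  assumes [measurable]: "Y \<in> borel_measurable M"
    and nonneg: "\<And>x. Y x \<ge> 0" and d: "d > 0" and p: "p > 0"
    and mgf: "\<And>s. 0 < s \<Longrightarrow> s < 1/2 \<Longrightarrow>
      (\<integral>\<^sup>+x. ennreal (exp (s * Y x)) \<partial>M) = ennreal ((1 - 2 * s) powr (- real d / 2))"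
  shows "(\<integral>\<^sup>+x. ennreal (Y x ^ p) \<partial>M)
    \<le> ennreal (chi_moment d p)"
proof -
  define D where "D = real d + 2 * real p"
  define s where "s = real p / D"
  have D: "D > 0" "D > 2 * real p" using d p by (auto simp: D_def)
  have s: "0 < s" "s < 1/2" "1 - 2 * s = real d / D" "real p / s = D"
    using d p D by (auto simp: s_def D_def field_simps)
  have "(\<integral>\<^sup>+x. ennreal (Y x ^ p) \<partial>M)
      \<le> (\<integral>\<^sup>+x. ennreal (D ^ p * exp (- real p)) * ennreal (exp (s * Y x)) \<partial>M)"
  proof (intro nn_integral_mono)
    fix x
    have "Y x ^ p \<le> D ^ p * exp (s * Y x - real p)"
      using power_le_exp_mult[OF s(1) nonneg[of x] p] s(4) by simp
    also have "\<dots> = D ^ p * exp (- real p) * exp (s * Y x)"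
      by (simp add: exp_diff exp_minus divide_inverse)
    finally show "ennreal (Y x ^ p) \<le> ennreal (D ^ p * exp (- real p)) * ennreal (exp (s * Y x))"
      using D by (simp add: ennreal_mult[symmetric] ennreal_leI)
  qed
  also have "\<dots> = ennreal (D ^ p * exp (- real p)) * (\<integral>\<^sup>+x. ennreal (exp (s * Y x)) \<partial>M)"
    by (intro nn_integral_cmult) auto
  also have "\<dots> = ennreal (D ^ p * exp (- real p) * (1 - 2 * s) powr (- real d / 2))"
    using s D by (subst mgf) (auto simp: ennreal_mult)
  also have "D ^ p * exp (- real p) * (1 - 2 * s) powr (- real d / 2)
      = exp (real p * ln D) * exp (- real p) * exp ((- real d / 2) * (ln (real d) - ln D))"
    using D d by (simp add: s(3) powr_def ln_div exp_of_nat_mult)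
  also have "\<dots> = chi_moment d p"
    unfolding exp_add[symmetric] D_def[symmetric] xlnx_def
    by (rule arg_cong[of _ _ exp]) (simp add: D_def field_simps)
  finally show ?thesis .
qed

lemma nn_integral_gauss_sum_squares_power_le:
  assumes "finite I" "I \<noteq> {}" "p > 0"
  shows "(\<integral>\<^sup>+x. ennreal ((sqsum I x) ^ p) \<partial>gauss_PiM I)
    \<le> ennreal (chi_moment (card I) p)"
  using assms
  by (intro nn_integral_power_le_of_chi_square_mgf nn_integral_gauss_exp_sum_squares)
     (auto simp: card_gt_0_iff intro!: sum_nonneg)

text \<open>The square in the exponent is linearised by an auxiliary Gaussian vector \<open>h\<close>, since
  \<open>exp (s * y\<^sup>2)\<close> is the expectation of \<open>exp (sqrt (2 * s) * h * y)\<close>. Then the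
  entries of \<open>B\<close> only occur linearly and can be integrated out first.\<close>

lemma nn_integral_gauss_matrix_exp:
  fixes u :: "'b \<Rightarrow> real"
  assumes I: "finite I" and J: "finite J" and u: "sqsum J u = 1" and s: "0 < s" "s < 1/2"
  shows "(\<integral>\<^sup>+B. ennreal (exp (s * (matsq I J B u))) \<partial>gauss_PiM (I \<times> J))
    = ennreal ((1 - 2 * s) powr (- real (card I) / 2))"
proof -
  let ?G = "gauss_PiM (I \<times> J)" and ?H = "gauss_PiM I"
  interpret G: prob_space ?G by (rule prob_space_gauss_PiM)
  interpret H: prob_space ?H by (rule prob_space_gauss_PiM)
  interpret GH: pair_sigma_finite ?G ?H by standard
  let ?f = "\<lambda>B h. ennreal (exp (\<Sum>i\<in>I. (sqrt (2 * s) * (\<Sum>j\<in>J. B (i, j) * u j)) * h i))"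
  have [measurable]: "case_prod ?f \<in> borel_measurable (?G \<Otimes>\<^sub>M ?H)"
    by measurable
  have 1: "ennreal (exp (s * (matsq I J B u))) = (\<integral>\<^sup>+h. ?f B h \<partial>?H)" for B
    using s by (subst nn_integral_gauss_exp_linear[OF I])
      (simp add: power_mult_distrib sum_distrib_left[symmetric])
  have 2: "(\<integral>\<^sup>+B. ?f B h \<partial>?G) = ennreal (exp (s * (sqsum I h)))" for h :: "'a \<Rightarrow> real"
  proof -
    have "?f B h = ennreal (exp (\<Sum>ij\<in>I \<times> J. (sqrt (2 * s) * h (fst ij) * u (snd ij)) * B ij))" for B
      by (simp add: sum.cartesian_product' sum_distrib_left sum_distrib_right mult_ac)
    then have "(\<integral>\<^sup>+B. ?f B h \<partial>?G)
        = ennreal (exp ((\<Sum>ij\<in>I \<times> J. (sqrt (2 * s) * h (fst ij) * u (snd ij))\<^sup>2) / 2))"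
      using I J by (simp only: nn_integral_gauss_exp_linear finite_cartesian_product)
    also have "(\<Sum>ij\<in>I \<times> J. (sqrt (2 * s) * h (fst ij) * u (snd ij))\<^sup>2)
        = 2 * s * ((sqsum I h) * (sqsum J u))"
      unfolding sum_product sum.cartesian_product'
      using s by (simp add: power_mult_distrib sum_distrib_left mult_ac)
    finally show ?thesis by (simp add: u)
  qed
  have "(\<integral>\<^sup>+B. ennreal (exp (s * (matsq I J B u))) \<partial>?G)
      = (\<integral>\<^sup>+B. (\<integral>\<^sup>+h. ?f B h \<partial>?H) \<partial>?G)"
    by (simp only: 1)
  also have "\<dots> = (\<integral>\<^sup>+h. (\<integral>\<^sup>+B. ?f B h \<partial>?G) \<partial>?H)"
    by (rule GH.Fubini'[symmetric]) measurable
  also have "\<dots> = ennreal ((1 - 2 * s) powr (- real (card I) / 2))"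
    using I s unfolding 2 by (subst nn_integral_gauss_exp_sum_squares) auto
  finally show ?thesis .
qed

text \<open>Both sides are homogeneous of degree \<open>2 * p\<close> in \<open>x\<close>, so it
  suffices to treat the unit vector \<open>u\<close>, for which |B u|^2 has the generating function
  of a chi-square variable with \<open>card I\<close> degrees of freedom. The zero vector cannot be
  normalised, but makes the left side zero because \<open>p > 0\<close>.\<close>

lemma nn_integral_gauss_matrix_power_le:
  fixes x :: "'b \<Rightarrow> real"
  assumes I: "finite I" "I \<noteq> {}" and J: "finite J" and p: "p > 0"
  shows "(\<integral>\<^sup>+B. ennreal ((matsq I J B x) ^ p) \<partial>gauss_PiM (I \<times> J))
    \<le> ennreal (chi_moment (card I) p)
      * ennreal ((sqsum J x) ^ p)"
proof (cases "sqsum J x = 0")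
  case True
  then have "x j = 0" if "j \<in> J" for j
    using J that by (simp add: sum_nonneg_eq_0_iff)
  then show ?thesis using p by (simp add: zero_power)
next
  case False
  define r where "r = sqsum J x"
  have r: "r > 0" using False by (simp add: r_def order_less_le sum_nonneg)
  define u where "u j = x j / sqrt r" for j
  have u: "sqsum J u = 1"
    using r by (simp add: u_def power_divide sum_divide_distrib[symmetric] r_def[symmetric])
  have eq: "matsq I J B x = r * matsq I J B u" for B
    using r by (simp add: u_def sum_divide_distrib[symmetric] power_divide)
  let ?G = "gauss_PiM (I \<times> J)"
  let ?c = "chi_moment (card I) p"
  have meas: "(\<lambda>B. \<Sum>i\<in>I. (\<Sum>j\<in>J. B (i, j) * u j)\<^sup>2) \<in> borel_measurable ?G"
    by measurable
  have "(\<integral>\<^sup>+B. ennreal ((matsq I J B x) ^ p) \<partial>?G)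
     = (\<integral>\<^sup>+B. ennreal (r ^ p) * ennreal ((matsq I J B u) ^ p) \<partial>?G)"
    unfolding eq using r by (simp add: power_mult_distrib ennreal_mult sum_nonneg)
  also have "\<dots> = ennreal (r ^ p) * (\<integral>\<^sup>+B. ennreal ((matsq I J B u) ^ p) \<partial>?G)"
    using meas by (intro nn_integral_cmult) measurable
  also have "\<dots> \<le> ennreal (r ^ p) * ennreal ?c"
  proof (intro mult_left_mono)
    show "(\<integral>\<^sup>+B. ennreal ((matsq I J B u) ^ p) \<partial>?G) \<le> ennreal ?c"
    using I J p meas nn_integral_gauss_matrix_exp[OF I(1) J u]
    by (intro nn_integral_power_le_of_chi_square_mgf) (auto simp: card_gt_0_iff intro!: sum_nonneg)
  qed simp
  also have "\<dots> = ennreal ?c * ennreal ((sqsum J x) ^ p)"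
    unfolding r_def by (rule mult.commute)
  finally show ?thesis .
qed

section \<open>Linear forms in Gaussian variables\<close>

lemma distributed_gauss_component:
  assumes "i \<in> I"
  shows "distributed (gauss_PiM I) lborel (\<lambda>x. x i) std_normal_density"
proof -
  have "distr (gauss_PiM I) std_gauss (\<lambda>x. x i) = std_gauss"
    using assms by (intro distr_PiM_component prob_space_std_gauss)
  then have "distr (gauss_PiM I) lborel (\<lambda>x. x i) = std_gauss"
    by (metis distr_cong sets_lborel sets_std_gauss)
  then show ?thesis
    using assms unfolding distributed_def std_gauss_def[symmetric] by auto
qed

lemma indep_vars_gauss_components:
  assumes "I \<noteq> {}"
  shows "prob_space.indep_vars (gauss_PiM I) (\<lambda>_. borel) (\<lambda>i x. x i) I"
proof -
  interpret G: prob_space "gauss_PiM I" by (rule prob_space_gauss_PiM)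
  have d: "distr (gauss_PiM I) borel (\<lambda>x. x i) = std_gauss" if "i \<in> I" for i
    using distributed_gauss_component[OF that]
    by (metis distr_cong distributed_distr_eq_density sets_lborel std_gauss_def)
  have "distr (gauss_PiM I) (PiM I (\<lambda>_. borel)) (\<lambda>x. \<lambda>i\<in>I. x i)
      = distr (gauss_PiM I) (gauss_PiM I) (\<lambda>x. x)"
    by (intro distr_cong sets_PiM_cong refl) (auto simp: space_PiM PiE_def extensional_restrict)
  also have "\<dots> = PiM I (\<lambda>i. distr (gauss_PiM I) borel (\<lambda>x. x i))"
    using d by (simp add: distr_id cong: PiM_cong)
  finally show ?thesis
    using assms by (subst G.indep_vars_iff_distr_eq_PiM') auto
qed

text \<open>The form is normal with variance \<open>sqsum J v\<close>, so its even moments are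
  explicit. They see only the length of \<open>v\<close>, which makes the unknown bad direction
  harmless in both tails.\<close>

lemma nn_integral_gauss_linear_power:
  assumes "finite J" "p > 0"
  shows "(\<integral>\<^sup>+x. ennreal ((\<Sum>j\<in>J. v j * x j) ^ (2 * p)) \<partial>gauss_PiM J)
    = ennreal ((sqsum J v) ^ p * (fact (2 * p) / (2 ^ p * fact p)))"
proof -
  \<comment> \<open>Zero coefficients are dropped since a normal density needs a positive standard
    deviation.\<close>
  define K where "K = {j \<in> J. v j \<noteq> 0}"
  have K: "finite K" "K \<subseteq> J" using assms by (auto simp: K_def)
  have sum_K: "(\<Sum>j\<in>J. v j * x j) = (\<Sum>j\<in>K. v j * x j)" "sqsum J v = sqsum K v" for x
    using assms by (auto simp: K_def intro!: sum.mono_neutral_right)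
  show ?thesis
  proof (cases "K = {}")
    case True
    then show ?thesis using assms by (simp add: sum_K zero_power)
  next
    case False
    let ?G = "gauss_PiM J"
    interpret G: prob_space ?G by (rule prob_space_gauss_PiM)
    define \<sigma> where "\<sigma> = sqrt (sqsum K v)"
    have \<sigma>: "\<sigma> > 0" "\<sigma>\<^sup>2 = sqsum K v"
      using False K by (auto simp: \<sigma>_def K_def intro!: sum_pos sum_nonneg)
    have "G.indep_vars (\<lambda>_. borel) (\<lambda>i x. x i) J"
      using False K by (intro indep_vars_gauss_components) auto
    then have "G.indep_vars (\<lambda>_. borel) (\<lambda>i x. x i) K"
      using K by (rule_tac G.indep_vars_subset)
    then have "G.indep_vars (\<lambda>_. borel) (\<lambda>i. (\<lambda>y. v i * y) \<circ> (\<lambda>x. x i)) K"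
      by (rule G.indep_vars_compose) auto
    then have ind: "G.indep_vars (\<lambda>_. borel) (\<lambda>i x. v i * x i) K"
      by (simp add: comp_def)
    have dist: "distributed ?G lborel (\<lambda>x. v j * x j) (normal_density 0 \<bar>v j\<bar>)" if "j \<in> K" for j
      using that K G.normal_density_affine[OF distributed_gauss_component[of j J], of "v j" 0]
      by (auto simp: K_def)
    have "distributed ?G lborel (\<lambda>x. \<Sum>j\<in>K. v j * x j) (normal_density (\<Sum>j\<in>K. 0) (sqrt (\<Sum>j\<in>K. \<bar>v j\<bar>\<^sup>2)))"
      using K False ind dist by (intro G.sum_indep_normal) (auto simp: K_def)
    then have D: "distributed ?G lborel (\<lambda>x. \<Sum>j\<in>K. v j * x j) (normal_density 0 \<sigma>)"
      by (simp add: \<sigma>_def)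
    have "(\<integral>\<^sup>+x. ennreal ((\<Sum>j\<in>J. v j * x j) ^ (2 * p)) \<partial>?G)
        = (\<integral>\<^sup>+y. ennreal (normal_density 0 \<sigma> y) * ennreal (y ^ (2 * p)) \<partial>lborel)"
      unfolding sum_K by (subst distributed_nn_integral[OF D, symmetric]) auto
    also have "\<dots> = (\<integral>\<^sup>+y. ennreal (normal_density 0 \<sigma> y * (y - 0) ^ (2 * p)) \<partial>lborel)"
      by (simp add: ennreal_mult)
    also have "\<dots> = ennreal (fact (2 * p) / ((2 / \<sigma>\<^sup>2) ^ p * fact p))"
      using normal_moment_even[OF \<sigma>(1), of 0 p]
      by (subst nn_integral_eq_integral) (auto simp: has_bochner_integral_iff)
    also have "fact (2 * p) / ((2 / \<sigma>\<^sup>2) ^ p * fact p) = (\<sigma>\<^sup>2) ^ p * (fact (2 * p) / (2 ^ p * fact p))"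
      using \<sigma>(1) by (simp add: power_divide)
    finally show ?thesis by (simp only: sum_K \<sigma>)
  qed
qed

text \<open>\<open>p ^ p / fact p\<close> is one term of the series for
  \<open>exp p\<close>.\<close>

lemma power_div_exp_le_fact: "real p ^ p / exp (real p) \<le> fact p"
proof -
  have "summable (\<lambda>n. real p ^ n / fact n)"
    using summable_exp[of "real p"] by (simp add: divide_inverse mult_ac)
  then have "sum (\<lambda>n. real p ^ n / fact n) {p} \<le> (\<Sum>n. real p ^ n / fact n)"
    by (intro sum_le_suminf) auto
  also have "\<dots> = exp (real p)"
    by (simp add: exp_def divide_inverse scaleR_conv_of_real mult_ac)
  finally show ?thesis by (simp add: field_simps)
qed

text \<open>The moment equals \<open>(2 * p choose p) * fact p / 2 ^ p\<close>. The central binomial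
  coefficient is at least \<open>4 ^ p / (2 * p)\<close>, and the factorial is at least
  \<open>p ^ p / exp p\<close>.\<close>

lemma gaussian_even_moment_ge:
  assumes "p > 0"
  shows "normal_moment p \<le> fact (2 * p) / (2 ^ p * fact p)"
proof -
  have f: "fact (2 * p) = real (2 * p choose p) * (fact p * fact p)"
    using binomial_fact_lemma[of p "2 * p"] by (metis le_add2 mult.commute mult_2 diff_add_inverse2 of_nat_fact of_nat_mult)
  have "exp (xlnx (2 * real p) / 2 - real p) = (2 * real p) ^ p / exp (real p)"
    using assms by (simp add: xlnx_def exp_diff exp_of_nat_mult)
  then have "normal_moment p \<le> (2 * real p) ^ p / exp (real p) / (2 * real p)"
    using assms by (simp add: divide_left_mono)
  also have "\<dots> = 2 ^ p / (2 * real p) * (real p ^ p / exp (real p))"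
    by (simp add: power_mult_distrib)
  also have "\<dots> \<le> 2 ^ p / (2 * real p) * fact p"
    by (intro mult_left_mono power_div_exp_le_fact) auto
  also have "\<dots> = (4 ^ p / (2 * real p)) * fact p / 2 ^ p"
    using power_mult_distrib[of "2::real" 2 p] by (simp add: field_simps)
  also have "\<dots> \<le> real (2 * p choose p) * fact p / 2 ^ p"
    using assms by (intro divide_right_mono mult_right_mono central_binomial_lower_bound) auto
  also have "\<dots> = fact (2 * p) / (2 ^ p * fact p)"
    by (simp add: f)
  finally show ?thesis .
qed

section \<open>Upper tail of a Gaussian matrix\<close>

text \<open>\<open>E\<close> is the set where the moment \<open>S\<close> over \<open>x\<close>
  reaches the value forced by an expanded vector. As a superlevel set of \<open>S\<close> it is
  measurable, Markov's inequality bounds its measure, and Fubini computes the mean of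
  \<open>S\<close> by integrating over \<open>B\<close> before \<open>x\<close>. The matrices that
  expand some \<open>v\<close> are only shown to lie in \<open>E\<close>.\<close>

lemma gauss_matrix_upper_tail:
  fixes I :: "'a set" and J :: "'b set" and T :: real
  assumes I: "finite I" "I \<noteq> {}" and J: "finite J" "J \<noteq> {}" and p: "p > 0" and T: "T > 0"
  shows "\<exists>E \<in> sets (gauss_PiM (I \<times> J)).
    emeasure (gauss_PiM (I \<times> J)) E
      \<le> ennreal (chi_moment (card I) p
          * chi_moment (card J) p
          / (T ^ p * (normal_moment p))) \<and>
    (\<forall>B \<in> space (gauss_PiM (I \<times> J)). \<forall>v.
      (sqsum J v) > 0 \<longrightarrow> T * sqsum J v \<le> matsq I J B v \<longrightarrow> B \<in> E)"
proof -
  let ?G = "gauss_PiM (I \<times> J)" and ?H = "gauss_PiM J"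
  interpret G: prob_space ?G by (rule prob_space_gauss_PiM)
  interpret H: prob_space ?H by (rule prob_space_gauss_PiM)
  interpret GH: pair_sigma_finite ?G ?H by standard
  define c1 where "c1 = chi_moment (card I) p"
  define c2 where "c2 = chi_moment (card J) p"
  define c3 where "c3 = normal_moment p"
  define mp where "mp = (fact (2 * p) / (2 ^ p * fact p) :: real)"
  have c: "c1 > 0" "c2 > 0" "c3 > 0" "mp > 0" "c3 \<le> mp"
    using gaussian_even_moment_ge[OF p] by (auto simp: c1_def c2_def c3_def mp_def)
  define S where "S B = (\<integral>\<^sup>+x. ennreal ((matsq I J B x) ^ p) \<partial>?H)" for B
  have meas: "(\<lambda>(B, x). ennreal ((matsq I J B x) ^ p)) \<in> borel_measurable (?G \<Otimes>\<^sub>M ?H)"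
    by measurable
  have S_meas [measurable]: "S \<in> borel_measurable ?G"
    unfolding S_def using meas by (intro H.borel_measurable_nn_integral) simp
  have "(\<integral>\<^sup>+B. S B \<partial>?G) = (\<integral>\<^sup>+x. (\<integral>\<^sup>+B. ennreal ((matsq I J B x) ^ p) \<partial>?G) \<partial>?H)"
    unfolding S_def by (rule GH.Fubini'[symmetric]) (rule meas)
  also have "\<dots> \<le> (\<integral>\<^sup>+x. ennreal c1 * ennreal ((sqsum J x) ^ p) \<partial>?H)"
    unfolding c1_def using I J p by (intro nn_integral_mono nn_integral_gauss_matrix_power_le)
  also have "\<dots> = ennreal c1 * (\<integral>\<^sup>+x. ennreal ((sqsum J x) ^ p) \<partial>?H)"
    by (intro nn_integral_cmult) measurable
  also have "\<dots> \<le> ennreal c1 * ennreal c2"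
    unfolding c2_def using J p by (intro mult_left_mono nn_integral_gauss_sum_squares_power_le) auto
  finally have S_le: "(\<integral>\<^sup>+B. S B \<partial>?G) \<le> ennreal (c1 * c2)"
    using c by (simp add: ennreal_mult)
  define E where "E = {B \<in> space ?G. 1 \<le> ennreal (1 / (T ^ p * mp)) * S B}"
  have E: "E \<in> sets ?G" unfolding E_def by measurable
  have "emeasure ?G E \<le> ennreal (1 / (T ^ p * mp)) * (\<integral>\<^sup>+B. S B * indicator (space ?G) B \<partial>?G)"
    using nn_integral_Markov_inequality[of S "space ?G" ?G "ennreal (1 / (T ^ p * mp))"]
    by (simp add: E_def)
  also have "(\<integral>\<^sup>+B. S B * indicator (space ?G) B \<partial>?G) = (\<integral>\<^sup>+B. S B \<partial>?G)"
    by (intro nn_integral_cong) simp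
  also have "ennreal (1 / (T ^ p * mp)) * (\<integral>\<^sup>+B. S B \<partial>?G) \<le> ennreal (1 / (T ^ p * mp)) * ennreal (c1 * c2)"
    by (intro mult_left_mono S_le) auto
  also have "\<dots> = ennreal (c1 * c2 / (T ^ p * mp))"
    using c T by (simp add: ennreal_mult[symmetric])
  also have "\<dots> \<le> ennreal (c1 * c2 / (T ^ p * c3))"
    using c T by (intro ennreal_leI divide_left_mono mult_left_mono mult_pos_pos) auto
  finally have E_le: "emeasure ?G E \<le> ennreal (c1 * c2 / (T ^ p * c3))" .
  have "B \<in> E" if B: "B \<in> space ?G" and v: "sqsum J v > 0"
    and le: "T * sqsum J v \<le> matsq I J B v" for B v
  proof -
    define w where "w i = (\<Sum>j\<in>J. B (i, j) * v j)" for i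
    define a where "a = sqsum I w"
    have le': "T * sqsum J v \<le> a" using le by (simp add: a_def w_def)
    then have a: "a > 0" using T v by (meson less_le_trans mult_pos_pos)
    \<comment> \<open>\<open>v'\<close> is the transpose of \<open>B\<close> applied to the unit
      vector along \<open>B v\<close>. Hence \<open>\<Sum>j\<in>J. v' j * x j\<close> is the
      component of \<open>B x\<close> along \<open>B v\<close>, and its square is at most |B
      x|^2.\<close>
    define v' where "v' j = (\<Sum>i\<in>I. B (i, j) * w i) / sqrt a" for j
    have 1: "(\<Sum>j\<in>J. v' j * x j) ^ (2 * p) \<le> (matsq I J B x) ^ p" for x
    proof -
      have "(\<Sum>j\<in>J. v' j * x j) = (\<Sum>j\<in>J. \<Sum>i\<in>I. w i * (B (i, j) * x j)) / sqrt a"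
        by (simp add: v'_def sum_distrib_left sum_distrib_right sum_divide_distrib mult_ac)
      also have "(\<Sum>j\<in>J. \<Sum>i\<in>I. w i * (B (i, j) * x j)) = (\<Sum>i\<in>I. w i * (\<Sum>j\<in>J. B (i, j) * x j))"
        by (subst sum.swap) (simp add: sum_distrib_left)
      finally have "(\<Sum>j\<in>J. v' j * x j)\<^sup>2 = (\<Sum>i\<in>I. w i * (\<Sum>j\<in>J. B (i, j) * x j))\<^sup>2 / a"
        using a by (simp add: power_divide)
      also have "\<dots> \<le> (a * (matsq I J B x)) / a"
        unfolding a_def by (intro divide_right_mono Cauchy_Schwarz_ineq_sum sum_nonneg) auto
      finally have "(\<Sum>j\<in>J. v' j * x j)\<^sup>2 \<le> matsq I J B x"
        using a by simp
      then show ?thesis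
        by (simp only: power_mult) (intro power_mono, auto)
    qed
    have "a\<^sup>2 = (\<Sum>j\<in>J. v j * (\<Sum>i\<in>I. B (i, j) * w i))\<^sup>2"
    proof -
      \<comment> \<open>|B v|^2 is the inner product of \<open>v\<close> with the transpose of
        \<open>B\<close> applied to \<open>B v\<close>. Cauchy-Schwarz then shows that the transpose
        expands the direction of \<open>B v\<close> at least as much as \<open>B\<close> expands
        \<open>v\<close>, so |v'|^2 is at least \<open>T\<close>.\<close>
      have "a = (\<Sum>i\<in>I. \<Sum>j\<in>J. v j * (B (i, j) * w i))"
        unfolding a_def power2_eq_square
        by (subst (2) w_def) (simp add: sum_distrib_left mult_ac)
      also have "\<dots> = (\<Sum>j\<in>J. v j * (\<Sum>i\<in>I. B (i, j) * w i))"
        by (subst sum.swap) (simp add: sum_distrib_left)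
      finally show ?thesis by simp
    qed
    also have "\<dots> \<le> (sqsum J v) * (\<Sum>j\<in>J. (\<Sum>i\<in>I. B (i, j) * w i)\<^sup>2)"
      by (rule Cauchy_Schwarz_ineq_sum)
    also have "(\<Sum>j\<in>J. (\<Sum>i\<in>I. B (i, j) * w i)\<^sup>2) = a * sqsum J v'"
      using a by (simp add: v'_def power_divide sum_divide_distrib[symmetric])
    finally have "a \<le> (sqsum J v) * sqsum J v'"
      using a by (simp add: power2_eq_square mult.left_commute)
    with le' have "T * sqsum J v \<le> (sqsum J v') * sqsum J v"
      by (simp add: mult.commute)
    then have v': "T \<le> sqsum J v'"
      using v by simp
    have "ennreal (T ^ p * mp) \<le> ennreal ((sqsum J v') ^ p * mp)"
      using c T v' by (intro ennreal_leI mult_right_mono power_mono) auto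
    also have "\<dots> = (\<integral>\<^sup>+x. ennreal ((\<Sum>j\<in>J. v' j * x j) ^ (2 * p)) \<partial>?H)"
      using J p by (simp add: nn_integral_gauss_linear_power mp_def)
    also have "\<dots> \<le> S B"
      unfolding S_def by (intro nn_integral_mono ennreal_leI 1)
    finally have "ennreal (1 / (T ^ p * mp)) * ennreal (T ^ p * mp) \<le> ennreal (1 / (T ^ p * mp)) * S B"
      by (intro mult_left_mono) auto
    moreover have "ennreal (1 / (T ^ p * mp)) * ennreal (T ^ p * mp) = 1"
      using c T by (simp add: ennreal_mult[symmetric])
    ultimately show ?thesis using B by (simp add: E_def)
  qed
  then show ?thesis
    using E E_le unfolding c1_def c2_def c3_def by blast
qed

section \<open>Lower tail of a Gaussian matrix\<close>

text \<open>The induction peels off one coordinate at a time and applies the one-dimensional affine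
  substitution. Translations combined with one common dilation are all that the lower tail requires.
  Restricting the substituted point to \<open>I\<close> keeps it in the space of the product
  measure.\<close>

lemma nn_integral_lborel_PiM_affine:
  fixes c :: real and t :: "'i \<Rightarrow> real"
  assumes "finite I" "c \<noteq> 0" "F \<in> borel_measurable (lborel_PiM I)"
  shows "(\<integral>\<^sup>+x. F x \<partial>lborel_PiM I)
    = ennreal (\<bar>c\<bar> ^ card I) * (\<integral>\<^sup>+x. F (\<lambda>i\<in>I. t i + c * x i) \<partial>lborel_PiM I)"
  using assms(1,3)
proof (induction I arbitrary: F rule: finite_induct)
  case empty
  have "(\<lambda>i\<in>{}. t i + c * x i) = (\<lambda>_. undefined)" for x by auto
  then show ?case by (simp add: PiM_empty nn_integral_count_space_finite)
next
  case (insert i I)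
  note [measurable] = insert.prems
  let ?L = "\<lambda>I. lborel_PiM I"
  interpret L: finite_product_sigma_finite "\<lambda>_. lborel :: real measure" I by standard (rule insert.hyps)
  have upd [measurable]: "(\<lambda>p. (fst p)(i := t i + c * snd p)) \<in> measurable (?L I \<Otimes>\<^sub>M lborel) (?L (insert i I))"
    by (rule measurable_fun_upd[where J = I]) (auto intro: measurable_fst)
  have m1: "(\<lambda>y. F (x(i := y))) \<in> borel_measurable borel" if "x \<in> space (?L I)" for x
    using measurable_comp[OF measurable_component_update insert.prems, OF that \<open>i \<notin> I\<close>]
    by (simp add: comp_def fun_upd_def)
  have m2: "(\<lambda>x. \<integral>\<^sup>+y. F (x(i := t i + c * y)) \<partial>lborel) \<in> borel_measurable (?L I)"
    using measurable_comp[OF upd insert.prems]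
    by (intro lborel.borel_measurable_nn_integral) (simp add: comp_def split_beta')
  have "(\<lambda>x. \<lambda>j\<in>insert i I. t j + c * x j) \<in> measurable (?L (insert i I)) (?L (insert i I))"
    by measurable
  then have m3: "(\<lambda>x. F (\<lambda>j\<in>insert i I. t j + c * x j)) \<in> borel_measurable (?L (insert i I))"
    by measurable
  have "(\<integral>\<^sup>+x. F x \<partial>?L (insert i I)) = (\<integral>\<^sup>+x. (\<integral>\<^sup>+y. F (x(i := y)) \<partial>lborel) \<partial>?L I)"
    using insert by (intro lborel_product.product_nn_integral_insert) auto
  also have "\<dots> = (\<integral>\<^sup>+x. ennreal \<bar>c\<bar> * (\<integral>\<^sup>+y. F (x(i := t i + c * y)) \<partial>lborel) \<partial>?L I)"
    using assms(2) m1 by (intro nn_integral_cong nn_integral_real_affine) auto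
  also have "\<dots> = ennreal \<bar>c\<bar> * (\<integral>\<^sup>+x. (\<integral>\<^sup>+y. F (x(i := t i + c * y)) \<partial>lborel) \<partial>?L I)"
    using m2 by (intro nn_integral_cmult)
  also have "(\<integral>\<^sup>+x. (\<integral>\<^sup>+y. F (x(i := t i + c * y)) \<partial>lborel) \<partial>?L I)
      = ennreal (\<bar>c\<bar> ^ card I) * (\<integral>\<^sup>+x. (\<integral>\<^sup>+y. F ((\<lambda>j\<in>I. t j + c * x j)(i := t i + c * y)) \<partial>lborel) \<partial>?L I)"
    by (rule insert.IH[OF m2])
  also have "(\<integral>\<^sup>+x. (\<integral>\<^sup>+y. F ((\<lambda>j\<in>I. t j + c * x j)(i := t i + c * y)) \<partial>lborel) \<partial>?L I)
      = (\<integral>\<^sup>+x. (\<integral>\<^sup>+y. F (\<lambda>j\<in>insert i I. t j + c * (x(i := y)) j) \<partial>lborel) \<partial>?L I)"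
    using insert.hyps by (intro nn_integral_cong arg_cong[where f = F]) auto
  also have "\<dots> = (\<integral>\<^sup>+x. F (\<lambda>j\<in>insert i I. t j + c * x j) \<partial>?L (insert i I))" (is "_ = ?rhs")
    using insert.hyps m3 by (intro lborel_product.product_nn_integral_insert[symmetric]) auto
  finally have "(\<integral>\<^sup>+x. F x \<partial>?L (insert i I)) = ennreal \<bar>c\<bar> * ennreal (\<bar>c\<bar> ^ card I) * ?rhs"
    by (simp only: mult.assoc)
  moreover have "ennreal \<bar>c\<bar> * ennreal (\<bar>c\<bar> ^ card I) = ennreal (\<bar>c\<bar> ^ card (insert i I))"
    using insert.hyps by (simp add: ennreal_mult)
  ultimately show ?case by (simp only:)
qed

definition gauss_density :: "'i set \<Rightarrow> ('i \<Rightarrow> real) \<Rightarrow> real" where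
  "gauss_density I x = (1 / sqrt (2 * pi)) ^ card I * exp (- (sqsum I x) / 2)"

lemma gauss_density_nonneg: "gauss_density I x \<ge> 0"
  by (simp add: gauss_density_def)

lemma gauss_density_measurable [measurable]:
  "gauss_density I \<in> borel_measurable (lborel_PiM I)"
  unfolding gauss_density_def by measurable

lemma prod_std_normal_density:
  assumes "finite I"
  shows "(\<Prod>i\<in>I. ennreal (std_normal_density (x i))) = ennreal (gauss_density I x)"
proof -
  have "(\<Prod>i\<in>I. std_normal_density (x i)) = gauss_density I x"
    using assms unfolding std_normal_density_def gauss_density_def
    by (simp add: prod.distrib exp_sum[symmetric] sum_negf sum_divide_distrib prod_dividef power_divide)
  then show ?thesis by (simp add: prod_ennreal)
qed

text \<open>A product measure is determined by its values on boxes, and on a box the integral of the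
  density splits into one-dimensional factors.\<close>

lemma gauss_PiM_eq_density:
  assumes "finite I"
  shows "gauss_PiM I = density (lborel_PiM I) (\<lambda>x. ennreal (gauss_density I x))"
proof (rule gauss_product.PiM_eqI[symmetric])
  let ?L = "lborel_PiM I"
  show "sets (density ?L (\<lambda>x. ennreal (gauss_density I x))) = sets (gauss_PiM I)"
    by (simp cong: sets_PiM_cong)
  fix A :: "'a \<Rightarrow> real set"
  assume A: "\<And>i. i \<in> I \<Longrightarrow> A i \<in> sets std_gauss"
  have S: "Pi\<^sub>E I A \<in> sets ?L"
    using A assms by (intro sets_PiM_I_finite) auto
  have "emeasure (density ?L (\<lambda>x. ennreal (gauss_density I x))) (Pi\<^sub>E I A)
      = (\<integral>\<^sup>+x. ennreal (gauss_density I x) * indicator (Pi\<^sub>E I A) x \<partial>?L)"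
    using S by (intro emeasure_density) auto
  also have "\<dots> = (\<integral>\<^sup>+x. (\<Prod>i\<in>I. ennreal (std_normal_density (x i)) * indicator (A i) (x i)) \<partial>?L)"
  proof (intro nn_integral_cong)
    fix x assume x: "x \<in> space ?L"
    have "indicator (Pi\<^sub>E I A) x = (\<Prod>i\<in>I. indicator (A i) (x i) :: ennreal)"
    proof (cases "\<forall>i\<in>I. x i \<in> A i")
      case True
      then show ?thesis using x by (auto simp: space_PiM PiE_def)
    next
      case False
      then show ?thesis using assms by (auto simp: prod_zero_iff indicator_def intro!: prod_zero[symmetric])
    qed
    then show "ennreal (gauss_density I x) * indicator (Pi\<^sub>E I A) x
        = (\<Prod>i\<in>I. ennreal (std_normal_density (x i)) * indicator (A i) (x i))"
      using assms by (simp add: prod.distrib prod_std_normal_density)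
  qed
  also have "\<dots> = (\<Prod>i\<in>I. \<integral>\<^sup>+x. ennreal (std_normal_density x) * indicator (A i) x \<partial>lborel)"
    using A assms by (intro lborel_product.product_nn_integral_prod) auto
  also have "\<dots> = (\<Prod>i\<in>I. emeasure std_gauss (A i))"
    using A unfolding std_gauss_def by (intro prod.cong refl emeasure_density[symmetric]) auto
  finally show "emeasure (density ?L (\<lambda>x. ennreal (gauss_density I x))) (Pi\<^sub>E I A)
      = (\<Prod>i\<in>I. emeasure std_gauss (A i))" .
qed fact

lemma nn_integral_gauss_PiM_eq:
  assumes "finite I" "F \<in> borel_measurable (lborel_PiM I)"
  shows "(\<integral>\<^sup>+x. F x \<partial>gauss_PiM I)
    = (\<integral>\<^sup>+x. ennreal (gauss_density I x) * F x \<partial>lborel_PiM I)"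
  unfolding gauss_PiM_eq_density[OF assms(1)] using assms by (intro nn_integral_density) auto

lemma gauss_density_restrict:
  "gauss_density I (restrict x I) = gauss_density I x"
  by (simp add: gauss_density_def)

text \<open>For a unit vector \<open>u\<close> this overwrites \<open>B u\<close> by
  \<open>g\<close> and leaves \<open>B\<close> unchanged on the orthogonal complement of
  \<open>u\<close>.\<close>

definition resample :: "'a set \<Rightarrow> 'b set \<Rightarrow> ('b \<Rightarrow> real) \<Rightarrow> ('a \<times> 'b \<Rightarrow> real) \<Rightarrow> ('a \<Rightarrow> real) \<Rightarrow> 'a \<times> 'b \<Rightarrow> real"
  where "resample I J u B g = (\<lambda>ij\<in>I \<times> J. B ij + (g (fst ij) - (\<Sum>j\<in>J. B (fst ij, j) * u j)) * u (snd ij))"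

text \<open>After passing to Lebesgue densities both sides only differ by translations of \<open>g\<close> and \<open>B\<close>.\<close>

lemma nn_integral_gauss_resample:
  fixes F :: "('a \<times> 'b \<Rightarrow> real) \<Rightarrow> ennreal"
  assumes I: "finite I" and J: "finite J" and u: "sqsum J u = 1"
    and F: "F \<in> borel_measurable (lborel_PiM (I \<times> J))"
  shows "(\<integral>\<^sup>+B. F B \<partial>gauss_PiM (I \<times> J))
    = (\<integral>\<^sup>+B. (\<integral>\<^sup>+g. F (resample I J u B g) \<partial>gauss_PiM I) \<partial>gauss_PiM (I \<times> J))"
proof -
  let ?p = "gauss_density (I \<times> J)" and ?r = "gauss_density I"
  let ?G = "lborel_PiM (I \<times> J)" and ?H = "lborel_PiM I"
  interpret G: finite_product_sigma_finite "\<lambda>_. lborel :: real measure" "I \<times> J" by standard (use I J in auto)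
  interpret H: finite_product_sigma_finite "\<lambda>_. lborel :: real measure" I by standard (use I in auto)
  interpret GH: pair_sigma_finite ?G ?H by standard
  note [measurable] = F
  have fin: "finite (I \<times> J)" using I J by simp
  have fst_in [simp]: "fst ij \<in> I" if "ij \<in> I \<times> J" for ij
    using that by auto
  define Bu where "Bu B i = (\<Sum>j\<in>J. B (i, j) * u j)" for B :: "'a \<times> 'b \<Rightarrow> real" and i
  have Bu_meas [measurable]: "(\<lambda>B. Bu B i) \<in> borel_measurable ?G" if "i \<in> I" for i
    unfolding Bu_def
  proof (intro borel_measurable_sum borel_measurable_times borel_measurable_const)
    fix j assume "j \<in> J"
    then show "(\<lambda>B. B (i, j)) \<in> borel_measurable ?G"
      using that measurable_component_singleton[of "(i, j)" "I \<times> J" "\<lambda>_. lborel :: real measure"] by simp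
  qed
  define add where "add B g = (\<lambda>ij\<in>I \<times> J. B ij + g (fst ij) * u (snd ij))" for B :: "'a \<times> 'b \<Rightarrow> real" and g :: "'a \<Rightarrow> real"
  have add_meas [measurable]: "case_prod add \<in> measurable (?G \<Otimes>\<^sub>M ?H) ?G"
    unfolding add_def by measurable
  have res: "resample I J u B g = add B (\<lambda>i. g i - Bu B i)" for B g
    by (auto simp: resample_def add_def Bu_def)
  have res_meas [measurable]: "(\<lambda>(B, g). resample I J u B g) \<in> measurable (?G \<Otimes>\<^sub>M ?H) ?G"
    unfolding resample_def by measurable
  \<comment> \<open>Row by row, with |u| = 1, both exponents equal |B_i|^2 + (g_i - <B_i, u>)^2 up
    to the factor -1/2: translating a row along \<open>u\<close> changes only its component along
    \<open>u\<close>.\<close>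
  have dens: "?p (\<lambda>ij\<in>I \<times> J. B ij - g (fst ij) * u (snd ij)) * ?r (Bu B)
      = ?p B * ?r (\<lambda>i. g i - Bu B i)" for B g
  proof -
    have row: "(\<Sum>j\<in>J. (B (i, j) - g i * u j)\<^sup>2) + (Bu B i)\<^sup>2 = (\<Sum>j\<in>J. (B (i, j))\<^sup>2) + (g i - Bu B i)\<^sup>2" for i
    proof -
      have "(\<Sum>j\<in>J. (B (i, j) - g i * u j)\<^sup>2) = (\<Sum>j\<in>J. (B (i, j))\<^sup>2 - 2 * g i * (B (i, j) * u j) + (g i)\<^sup>2 * (u j)\<^sup>2)"
        by (intro sum.cong refl) (simp add: power2_eq_square algebra_simps)
      also have "\<dots> = (\<Sum>j\<in>J. (B (i, j))\<^sup>2) - 2 * g i * Bu B i + (g i)\<^sup>2"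
        by (simp add: sum.distrib sum_subtractf sum_distrib_left[symmetric] Bu_def u)
      finally show ?thesis by (simp add: power2_diff)
    qed
    have "(\<Sum>ij\<in>I \<times> J. (B ij - g (fst ij) * u (snd ij))\<^sup>2) + (\<Sum>i\<in>I. (Bu B i)\<^sup>2)
        = (\<Sum>ij\<in>I \<times> J. (B ij)\<^sup>2) + (\<Sum>i\<in>I. (g i - Bu B i)\<^sup>2)"
      by (simp add: sum.cartesian_product' sum.distrib[symmetric] row)
    then show ?thesis
      unfolding gauss_density_def
      by (simp add: mult_ac exp_add[symmetric] add_divide_distrib[symmetric])
  qed
  let ?k1 = "\<lambda>B g. ennreal (?p B * ?r (\<lambda>i. g i + Bu B i)) * F (add B g)"
  let ?k2 = "\<lambda>B g. ennreal (?p B * ?r (\<lambda>i. g i - Bu B i)) * F B"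
  have one: "(\<integral>\<^sup>+g. ennreal (?r (\<lambda>i. g i - t i)) \<partial>?H) = 1" for t
  proof -
    have "(\<integral>\<^sup>+g. ennreal (?r g) \<partial>?H) = (\<integral>\<^sup>+g. ennreal (?r (\<lambda>i\<in>I. - t i + 1 * g i)) \<partial>?H)"
      using I by (subst nn_integral_lborel_PiM_affine[of I 1 _ "\<lambda>i. - t i"]) auto
    also have "\<dots> = (\<integral>\<^sup>+g. ennreal (?r (\<lambda>i. g i - t i)) \<partial>?H)"
      by (simp only: gauss_density_restrict) (simp add: add.commute)
    finally show ?thesis
      using nn_integral_gauss_PiM_eq[OF I, of "\<lambda>_. 1"] prob_space.emeasure_space_1[OF prob_space_gauss_PiM[of I]]
      by simp
  qed
  have "(\<integral>\<^sup>+B. (\<integral>\<^sup>+g. F (resample I J u B g) \<partial>gauss_PiM I) \<partial>gauss_PiM (I \<times> J))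
      = (\<integral>\<^sup>+B. (\<integral>\<^sup>+g. ennreal (?r g) * F (resample I J u B g) \<partial>?H) \<partial>gauss_PiM (I \<times> J))"
    using I by (intro nn_integral_cong nn_integral_gauss_PiM_eq) (auto cong: measurable_cong_sets sets_PiM_cong simp: space_PiM)
  also have "\<dots> = (\<integral>\<^sup>+B. ennreal (?p B) * (\<integral>\<^sup>+g. ennreal (?r g) * F (resample I J u B g) \<partial>?H) \<partial>?G)"
    using fin by (intro nn_integral_gauss_PiM_eq) auto
  \<comment> \<open>Translating \<open>g\<close> by \<open>B u\<close> turns the resampled matrix
    into \<open>add B g\<close>, in which \<open>B u\<close> is no longer subtracted.\<close>
  also have "\<dots> = (\<integral>\<^sup>+B. (\<integral>\<^sup>+g. ?k1 B g \<partial>?H) \<partial>?G)"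
  proof (intro nn_integral_cong)
    fix B assume B: "B \<in> space ?G"
    have m: "(\<lambda>g. ennreal (?r g) * F (resample I J u B g)) \<in> borel_measurable ?H"
      using B by measurable
    have "(\<integral>\<^sup>+g. ennreal (?r g) * F (resample I J u B g) \<partial>?H)
       = (\<integral>\<^sup>+g. ennreal (?r (\<lambda>i\<in>I. Bu B i + 1 * g i)) * F (resample I J u B (\<lambda>i\<in>I. Bu B i + 1 * g i)) \<partial>?H)"
      using I by (subst nn_integral_lborel_PiM_affine[OF _ _ m, of 1 "Bu B"]) auto
    also have "\<dots> = (\<integral>\<^sup>+g. ennreal (?r (\<lambda>i. g i + Bu B i)) * F (add B g) \<partial>?H)"
    proof (intro nn_integral_cong)
      fix g
      have "resample I J u B (\<lambda>i\<in>I. Bu B i + 1 * g i) = add B g"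
        by (auto simp: res add_def)
      then show "ennreal (?r (\<lambda>i\<in>I. Bu B i + 1 * g i)) * F (resample I J u B (\<lambda>i\<in>I. Bu B i + 1 * g i))
          = ennreal (?r (\<lambda>i. g i + Bu B i)) * F (add B g)"
        by (simp only: gauss_density_restrict) (simp add: add.commute)
    qed
    finally have *: "(\<integral>\<^sup>+g. ennreal (?r g) * F (resample I J u B g) \<partial>?H)
       = (\<integral>\<^sup>+g. ennreal (?r (\<lambda>i. g i + Bu B i)) * F (add B g) \<partial>?H)" .
    have m': "(\<lambda>g. ennreal (?r (\<lambda>i. g i + Bu B i)) * F (add B g)) \<in> borel_measurable ?H"
      unfolding gauss_density_def using B by measurable
    show "ennreal (?p B) * (\<integral>\<^sup>+g. ennreal (?r g) * F (resample I J u B g) \<partial>?H)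
      = (\<integral>\<^sup>+g. ?k1 B g \<partial>?H)"
      unfolding * by (subst nn_integral_cmult[OF m', symmetric])
        (simp add: ennreal_mult gauss_density_nonneg mult.assoc)
  qed
  also have "\<dots> = (\<integral>\<^sup>+g. (\<integral>\<^sup>+B. ?k1 B g \<partial>?G) \<partial>?H)"
    unfolding gauss_density_def by (intro GH.Fubini'[symmetric]) measurable
  \<comment> \<open>Translating \<open>B\<close> by minus the rank-one matrix with entries
    \<open>g i * u j\<close> undoes \<open>add\<close>, so that \<open>F\<close> is evaluated at
    \<open>B\<close> alone.\<close>
  also have "\<dots> = (\<integral>\<^sup>+g. (\<integral>\<^sup>+B. ?k2 B g \<partial>?G) \<partial>?H)"
  proof (rule nn_integral_cong)
    fix g assume g: "g \<in> space ?H"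
    let ?t = "\<lambda>ij. - (g (fst ij) * u (snd ij))"
    have m: "(\<lambda>B. ?k1 B g) \<in> borel_measurable ?G"
      using g unfolding gauss_density_def by measurable
    have "(\<integral>\<^sup>+B. ?k1 B g \<partial>?G)
       = (\<integral>\<^sup>+B. ennreal (?p (\<lambda>ij\<in>I \<times> J. ?t ij + 1 * B ij) *
             ?r (\<lambda>i. g i + Bu (\<lambda>ij\<in>I \<times> J. ?t ij + 1 * B ij) i)) * F (add (\<lambda>ij\<in>I \<times> J. ?t ij + 1 * B ij) g) \<partial>?G)"
      using fin by (subst nn_integral_lborel_PiM_affine[OF _ _ m, of 1 ?t]) auto
    also have "\<dots> = (\<integral>\<^sup>+B. ?k2 B g \<partial>?G)"
    proof (intro nn_integral_cong)
      fix B assume B: "B \<in> space ?G"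
      have 1: "add (\<lambda>ij\<in>I \<times> J. ?t ij + 1 * B ij) g = B"
        using B by (auto simp: add_def space_PiM PiE_def extensional_def)
      have 2: "g i + Bu (\<lambda>ij\<in>I \<times> J. ?t ij + 1 * B ij) i = Bu B i" if "i \<in> I" for i
      proof -
        have "Bu (\<lambda>ij\<in>I \<times> J. ?t ij + 1 * B ij) i = (\<Sum>j\<in>J. B (i, j) * u j - g i * (u j)\<^sup>2)"
          using that unfolding Bu_def by (intro sum.cong refl) (simp add: algebra_simps power2_eq_square)
        also have "\<dots> = Bu B i - g i"
          by (simp add: Bu_def sum_subtractf sum_distrib_left[symmetric] u)
        finally show ?thesis by simp
      qed
      have 3: "?r (\<lambda>i. g i + Bu (\<lambda>ij\<in>I \<times> J. ?t ij + 1 * B ij) i) = ?r (Bu B)"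
      proof -
        have "(\<Sum>i\<in>I. (g i + Bu (\<lambda>ij\<in>I \<times> J. ?t ij + 1 * B ij) i)\<^sup>2) = (\<Sum>i\<in>I. (Bu B i)\<^sup>2)"
          by (intro sum.cong refl) (simp only: 2)
        then show ?thesis unfolding gauss_density_def by (simp only:)
      qed
      have 4: "(\<lambda>ij\<in>I \<times> J. ?t ij + 1 * B ij) = (\<lambda>ij\<in>I \<times> J. B ij - g (fst ij) * u (snd ij))"
        by auto
      show "ennreal (?p (\<lambda>ij\<in>I \<times> J. ?t ij + 1 * B ij) *
             ?r (\<lambda>i. g i + Bu (\<lambda>ij\<in>I \<times> J. ?t ij + 1 * B ij) i)) * F (add (\<lambda>ij\<in>I \<times> J. ?t ij + 1 * B ij) g)
        = ?k2 B g"
        unfolding 1 3 unfolding 4 dens ..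
    qed
    finally show "(\<integral>\<^sup>+B. ?k1 B g \<partial>?G)
       = (\<integral>\<^sup>+B. ?k2 B g \<partial>?G)" .
  qed
  also have "\<dots> = (\<integral>\<^sup>+B. (\<integral>\<^sup>+g. ?k2 B g \<partial>?H) \<partial>?G)"
    unfolding gauss_density_def by (intro GH.Fubini') measurable
  \<comment> \<open>\<open>g\<close> now occurs only in a translated Gaussian density, which
    integrates to one.\<close>
  also have "\<dots> = (\<integral>\<^sup>+B. ennreal (?p B) * F B \<partial>?G)"
  proof (intro nn_integral_cong)
    fix B
    have "(\<integral>\<^sup>+g. ?k2 B g \<partial>?H)
        = (\<integral>\<^sup>+g. ennreal (?p B) * F B * ennreal (?r (\<lambda>i. g i - Bu B i)) \<partial>?H)"
      by (simp add: ennreal_mult gauss_density_nonneg mult_ac)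
    also have "\<dots> = ennreal (?p B) * F B"
    proof -
      have "(\<lambda>g. ennreal (?r (\<lambda>i. g i - Bu B i))) \<in> borel_measurable ?H"
        unfolding gauss_density_def by measurable
      then show ?thesis by (simp add: nn_integral_cmult one)
    qed
    finally show "(\<integral>\<^sup>+g. ?k2 B g \<partial>?H)
        = ennreal (?p B) * F B" .
  qed
  also have "\<dots> = (\<integral>\<^sup>+B. F B \<partial>gauss_PiM (I \<times> J))"
    using fin by (intro nn_integral_gauss_PiM_eq[symmetric]) auto
  finally show ?thesis by simp
qed

text \<open>For a unit vector \<open>u\<close> the map \<open>proj J u\<close> is the orthogonal projection onto its complement.
  The ratio of \<open>fibre_num\<close> and \<open>fibre_den\<close> plays the role of \<open>exp (- s * m)\<close>, where \<open>m\<close> is the squared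
  distance of \<open>B u\<close> from the image of that complement; the term \<open>e * |z|\<^sup>2\<close> keeps
  the integrals finite when \<open>B\<close> is not injective.\<close>

definition proj :: "'b set \<Rightarrow> ('b \<Rightarrow> real) \<Rightarrow> ('b \<Rightarrow> real) \<Rightarrow> 'b \<Rightarrow> real" where
  "proj J u z j = z j - (\<Sum>l\<in>J. u l * z l) * u j"

definition fibre_num :: "'a set \<Rightarrow> 'b set \<Rightarrow> real \<Rightarrow> real \<Rightarrow> ('b \<Rightarrow> real) \<Rightarrow> ('a \<times> 'b \<Rightarrow> real) \<Rightarrow> ennreal" where
  "fibre_num I J e s u B = (\<integral>\<^sup>+z. ennreal (exp (- s * ((\<Sum>i\<in>I. (\<Sum>j\<in>J. B (i, j) * (u j + proj J u z j))\<^sup>2)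
     + e * (sqsum J z)))) \<partial>lborel_PiM J)"

definition fibre_den :: "'a set \<Rightarrow> 'b set \<Rightarrow> real \<Rightarrow> real \<Rightarrow> ('b \<Rightarrow> real) \<Rightarrow> ('a \<times> 'b \<Rightarrow> real) \<Rightarrow> ennreal" where
  "fibre_den I J e s u B = (\<integral>\<^sup>+z. ennreal (exp (- s * ((\<Sum>i\<in>I. (\<Sum>j\<in>J. B (i, j) * proj J u z j)\<^sup>2)
     + e * (sqsum J z)))) \<partial>lborel_PiM J)"

section \<open>Laplace transform of the squared distance through fibre integrals\<close>

lemma nn_integral_lborel_exp_square_finite:
  assumes "a > 0"
  shows "(\<integral>\<^sup>+x. ennreal (exp (- a * x\<^sup>2)) \<partial>lborel) < \<infinity>"
proof -
  define \<sigma> where "\<sigma> = 1 / sqrt (2 * a)"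
  have \<sigma>: "\<sigma> > 0" "2 * \<sigma>\<^sup>2 = 1 / a" using assms by (auto simp: \<sigma>_def power_divide)
  have "exp (- a * x\<^sup>2) = sqrt (2 * pi * \<sigma>\<^sup>2) * normal_density 0 \<sigma> x" for x
    using \<sigma> assms by (simp add: normal_density_def)
  then have "(\<integral>\<^sup>+x. ennreal (exp (- a * x\<^sup>2)) \<partial>lborel)
      = (\<integral>\<^sup>+x. ennreal (sqrt (2 * pi * \<sigma>\<^sup>2)) * ennreal (normal_density 0 \<sigma> x) \<partial>lborel)"
    by (simp only: ennreal_mult normal_density_nonneg real_sqrt_ge_zero mult_nonneg_nonneg
        zero_le_power2 pi_ge_zero zero_le_numeral)
  also have "\<dots> = ennreal (sqrt (2 * pi * \<sigma>\<^sup>2)) * (\<integral>\<^sup>+x. ennreal (normal_density 0 \<sigma> x) \<partial>lborel)"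
    by (intro nn_integral_cmult) auto
  also have "(\<integral>\<^sup>+x. ennreal (normal_density 0 \<sigma> x) \<partial>lborel) = 1"
    using \<sigma>(1) by (subst nn_integral_eq_integral) auto
  finally show ?thesis by simp
qed

lemma nn_integral_lborel_PiM_exp_squares_finite:
  assumes "finite J" "a > 0"
  shows "(\<integral>\<^sup>+z. ennreal (exp (- a * (sqsum J z))) \<partial>lborel_PiM J) < \<infinity>"
proof -
  have "(\<integral>\<^sup>+z. ennreal (exp (- a * (sqsum J z))) \<partial>lborel_PiM J)
      = (\<integral>\<^sup>+z. (\<Prod>j\<in>J. ennreal (exp (- a * (z j)\<^sup>2))) \<partial>lborel_PiM J)"
    using assms(1) by (simp only: prod_ennreal exp_ge_zero exp_sum sum_distrib_left)
  also have "\<dots> = (\<Prod>j\<in>J. \<integral>\<^sup>+x. ennreal (exp (- a * x\<^sup>2)) \<partial>lborel)"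
    using assms(1) by (intro lborel_product.product_nn_integral_prod) auto
  also have "\<dots> < \<infinity>"
    using nn_integral_lborel_exp_square_finite[OF assms(2)]
    by (auto simp: less_top[symmetric] ennreal_prod_eq_top power_eq_top_ennreal)
  finally show ?thesis .
qed

lemma proj_measurable [measurable]:
  assumes [measurable]: "\<And>j. j \<in> J \<Longrightarrow> (\<lambda>x. u x j) \<in> borel_measurable M" "\<And>j. j \<in> J \<Longrightarrow> (\<lambda>x. z x j) \<in> borel_measurable M"
    and "j \<in> J"
  shows "(\<lambda>x. proj J (u x) (z x) j) \<in> borel_measurable M"
  unfolding proj_def using assms(3) by measurable

lemma fibre_den_finite:
  assumes "finite J" "s > 0" "e > 0"
  shows "fibre_den I J e s u B < \<infinity>"
proof -
  have "fibre_den I J e s u B \<le> (\<integral>\<^sup>+z. ennreal (exp (- (s * e) * (sqsum J z))) \<partial>lborel_PiM J)"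
    unfolding fibre_den_def using assms
    by (intro nn_integral_mono ennreal_leI) (simp add: algebra_simps sum_nonneg)
  also have "\<dots> < \<infinity>"
    using assms by (intro nn_integral_lborel_PiM_exp_squares_finite) auto
  finally show ?thesis .
qed

text \<open>The integrand vanishes nowhere and the measure is not zero. Positivity and finiteness
  together permit cancelling \<open>fibre_den\<close> in the extended reals.\<close>

lemma fibre_den_pos:
  assumes J: "finite J"
  shows "fibre_den I J e s u B > 0"
proof -
  let ?L = "lborel_PiM J"
  interpret L: finite_product_sigma_finite "\<lambda>_. lborel :: real measure" J by standard (rule J)
  have "emeasure ?L (space ?L) \<noteq> 0"
    using J by (simp add: L.measure_times space_PiM)
  then have "\<not> (AE z in ?L. False)"
    by (simp add: AE_iff_measurable[of "space ?L"])
  then have "\<not> (AE z in ?L. ennreal (exp (- s * ((\<Sum>i\<in>I. (\<Sum>j\<in>J. B (i, j) * proj J u z j)\<^sup>2) + e * (sqsum J z)))) = 0)"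
    by simp
  then show ?thesis
    unfolding fibre_den_def
    by (subst (asm) nn_integral_0_iff_AE[symmetric]) (auto simp: zero_less_iff_neq_zero)
qed

text \<open>Symmetrising the shifted integral under \<open>z \<mapsto> -z\<close> removes the cross terms, so that no
  minimiser of the quadratic form is needed.\<close>

lemma fibre_num_ge:
  fixes u y :: "'b \<Rightarrow> real"
  assumes J: "finite J" and u: "sqsum J u = 1" and y: "(\<Sum>j\<in>J. u j * y j) = 1"
    and s: "s > 0" and e: "e > 0"
  shows "ennreal (exp (- s * ((matsq I J B y) + e * (sqsum J y)))) * fibre_den I J e s u B
    \<le> fibre_num I J e s u B"
proof -
  let ?L = "lborel_PiM J"
  define a where "a i = (\<Sum>j\<in>J. B (i, j) * y j)" for i
  define b where "b z i = (\<Sum>j\<in>J. B (i, j) * proj J u z j)" for z i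
  \<comment> \<open>\<open>w\<close> is orthogonal to \<open>u\<close>, so translating
    \<open>z\<close> by \<open>w\<close> moves the base point of the fibre from \<open>u\<close> to
    \<open>y\<close>.\<close>
  define w where "w j = y j - u j" for j
  define Q where "Q c z = (\<Sum>i\<in>I. (a i + c * b z i)\<^sup>2) + e * (\<Sum>j\<in>J. (w j + c * z j)\<^sup>2)" for c :: real and z
  define D where "D z = (\<Sum>i\<in>I. (b z i)\<^sup>2) + e * sqsum J z" for z
  define A where "A = sqsum I a + e * sqsum J y"
  have uw: "(\<Sum>j\<in>J. u j * w j) = 0"
    using u y by (simp add: w_def right_diff_distrib sum_subtractf power2_eq_square)
  have m [measurable]: "(\<lambda>z. b z i) \<in> borel_measurable ?L" for i
    unfolding b_def by measurable
  have num: "fibre_num I J e s u B = (\<integral>\<^sup>+z. ennreal (exp (- s * Q c z)) \<partial>?L)" if c: "\<bar>c\<bar> = 1" for c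
  proof -
    let ?F = "\<lambda>z. ennreal (exp (- s * ((\<Sum>i\<in>I. (\<Sum>j\<in>J. B (i, j) * (u j + proj J u z j))\<^sup>2) + e * (sqsum J z))))"
    have "fibre_num I J e s u B = (\<integral>\<^sup>+z. ?F (\<lambda>j\<in>J. w j + c * z j) \<partial>?L)"
      unfolding fibre_num_def using J c
      by (subst nn_integral_lborel_PiM_affine[of J c _ w]) auto
    also have "\<dots> = (\<integral>\<^sup>+z. ennreal (exp (- s * Q c z)) \<partial>?L)"
    proof (intro nn_integral_cong)
      fix z
      have "(\<Sum>l\<in>J. u l * (w l + c * z l)) = c * (\<Sum>l\<in>J. u l * z l)"
        using uw by (simp add: distrib_left sum.distrib sum_distrib_left mult.left_commute)
      then have "proj J u (\<lambda>j\<in>J. w j + c * z j) j = w j + c * proj J u z j" if "j \<in> J" for j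
        using that by (simp add: proj_def algebra_simps cong: sum.cong)
      then have "(\<Sum>j\<in>J. B (i, j) * (u j + proj J u (\<lambda>j\<in>J. w j + c * z j) j)) = a i + c * b z i" for i
        unfolding a_def b_def sum_distrib_left sum.distrib[symmetric]
        by (intro sum.cong refl) (simp add: w_def algebra_simps)
      then show "?F (\<lambda>j\<in>J. w j + c * z j) = ennreal (exp (- s * Q c z))"
        by (simp add: Q_def cong: sum.cong)
    qed
    finally show ?thesis .
  qed
  have "2 * (ennreal (exp (- s * A)) * fibre_den I J e s u B) = (\<integral>\<^sup>+z. ennreal (2 * (exp (- s * A) * exp (- s * D z))) \<partial>?L)"
    unfolding fibre_den_def D_def b_def
    by (subst nn_integral_cmult[symmetric], measurable, subst nn_integral_cmult[symmetric], measurable)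
      (simp add: ennreal_mult)
  also have "\<dots> \<le> (\<integral>\<^sup>+z. ennreal (exp (- s * Q 1 z)) + ennreal (exp (- s * Q (-1) z)) \<partial>?L)"
  proof (intro nn_integral_mono)
    fix z
    \<comment> \<open>By orthogonality |y|^2 = 1 + |w|^2, so the penalty on \<open>w\<close> is at
      most the penalty on \<open>y\<close>.\<close>
    have "sqsum J w = (sqsum J y) - 1"
    proof -
      have "sqsum J w = (\<Sum>j\<in>J. (y j)\<^sup>2 - 2 * (u j * y j) + (u j)\<^sup>2)"
        by (intro sum.cong refl) (simp add: w_def power2_diff)
      then show ?thesis using u y by (simp add: sum.distrib sum_subtractf sum_distrib_left[symmetric])
    qed
    then have w: "e * sqsum J w \<le> e * sqsum J y"
      using e by simp
    \<comment> \<open>The parallelogram law, used once for the image part and once for the penalty: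
      adding the values at \<open>z\<close> and \<open>-z\<close> cancels the cross terms.\<close>
    have par: "(\<Sum>i\<in>K. (f i + 1 * g i)\<^sup>2) + (\<Sum>i\<in>K. (f i + (-1) * g i)\<^sup>2) = 2 * sqsum K f + 2 * sqsum K g"
      for f g :: "'c \<Rightarrow> real" and K
      unfolding sum.distrib[symmetric] sum_distrib_left
      by (intro sum.cong refl) (simp add: power2_eq_square algebra_simps)
    have "Q 1 z + Q (-1) z = (2 * sqsum I a + 2 * (\<Sum>i\<in>I. (b z i)\<^sup>2)) + e * (2 * sqsum J w + 2 * (sqsum J z))"
      unfolding Q_def par[symmetric] by (simp add: algebra_simps)
    also have "\<dots> \<le> 2 * (A + D z)"
      using w by (simp add: A_def D_def algebra_simps)
    finally have "- s * (2 * (A + D z)) \<le> - s * (Q 1 z + Q (-1) z)"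
      using s by simp
    then have le: "- s * A + - s * D z \<le> (- s * Q 1 z) / 2 + (- s * Q (-1) z) / 2"
      by (simp add: algebra_simps)
    \<comment> \<open>The inequality of arithmetic and geometric means for the two exponentials,
      written as \<open>2 * a * b \<le> a^2 + b^2\<close> for their square roots.\<close>
    have "2 * (exp (- s * A) * exp (- s * D z)) \<le> 2 * (exp (- s * Q 1 z / 2) * exp (- s * Q (-1) z / 2))"
      using le by (simp only: exp_add[symmetric] mult_le_cancel_left_pos zero_less_numeral exp_le_cancel_iff)
    also have "\<dots> \<le> (exp (- s * Q 1 z / 2))\<^sup>2 + (exp (- s * Q (-1) z / 2))\<^sup>2"
      using sum_squares_bound[of "exp (- s * Q 1 z / 2)" "exp (- s * Q (-1) z / 2)"] by simp
    also have "\<dots> = exp (- s * Q 1 z) + exp (- s * Q (-1) z)"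
      by (simp add: exp_double[symmetric])
    finally show "ennreal (2 * (exp (- s * A) * exp (- s * D z))) \<le> ennreal (exp (- s * Q 1 z)) + ennreal (exp (- s * Q (-1) z))"
      by (simp add: ennreal_plus[symmetric] ennreal_leI del: ennreal_plus)
  qed
  also have "\<dots> = (\<integral>\<^sup>+z. ennreal (exp (- s * Q 1 z)) \<partial>?L) + (\<integral>\<^sup>+z. ennreal (exp (- s * Q (-1) z)) \<partial>?L)"
    unfolding Q_def by (intro nn_integral_add) measurable
  also have "\<dots> = 2 * fibre_num I J e s u B"
    using num[of 1] num[of "-1"] by (simp add: mult_2)
  finally show ?thesis
    unfolding A_def a_def by (subst (asm) ennreal_mult_le_mult_iff) auto
qed

lemma proj_orthogonal:
  assumes "sqsum J u = 1"
  shows "(\<Sum>j\<in>J. u j * proj J u z j) = 0"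
proof -
  have "(\<Sum>j\<in>J. u j * proj J u z j) = (\<Sum>j\<in>J. u j * z j - (\<Sum>l\<in>J. u l * z l) * (u j)\<^sup>2)"
    by (intro sum.cong refl) (simp add: proj_def power2_eq_square algebra_simps)
  then show ?thesis by (simp add: sum_subtractf sum_distrib_left[symmetric] assms)
qed

text \<open>The denominator sees \<open>B\<close> only on the complement of \<open>u\<close>, which
  resampling does not touch.\<close>

lemma fibre_den_resample:
  fixes u :: "'b \<Rightarrow> real"
  assumes u: "sqsum J u = 1"
  shows "fibre_den I J e s u (resample I J u B g) = fibre_den I J e s u B"
proof -
  have "(\<Sum>j\<in>J. resample I J u B g (i, j) * proj J u z j) = (\<Sum>j\<in>J. B (i, j) * proj J u z j)" if "i \<in> I" for i z
  proof -
    have "(\<Sum>j\<in>J. resample I J u B g (i, j) * proj J u z j)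
      = (\<Sum>j\<in>J. B (i, j) * proj J u z j + (g i - (\<Sum>j\<in>J. B (i, j) * u j)) * (u j * proj J u z j))"
      using that by (intro sum.cong refl) (simp add: resample_def algebra_simps)
    then show ?thesis by (simp add: sum.distrib sum_distrib_left[symmetric] proj_orthogonal[OF u])
  qed
  then show ?thesis unfolding fibre_den_def by (simp cong: sum.cong)
qed

text \<open>In the numerator the image of the base point \<open>u\<close> becomes the fresh vector
  \<open>g\<close>, while the part coming from \<open>proj\<close> is the old one.\<close>

lemma fibre_num_resample:
  fixes u :: "'b \<Rightarrow> real"
  assumes u: "sqsum J u = 1"
  shows "fibre_num I J e s u (resample I J u B g) = (\<integral>\<^sup>+z. ennreal (exp (- s * ((\<Sum>i\<in>I. (g i + (\<Sum>j\<in>J. B (i, j) * proj J u z j))\<^sup>2)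
     + e * (sqsum J z)))) \<partial>lborel_PiM J)"
proof -
  have "(\<Sum>j\<in>J. resample I J u B g (i, j) * (u j + proj J u z j)) = g i + (\<Sum>j\<in>J. B (i, j) * proj J u z j)" if "i \<in> I" for i z
  proof -
    define h where "h = g i - (\<Sum>j\<in>J. B (i, j) * u j)"
    have "(\<Sum>j\<in>J. resample I J u B g (i, j) * (u j + proj J u z j))
      = (\<Sum>j\<in>J. B (i, j) * u j + B (i, j) * proj J u z j + h * (u j)\<^sup>2 + h * (u j * proj J u z j))"
      using that unfolding h_def
      by (intro sum.cong refl) (simp add: resample_def algebra_simps power2_eq_square)
    also have "\<dots> = g i + (\<Sum>j\<in>J. B (i, j) * proj J u z j)"
      by (simp add: sum.distrib sum_distrib_left[symmetric] proj_orthogonal[OF u] u) (simp add: h_def)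
    finally show ?thesis .
  qed
  then show ?thesis unfolding fibre_num_def by (simp cong: sum.cong)
qed

text \<open>Averaging over \<open>g\<close> gives the power \<open>- card I / 2\<close> of
  \<open>r = 1 + 2 * s\<close> and weakens the rate to \<open>s / r\<close>; the dilation of
  \<open>z\<close> by \<open>sqrt r\<close> restores the rate and gives the power
  \<open>card J / 2\<close>. A chi-square law for the distance would have one degree of freedom
  more: here \<open>z\<close> runs over all of the space and not just over the complement of
  \<open>u\<close>. The loss does not affect the exponential rate.\<close>

lemma nn_integral_fibre_num_le:
  fixes u :: "'b \<Rightarrow> real"
  assumes I: "finite I" and J: "finite J" and u: "sqsum J u = 1" and s: "s > 0" and e: "e > 0"
  shows "(\<integral>\<^sup>+g. fibre_num I J e s u (resample I J u B g) \<partial>gauss_PiM I)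
    \<le> ennreal ((1 + 2 * s) powr ((real (card J) - real (card I)) / 2)) * fibre_den I J e s u B"
proof -
  let ?L = "lborel_PiM J" and ?H = "gauss_PiM I"
  interpret L: finite_product_sigma_finite "\<lambda>_. lborel :: real measure" J by standard (rule J)
  interpret H: prob_space ?H by (rule prob_space_gauss_PiM)
  interpret HL: pair_sigma_finite ?H ?L by standard
  define b where "b z i = (\<Sum>j\<in>J. B (i, j) * proj J u z j)" for z i
  have b_meas [measurable]: "(\<lambda>z. b z i) \<in> borel_measurable ?L" for i
    unfolding b_def by measurable
  define r where "r = 1 + 2 * s"
  have r: "r > 1" using s by (simp add: r_def)
  let ?f = "\<lambda>g z. ennreal (exp (- s * ((\<Sum>i\<in>I. (g i + b z i)\<^sup>2) + e * (sqsum J z))))"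
  let ?q = "\<lambda>z. (\<Sum>i\<in>I. (b z i)\<^sup>2) + e * sqsum J z"
  have "(\<integral>\<^sup>+g. fibre_num I J e s u (resample I J u B g) \<partial>?H) = (\<integral>\<^sup>+g. (\<integral>\<^sup>+z. ?f g z \<partial>?L) \<partial>?H)"
    by (simp only: fibre_num_resample[OF u] b_def)
  also have "\<dots> = (\<integral>\<^sup>+z. (\<integral>\<^sup>+g. ?f g z \<partial>?H) \<partial>?L)"
    by (rule HL.Fubini'[symmetric]) measurable
  also have "\<dots> \<le> (\<integral>\<^sup>+z. ennreal (r powr (- real (card I) / 2)) * ennreal (exp (- (s / r) * ?q z)) \<partial>?L)"
  proof (intro nn_integral_mono)
    fix z
    have "(\<integral>\<^sup>+g. ?f g z \<partial>?H) = (\<integral>\<^sup>+g. ennreal (exp (- s * (e * (sqsum J z)))) * ennreal (exp (- s * (\<Sum>i\<in>I. (g i + b z i)\<^sup>2))) \<partial>?H)"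
      by (intro nn_integral_cong) (simp add: ennreal_mult[symmetric] exp_add[symmetric] algebra_simps)
    also have "\<dots> = ennreal (exp (- s * (e * (sqsum J z)))) * (\<integral>\<^sup>+g. ennreal (exp (- s * (\<Sum>i\<in>I. (g i + b z i)\<^sup>2))) \<partial>?H)"
      by (intro nn_integral_cmult) measurable
    also have "\<dots> = ennreal (exp (- s * (e * (sqsum J z))) * (r powr (- real (card I) / 2) * exp (- (s / r) * (\<Sum>i\<in>I. (b z i)\<^sup>2))))"
      unfolding nn_integral_gauss_exp_shifted_squares[OF I s] r_def by (simp add: ennreal_mult)
    also have "\<dots> \<le> ennreal (r powr (- real (card I) / 2) * exp (- (s / r) * ?q z))"
    proof (intro ennreal_leI)
      \<comment> \<open>The average over \<open>g\<close> does not act on the penalty term. Its rate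
        is lowered to \<open>s / r\<close> by hand, so that the whole quadratic form has one rate
        and can be dilated at once.\<close>
      have "s / r \<le> s" using r s by (simp add: field_simps)
      then have "(s / r) * (e * (sqsum J z)) \<le> s * (e * (sqsum J z))"
        using e by (intro mult_right_mono) (auto intro!: mult_nonneg_nonneg sum_nonneg)
      then have "exp (- s * (e * (sqsum J z))) * exp (- (s / r) * (\<Sum>i\<in>I. (b z i)\<^sup>2)) \<le> exp (- (s / r) * ?q z)"
        unfolding exp_add[symmetric] by (simp add: distrib_left)
      then show "exp (- s * (e * (sqsum J z))) * (r powr (- real (card I) / 2) * exp (- (s / r) * (\<Sum>i\<in>I. (b z i)\<^sup>2)))
          \<le> r powr (- real (card I) / 2) * exp (- (s / r) * ?q z)"
        by (simp add: mult.left_commute mult_left_mono)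
    qed
    finally show "(\<integral>\<^sup>+g. ?f g z \<partial>?H) \<le> ennreal (r powr (- real (card I) / 2)) * ennreal (exp (- (s / r) * ?q z))"
      by (simp add: ennreal_mult)
  qed
  also have "\<dots> = ennreal (r powr (- real (card I) / 2)) * (\<integral>\<^sup>+z. ennreal (exp (- (s / r) * ?q z)) \<partial>?L)"
    by (intro nn_integral_cmult) measurable
  also have "(\<integral>\<^sup>+z. ennreal (exp (- (s / r) * ?q z)) \<partial>?L)
      = ennreal (\<bar>sqrt r\<bar> ^ card J) * (\<integral>\<^sup>+z. ennreal (exp (- (s / r) * ?q (\<lambda>j\<in>J. 0 + sqrt r * z j))) \<partial>?L)"
    using J r by (intro nn_integral_lborel_PiM_affine) auto
  also have "(\<integral>\<^sup>+z. ennreal (exp (- (s / r) * ?q (\<lambda>j\<in>J. 0 + sqrt r * z j))) \<partial>?L) = fibre_den I J e s u B"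
    unfolding fibre_den_def
  proof (intro nn_integral_cong)
    fix z
    have "b (\<lambda>j\<in>J. 0 + sqrt r * z j) i = sqrt r * b z i" for i
      unfolding b_def sum_distrib_left
      by (intro sum.cong refl) (simp add: proj_def algebra_simps sum_distrib_left cong: sum.cong)
    then have "?q (\<lambda>j\<in>J. 0 + sqrt r * z j) = r * ?q z"
      using r by (simp add: power_mult_distrib sum_distrib_left[symmetric] algebra_simps cong: sum.cong)
    then show "ennreal (exp (- (s / r) * ?q (\<lambda>j\<in>J. 0 + sqrt r * z j)))
       = ennreal (exp (- s * ((\<Sum>i\<in>I. (\<Sum>j\<in>J. B (i, j) * proj J u z j)\<^sup>2) + e * (sqsum J z))))"
      using r by (simp add: b_def)
  qed
  also have "ennreal (r powr (- real (card I) / 2)) * (ennreal (\<bar>sqrt r\<bar> ^ card J) * fibre_den I J e s u B)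
      = ennreal (r powr ((real (card J) - real (card I)) / 2)) * fibre_den I J e s u B"
  proof -
    have "\<bar>sqrt r\<bar> ^ card J = r powr (real (card J) / 2)"
      using r by (simp add: powr_half_sqrt[symmetric] powr_power)
    then have "r powr (- real (card I) / 2) * \<bar>sqrt r\<bar> ^ card J = r powr ((real (card J) - real (card I)) / 2)"
      by (simp add: powr_add[symmetric] diff_divide_distrib)
    then show ?thesis by (simp add: mult.assoc[symmetric] ennreal_mult[symmetric])
  qed
  finally show ?thesis by (simp add: r_def)
qed

text \<open>All parameters may vary measurably with \<omega>, because the lower tail integrates over
  \<open>B\<close>, over the direction \<open>u\<close> and over \<open>s\<close>.\<close>

lemma fibre_measurable:
  fixes u :: "'c \<Rightarrow> 'b \<Rightarrow> real"
  assumes J: "finite J" and s: "s \<in> borel_measurable M"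
    and u: "\<And>j. j \<in> J \<Longrightarrow> (\<lambda>\<omega>. u \<omega> j) \<in> borel_measurable M"
    and B: "\<And>i j. i \<in> I \<Longrightarrow> j \<in> J \<Longrightarrow> (\<lambda>\<omega>. B \<omega> (i, j)) \<in> borel_measurable M"
  shows "(\<lambda>\<omega>. fibre_num I J e (s \<omega>) (u \<omega>) (B \<omega>)) \<in> borel_measurable M"
    and "(\<lambda>\<omega>. fibre_den I J e (s \<omega>) (u \<omega>) (B \<omega>)) \<in> borel_measurable M"
proof -
  interpret L: finite_product_sigma_finite "\<lambda>_. lborel :: real measure" J by standard (rule J)
  let ?N = "M \<Otimes>\<^sub>M lborel_PiM J"
  have [measurable]: "(\<lambda>p. s (fst p)) \<in> borel_measurable ?N"
    by (rule measurable_compose[OF measurable_fst s])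
  have [measurable]: "(\<lambda>p. u (fst p) j) \<in> borel_measurable ?N" if "j \<in> J" for j
    by (rule measurable_compose[OF measurable_fst u[OF that]])
  have [measurable]: "(\<lambda>p. B (fst p) (i, j)) \<in> borel_measurable ?N" if "i \<in> I" "j \<in> J" for i j
    by (rule measurable_compose[OF measurable_fst B[OF that]])
  have [measurable]: "(\<lambda>p. snd p j) \<in> borel_measurable ?N" if "j \<in> J" for j
    using measurable_compose[OF measurable_snd measurable_component_singleton[OF that, of "\<lambda>_. lborel :: real measure"]]
    by simp
  show "(\<lambda>\<omega>. fibre_num I J e (s \<omega>) (u \<omega>) (B \<omega>)) \<in> borel_measurable M"
    unfolding fibre_num_def
    by (intro L.borel_measurable_nn_integral) (simp add: split_beta', measurable)
  show "(\<lambda>\<omega>. fibre_den I J e (s \<omega>) (u \<omega>) (B \<omega>)) \<in> borel_measurable M"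
    unfolding fibre_den_def
    by (intro L.borel_measurable_nn_integral) (simp add: split_beta', measurable)
qed

text \<open>Every \<open>y\<close> on the affine hyperplane through \<open>u\<close> orthogonal to
  \<open>u\<close> is a competitor for the distance. This is how the existence of one contracted
  vector enters the averaged quantity.\<close>

lemma fibre_ratio_ge:
  fixes u y :: "'b \<Rightarrow> real"
  assumes J: "finite J" and u: "sqsum J u = 1" and y: "(\<Sum>j\<in>J. u j * y j) = 1"
    and s: "s > 0" and e: "e > 0"
  shows "ennreal (exp (- s * ((matsq I J B y) + e * (sqsum J y))))
    \<le> fibre_num I J e s u B / fibre_den I J e s u B" (is "?a \<le> _")
proof -
  let ?d = "fibre_den I J e s u B"
  have "?d \<noteq> 0" "?d \<noteq> \<top>"
    using fibre_den_pos[OF J, of I e s u B] fibre_den_finite[OF J s e, of I u B] by (auto simp: less_top[symmetric] zero_less_iff_neq_zero)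
  then have "?a = ?a * ?d / ?d"
    by (simp add: ennreal_mult_divide_eq)
  also have "\<dots> \<le> fibre_num I J e s u B / ?d"
    by (intro divide_right_mono_ennreal fibre_num_ge assms)
  finally show ?thesis .
qed

text \<open>After resampling, the denominator is constant in \<open>g\<close>, so it comes out of
  the inner integral and cancels against the bound for the numerator.\<close>

lemma nn_integral_fibre_ratio_le:
  fixes u :: "'b \<Rightarrow> real"
  assumes I: "finite I" and J: "finite J" and u: "sqsum J u = 1" and s: "s > 0" and e: "e > 0"
  shows "(\<integral>\<^sup>+B. fibre_num I J e s u B / fibre_den I J e s u B \<partial>gauss_PiM (I \<times> J))
    \<le> ennreal ((1 + 2 * s) powr ((real (card J) - real (card I)) / 2))"
proof -
  let ?G = "gauss_PiM (I \<times> J)" and ?H = "gauss_PiM I" and ?GL = "lborel_PiM (I \<times> J)"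
  let ?c = "ennreal ((1 + 2 * s) powr ((real (card J) - real (card I)) / 2))"
  interpret G: prob_space ?G by (rule prob_space_gauss_PiM)
  have comp: "(\<lambda>B. B (i, j)) \<in> borel_measurable ?GL" if "i \<in> I" "j \<in> J" for i j
    using measurable_component_singleton[of "(i, j)" "I \<times> J" "\<lambda>_. lborel :: real measure"] that by simp
  have num_meas: "fibre_num I J e s u \<in> borel_measurable ?GL"
    by (rule fibre_measurable(1)[OF J, of "\<lambda>_. s" ?GL "\<lambda>_. u" I "\<lambda>B. B"]) (auto intro: comp)
  have den_meas: "fibre_den I J e s u \<in> borel_measurable ?GL"
    by (rule fibre_measurable(2)[OF J, of "\<lambda>_. s" ?GL "\<lambda>_. u" I "\<lambda>B. B"]) (auto intro: comp)
  have "(\<integral>\<^sup>+B. fibre_num I J e s u B / fibre_den I J e s u B \<partial>?G)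
     = (\<integral>\<^sup>+B. (\<integral>\<^sup>+g. fibre_num I J e s u (resample I J u B g) / fibre_den I J e s u (resample I J u B g) \<partial>?H) \<partial>?G)"
    using num_meas den_meas by (intro nn_integral_gauss_resample I J u borel_measurable_divide_ennreal)
  also have "\<dots> \<le> (\<integral>\<^sup>+B. ?c \<partial>?G)"
  proof (rule nn_integral_mono)
    fix B assume B: "B \<in> space ?G"
    let ?d = "fibre_den I J e s u B"
    have d: "?d \<noteq> 0" "?d \<noteq> \<top>"
      using fibre_den_pos[OF J, of I e s u B] fibre_den_finite[OF J s e, of I u B] by (auto simp: less_top[symmetric] zero_less_iff_neq_zero)
    have "(\<lambda>g. resample I J u B g (i, j)) \<in> borel_measurable ?H" if "i \<in> I" "j \<in> J" for i j
      using that unfolding resample_def by simp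
    then have m: "(\<lambda>g. fibre_num I J e s u (resample I J u B g)) \<in> borel_measurable ?H"
      by (intro fibre_measurable(1)[OF J, of "\<lambda>_. s" ?H "\<lambda>_. u" I "\<lambda>g. resample I J u B g"]) auto
    have "(\<integral>\<^sup>+g. fibre_num I J e s u (resample I J u B g) / fibre_den I J e s u (resample I J u B g) \<partial>?H)
       = (\<integral>\<^sup>+g. fibre_num I J e s u (resample I J u B g) \<partial>?H) / ?d"
      unfolding fibre_den_resample[OF u] by (rule nn_integral_divide[OF m])
    also have "\<dots> \<le> ?c * ?d / ?d"
      by (intro divide_right_mono_ennreal nn_integral_fibre_num_le I J u s e)
    also have "\<dots> = ?c"
      using d by (simp add: ennreal_mult_divide_eq)
    finally show "(\<integral>\<^sup>+g. fibre_num I J e s u (resample I J u B g) / fibre_den I J e s u (resample I J u B g) \<partial>?H) \<le> ?c" .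
  qed
  also have "\<dots> = ?c" by (simp add: G.emeasure_space_1)
  finally show ?thesis .
qed

section \<open>Integrals that turn Laplace transforms into negative moments\<close>

lemma nn_integral_power_exp:
  assumes Y: "Y > 0"
  shows "(\<integral>\<^sup>+s. ennreal (s ^ q) * indicator {0<..} s * ennreal (exp (- s * Y)) \<partial>lborel) = ennreal (fact q / Y ^ Suc q)"
proof -
  let ?I = "\<integral>\<^sup>+s. ennreal (s ^ q) * indicator {0<..} s * ennreal (exp (- s * Y)) \<partial>lborel"
  have "ennreal (fact q) = (\<integral>\<^sup>+x. ennreal (x ^ q * exp (- x)) * indicator {0..} x \<partial>lborel)"
    by (simp add: nn_intergal_power_times_exp_Ici)
  also have "\<dots> = ennreal Y * (\<integral>\<^sup>+x. ennreal ((0 + Y * x) ^ q * exp (- (0 + Y * x))) * indicator {0..} (0 + Y * x) \<partial>lborel)"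
    using Y by (subst nn_integral_real_affine[of _ Y 0]) auto
  also have "(\<integral>\<^sup>+x. ennreal ((0 + Y * x) ^ q * exp (- (0 + Y * x))) * indicator {0..} (0 + Y * x) \<partial>lborel)
      = (\<integral>\<^sup>+x. ennreal (Y ^ q) * (ennreal (x ^ q) * indicator {0<..} x * ennreal (exp (- x * Y))) \<partial>lborel)"
  proof (intro nn_integral_cong_AE)
    have "AE x in lborel. (x::real) \<noteq> 0" by (rule AE_lborel_singleton)
    then show "AE x in lborel. ennreal ((0 + Y * x) ^ q * exp (- (0 + Y * x))) * indicator {0..} (0 + Y * x)
        = ennreal (Y ^ q) * (ennreal (x ^ q) * indicator {0<..} x * ennreal (exp (- x * Y)))"
    proof eventually_elim
      case (elim x)
      then show ?case
        using Y by (cases "x > 0")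
          (auto simp: zero_le_mult_iff power_mult_distrib ennreal_mult[symmetric] mult_ac indicator_def)
    qed
  qed
  also have "\<dots> = ennreal (Y ^ q) * ?I"
    by (intro nn_integral_cmult) measurable
  finally have "ennreal (fact q) = ennreal (Y ^ Suc q) * ?I"
    using Y by (simp add: mult.assoc[symmetric] ennreal_mult[symmetric])
  then have "ennreal (1 / Y ^ Suc q) * ennreal (fact q) = ennreal (1 / Y ^ Suc q) * ennreal (Y ^ Suc q) * ?I"
    by (simp only: mult.assoc)
  also have "ennreal (1 / Y ^ Suc q) * ennreal (Y ^ Suc q) = 1"
    using Y by (subst ennreal_mult[symmetric]) auto
  finally show ?thesis
    using Y by (simp add: ennreal_mult[symmetric] del: power_Suc)
qed

text \<open>This is \<open>ln t \<le> t - 1\<close> at \<open>t = x * c / a\<close>, multiplied by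
  \<open>a\<close>; equality holds at \<open>x = a / c\<close>.\<close>

lemma mult_ln_le:
  fixes a c x :: real
  assumes "a \<ge> 0" "c > 0" "x > 0"
  shows "a * ln x \<le> xlnx a - a * ln c + (x * c - a)"
proof (cases "a = 0")
  case False
  then have a: "a > 0" using assms by simp
  have "a * ln (x * c / a) \<le> a * (x * c / a - 1)"
    using a assms by (intro mult_left_mono ln_le_minus_one) auto
  also have "a * ln (x * c / a) = a * ln x + a * ln c - xlnx a"
    using a assms by (simp add: ln_mult ln_div xlnx_def algebra_simps)
  also have "a * (x * c / a - 1) = x * c - a"
    using a by (simp add: field_simps)
  finally show ?thesis by simp
qed (use assms in \<open>simp add: xlnx_def\<close>)

text \<open>Gibbs' inequality: the left side is largest at \<open>w = a / (a + b)\<close>. Two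
  tangent bounds with \<open>c = a + b\<close> are added, and their linear corrections cancel
  because \<open>w\<close> and \<open>1 - w\<close> sum to one.\<close>

lemma gibbs_two_point:
  fixes a b w :: real
  assumes "a \<ge> 0" "b \<ge> 0" "0 < w" "w < 1"
  shows "a * ln w + b * ln (1 - w) \<le> xlnx a + xlnx b - xlnx (a + b)"
proof (cases "a + b = 0")
  case True
  then have "a = 0" "b = 0" using assms by auto
  then show ?thesis by (simp add: xlnx_def)
next
  case False
  then have c: "a + b > 0" using assms by simp
  have "a * ln w + b * ln (1 - w) \<le> (xlnx a - a * ln (a + b) + (w * (a + b) - a))
      + (xlnx b - b * ln (a + b) + ((1 - w) * (a + b) - b))"
    using assms c by (intro add_mono mult_ln_le) auto
  then show ?thesis by (simp add: xlnx_def algebra_simps)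
qed

lemma nn_integral_inverse_square:
  "(\<integral>\<^sup>+s. ennreal (1 / (1 + 2 * s)\<^sup>2) * indicator {0..} s \<partial>lborel) = ennreal (1 / 2)"
proof -
  have "(\<integral>\<^sup>+s. ennreal (1 / (1 + 2 * s)\<^sup>2) * indicator {0..} s \<partial>lborel) = ennreal (0 - (- 1 / (2 * (1 + 2 * 0))))"
  proof (rule nn_integral_FTC_atLeast)
    fix x :: real assume "0 \<le> x"
    then show "((\<lambda>x. - 1 / (2 * (1 + 2 * x))) has_real_derivative 1 / (1 + 2 * x)\<^sup>2) (at x)"
      by (auto intro!: derivative_eq_intros simp: power2_eq_square divide_simps) (simp add: algebra_simps)
  next
    show "((\<lambda>x::real. - 1 / (2 * (1 + 2 * x))) \<longlongrightarrow> 0) at_top"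
      by real_asymp
  qed auto
  then show ?thesis by simp
qed

text \<open>The integral is of beta type, but only its exponential rate matters. Splitting off the
  integrable weight \<open>1 / (1 + 2 * s)^2\<close> accounts for the \<open>4\<close> subtracted
  from \<open>m\<close>; the remaining factor is bounded by its maximum over
  \<open>s\<close>.\<close>

lemma nn_integral_beta_le:
  fixes m :: real
  assumes m: "m \<ge> 2 * real q + 4"
  shows "(\<integral>\<^sup>+s. ennreal (s ^ q) * indicator {0<..} s * ennreal ((1 + 2 * s) powr (- m / 2)) \<partial>lborel)
    \<le> ennreal (1 / 2 * exp ((xlnx (m - 2 * real q - 4) - xlnx (m - 4)) / 2 + real q) * fact q)"
proof -
  define b where "b = m - 2 * real q - 4"
  define C where "C = exp ((xlnx b - xlnx (m - 4)) / 2 + real q) * fact q"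
  have b: "b \<ge> 0" "2 * real q + b = m - 4" using m by (auto simp: b_def)
  have pw: "s ^ q * (1 + 2 * s) powr (- m / 2) \<le> C * (1 / (1 + 2 * s)\<^sup>2)" if s: "s > 0" for s :: real
  proof -
    \<comment> \<open>With this \<open>w\<close> the factor left after splitting off the weight is
      \<open>w ^ q * (1 - w) powr (b / 2) / 2 ^ q\<close>, to which the two-point inequality
      applies.\<close>
    define w where "w = 2 * s / (1 + 2 * s)"
    have w: "0 < w" "w < 1" "1 - w = 1 / (1 + 2 * s)" using s by (auto simp: w_def field_simps)
    have "2 * real q * ln w + b * ln (1 - w) \<le> xlnx (2 * real q) + xlnx b - xlnx (m - 4)"
      using gibbs_two_point[of "2 * real q" b w] b w by simp
    moreover have "ln w = ln 2 + ln s - ln (1 + 2 * s)" "ln (1 - w) = - ln (1 + 2 * s)"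
      using s w(3) by (auto simp: w_def ln_div ln_mult)
    ultimately have "2 * real q * (ln 2 + ln s - ln (1 + 2 * s)) - b * ln (1 + 2 * s) \<le> xlnx (2 * real q) + xlnx b - xlnx (m - 4)"
      by simp
    then have "2 * real q * (ln 2 + ln s) - (m - 4) * ln (1 + 2 * s) \<le> xlnx (2 * real q) + xlnx b - xlnx (m - 4)"
      unfolding b(2)[symmetric] by (simp add: algebra_simps)
    then have le: "real q * ln s + (- m / 2) * ln (1 + 2 * s)
        \<le> (xlnx b - xlnx (m - 4)) / 2 + (xlnx (2 * real q) / 2 - real q * ln 2) - 2 * ln (1 + 2 * s)"
      by (simp add: field_simps)
    have "s ^ q * (1 + 2 * s) powr (- m / 2) = exp (real q * ln s + (- m / 2) * ln (1 + 2 * s))"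
    proof -
      have "exp (real q * ln s) = s ^ q" using s by (simp add: exp_of_nat_mult)
      moreover have "(1 + 2 * s) powr (- m / 2) = exp ((- m / 2) * ln (1 + 2 * s))"
        using s by (simp add: powr_def)
      ultimately show ?thesis by (simp only: exp_add)
    qed
    also have "\<dots> \<le> exp ((xlnx b - xlnx (m - 4)) / 2 + (xlnx (2 * real q) / 2 - real q * ln 2) - 2 * ln (1 + 2 * s))"
      using le by simp
    also have "\<dots> = exp ((xlnx b - xlnx (m - 4)) / 2) * exp (xlnx (2 * real q) / 2 - real q * ln 2) * (1 / (1 + 2 * s)\<^sup>2)"
      using s by (simp add: exp_add exp_diff exp_double)
    also have "exp (xlnx (2 * real q) / 2 - real q * ln 2) = real q ^ q"
    proof (cases "q = 0")
      case False
      then have "xlnx (2 * real q) / 2 - real q * ln 2 = real q * ln (real q)"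
        by (simp add: xlnx_def ln_mult algebra_simps)
      with False show ?thesis by (simp add: exp_of_nat_mult)
    qed (simp add: xlnx_def)
    \<comment> \<open>\<open>q ^ q\<close> is traded for \<open>exp q * fact q\<close>, because the
      factorial will cancel against the one from the Gamma integral.\<close>
    also have "exp ((xlnx b - xlnx (m - 4)) / 2) * real q ^ q * (1 / (1 + 2 * s)\<^sup>2)
        \<le> exp ((xlnx b - xlnx (m - 4)) / 2) * (exp (real q) * fact q) * (1 / (1 + 2 * s)\<^sup>2)"
      using power_div_exp_le_fact[of q] by (intro mult_right_mono mult_left_mono) (auto simp: field_simps)
    finally show ?thesis by (simp add: C_def exp_add mult_ac)
  qed
  have "(\<integral>\<^sup>+s. ennreal (s ^ q) * indicator {0<..} s * ennreal ((1 + 2 * s) powr (- m / 2)) \<partial>lborel)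
      \<le> (\<integral>\<^sup>+s. ennreal C * (ennreal (1 / (1 + 2 * s)\<^sup>2) * indicator {0..} s) \<partial>lborel)"
  proof (intro nn_integral_mono)
    fix s :: real
    show "ennreal (s ^ q) * indicator {0<..} s * ennreal ((1 + 2 * s) powr (- m / 2))
      \<le> ennreal C * (ennreal (1 / (1 + 2 * s)\<^sup>2) * indicator {0..} s)"
    proof (cases "s > 0")
      case True
      have "ennreal (s ^ q) * ennreal ((1 + 2 * s) powr (- m / 2)) \<le> ennreal C * ennreal (1 / (1 + 2 * s)\<^sup>2)"
        using pw[OF True] True by (simp add: ennreal_mult[symmetric] C_def ennreal_leI)
      with True show ?thesis by simp
    qed simp
  qed
  also have "\<dots> = ennreal C * ennreal (1 / 2)"
    by (subst nn_integral_cmult) (auto simp: nn_integral_inverse_square)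
  also have "\<dots> = ennreal (1 / 2 * C)"
    by (simp add: ennreal_mult[symmetric] C_def del: ennreal_half)
  finally show ?thesis by (simp add: C_def b_def)
qed

lemma gauss_component_measurable:
  "i \<in> I \<Longrightarrow> (\<lambda>x. x i) \<in> borel_measurable (gauss_PiM I)"
  using measurable_component_singleton[of i I "\<lambda>_. std_gauss"] by (simp cong: measurable_cong_sets)

text \<open>Markov's inequality is applied to \<open>S\<close>, the average over Gaussian
  \<open>x\<close> of |x|^(2p) times a negative moment of the distance belonging to the direction of
  \<open>x\<close>. If \<open>B\<close> contracts \<open>v\<close>, then \<open>K B x\<close> is
  large in proportion to the p-th power of <x, v>^2 / |x|^2, so the average is bounded below by a
  Gaussian moment. The regularisation \<open>e\<close> only replaces \<open>T\<close> by
  \<open>T + e\<close>.\<close>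

lemma gauss_matrix_lower_tail:
  fixes I :: "'a set" and J :: "'b set" and T e :: real
  assumes I: "finite I" and J: "finite J" "J \<noteq> {}" and T: "T > 0" and e: "e > 0"
    and q: "card J + 2 * q + 4 \<le> card I"
  shows "\<exists>E \<in> sets (gauss_PiM (I \<times> J)).
    emeasure (gauss_PiM (I \<times> J)) E
      \<le> ennreal (chi_moment (card J) (Suc q)
          * (1 / 2 * exp ((xlnx (real (card I) - real (card J) - 2 * real q - 4) - xlnx (real (card I) - real (card J) - 4)) / 2 + real q))
          * (T + e) ^ Suc q / (normal_moment (Suc q))) \<and>
    (\<forall>B \<in> space (gauss_PiM (I \<times> J)). \<forall>v.
      (sqsum J v) > 0 \<longrightarrow> matsq I J B v \<le> T * sqsum J v \<longrightarrow> B \<in> E)"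
proof -
  let ?G = "gauss_PiM (I \<times> J)" and ?H = "gauss_PiM J"
  interpret G: prob_space ?G by (rule prob_space_gauss_PiM)
  interpret H: prob_space ?H by (rule prob_space_gauss_PiM)
  interpret GH: pair_sigma_finite ?G ?H by standard
  interpret GL: pair_sigma_finite ?G "lborel :: real measure" by standard
  define p where "p = Suc q"
  have p: "p > 0" by (simp add: p_def)
  define m where "m = real (card I) - real (card J)"
  have m: "m \<ge> 2 * real q + 4" using q by (simp add: m_def)
  define c2 where "c2 = chi_moment (card J) p"
  define c1 where "c1 = 1 / 2 * exp ((xlnx (m - 2 * real q - 4) - xlnx (m - 4)) / 2 + real q)"
  define c3 where "c3 = normal_moment p"
  define mp where "mp = (fact (2 * p) / (2 ^ p * fact p) :: real)"
  have c: "c1 > 0" "c2 > 0" "c3 > 0" "mp > 0" "c3 \<le> mp"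
    using gaussian_even_moment_ge[OF p] by (auto simp: c1_def c2_def c3_def mp_def)
  define nrm where "nrm x = sqsum J x" for x :: "'b \<Rightarrow> real"
  define u where "u x j = x j / sqrt (nrm x)" for x :: "'b \<Rightarrow> real" and j
  have u: "(\<Sum>j\<in>J. (u x j)\<^sup>2) = 1" if "nrm x > 0" for x
    using that by (simp add: u_def power_divide sum_divide_distrib[symmetric] nrm_def[symmetric])
  have nrm_nonneg: "nrm x \<ge> 0" for x by (simp add: nrm_def sum_nonneg)
  define R where "R s x B = fibre_num I J e s (u x) B / fibre_den I J e s (u x) B" for s x B
  \<comment> \<open>\<open>K\<close> plays the role of \<open>fact q / m ^ p\<close> with
    \<open>m\<close> the squared distance in the direction of \<open>x\<close>: the Gamma integral
    of \<open>s ^ q\<close> raises the order by one, whence \<open>p = Suc q\<close>.\<close>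
  define K where "K B x = (\<integral>\<^sup>+s. ennreal (s ^ q) * indicator {0<..} s * R s x B \<partial>lborel)" for B x
  define S where "S B = (\<integral>\<^sup>+x. ennreal (nrm x ^ p) * K B x \<partial>?H)" for B
  have nrm_meas [measurable]: "nrm \<in> borel_measurable ?H"
    unfolding nrm_def by measurable
  have R_meas: "(\<lambda>\<omega>. R (f \<omega>) (g \<omega>) (h \<omega>)) \<in> borel_measurable M"
    if f: "f \<in> borel_measurable M" and g: "g \<in> measurable M ?H" and h: "h \<in> measurable M ?G"
    for f g h and M :: "'z measure"
  proof -
    note [measurable] = f g h
    have 1: "(\<lambda>\<omega>. u (g \<omega>) j) \<in> borel_measurable M" if "j \<in> J" for j
    proof -
      have "(\<lambda>\<omega>. g \<omega> j) \<in> borel_measurable M"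
        by (rule measurable_compose[OF g gauss_component_measurable[OF that]])
      moreover have "(\<lambda>\<omega>. nrm (g \<omega>)) \<in> borel_measurable M"
        by (rule measurable_compose[OF g nrm_meas])
      ultimately show ?thesis unfolding u_def by simp
    qed
    have 2: "(\<lambda>\<omega>. h \<omega> (i, j)) \<in> borel_measurable M" if "i \<in> I" "j \<in> J" for i j
      using that by (intro measurable_compose[OF h gauss_component_measurable]) auto
    show ?thesis
      unfolding R_def by (intro borel_measurable_divide_ennreal fibre_measurable J f 1 2)
  qed
  have K_meas: "case_prod K \<in> borel_measurable (?G \<Otimes>\<^sub>M ?H)"
  proof -
    have [measurable]: "(\<lambda>w. R (snd w) (snd (fst w)) (fst (fst w))) \<in> borel_measurable ((?G \<Otimes>\<^sub>M ?H) \<Otimes>\<^sub>M lborel)"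
      by (intro R_meas) measurable
    show ?thesis
      unfolding K_def split_beta' by (intro lborel.borel_measurable_nn_integral) (simp add: split_beta', measurable)
  qed
  then have KK: "(\<lambda>(B, x). ennreal (nrm x ^ p) * K B x) \<in> borel_measurable (?G \<Otimes>\<^sub>M ?H)"
    by measurable
  have S_meas [measurable]: "S \<in> borel_measurable ?G"
    unfolding S_def using KK by (intro H.borel_measurable_nn_integral) simp
  have K_le: "(\<integral>\<^sup>+B. K B x \<partial>?G) \<le> ennreal (c1 * fact q)" if x: "nrm x > 0" "x \<in> space ?H" for x
  proof -
    have [measurable]: "(\<lambda>w. R (snd w) x (fst w)) \<in> borel_measurable (?G \<Otimes>\<^sub>M lborel)"
      using x(2) by (intro R_meas) measurable
    have "(\<integral>\<^sup>+B. K B x \<partial>?G) = (\<integral>\<^sup>+s. (\<integral>\<^sup>+B. ennreal (s ^ q) * indicator {0<..} s * R s x B \<partial>?G) \<partial>lborel)"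
      unfolding K_def by (intro GL.Fubini'[symmetric]) measurable
    also have "\<dots> \<le> (\<integral>\<^sup>+s. ennreal (s ^ q) * indicator {0<..} s * ennreal ((1 + 2 * s) powr (- m / 2)) \<partial>lborel)"
    proof (rule nn_integral_mono)
      fix s :: real
      have Rs: "(\<lambda>B. R s x B) \<in> borel_measurable ?G"
        using x(2) by (intro R_meas) auto
      have "(\<integral>\<^sup>+B. ennreal (s ^ q) * indicator {0<..} s * R s x B \<partial>?G)
          = ennreal (s ^ q) * indicator {0<..} s * (\<integral>\<^sup>+B. R s x B \<partial>?G)"
        by (rule nn_integral_cmult[OF Rs])
      also have "\<dots> \<le> ennreal (s ^ q) * indicator {0<..} s * ennreal ((1 + 2 * s) powr (- m / 2))"
      proof (cases "s > 0")
        case True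
        have "(\<integral>\<^sup>+B. R s x B \<partial>?G) \<le> ennreal ((1 + 2 * s) powr (- m / 2))"
          using nn_integral_fibre_ratio_le[OF I J(1) u[OF x(1)] True e] unfolding R_def m_def by simp
        then show ?thesis by (intro mult_left_mono) auto
      qed simp
      finally show "(\<integral>\<^sup>+B. ennreal (s ^ q) * indicator {0<..} s * R s x B \<partial>?G)
        \<le> ennreal (s ^ q) * indicator {0<..} s * ennreal ((1 + 2 * s) powr (- m / 2))" .
    qed
    also have "\<dots> \<le> ennreal (c1 * fact q)"
      unfolding c1_def by (rule nn_integral_beta_le[OF m])
    finally show ?thesis .
  qed
  have "(\<integral>\<^sup>+B. S B \<partial>?G) = (\<integral>\<^sup>+x. (\<integral>\<^sup>+B. ennreal (nrm x ^ p) * K B x \<partial>?G) \<partial>?H)"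
    unfolding S_def by (rule GH.Fubini'[symmetric]) (rule KK)
  also have "\<dots> \<le> (\<integral>\<^sup>+x. ennreal (c1 * fact q) * ennreal (nrm x ^ p) \<partial>?H)"
  proof (rule nn_integral_mono)
    fix x assume x: "x \<in> space ?H"
    have Km: "(\<lambda>B. K B x) \<in> borel_measurable ?G"
      using K_meas x by measurable
    have "(\<integral>\<^sup>+B. ennreal (nrm x ^ p) * K B x \<partial>?G) = ennreal (nrm x ^ p) * (\<integral>\<^sup>+B. K B x \<partial>?G)"
      by (rule nn_integral_cmult[OF Km])
    also have "\<dots> \<le> ennreal (nrm x ^ p) * ennreal (c1 * fact q)"
    proof (cases "nrm x > 0")
      case True
      then show ?thesis by (intro mult_left_mono K_le x) auto
    next
      case False
      then have "nrm x = 0" using nrm_nonneg[of x] by simp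
      then show ?thesis using p by (simp add: zero_power)
    qed
    finally show "(\<integral>\<^sup>+B. ennreal (nrm x ^ p) * K B x \<partial>?G) \<le> ennreal (c1 * fact q) * ennreal (nrm x ^ p)"
      by (simp only: mult.commute)
  qed
  also have "\<dots> = ennreal (c1 * fact q) * (\<integral>\<^sup>+x. ennreal (nrm x ^ p) \<partial>?H)"
    by (intro nn_integral_cmult) measurable
  also have "\<dots> \<le> ennreal (c1 * fact q) * ennreal c2"
    unfolding c2_def nrm_def using J p by (intro mult_left_mono nn_integral_gauss_sum_squares_power_le) auto
  finally have S_le: "(\<integral>\<^sup>+B. S B \<partial>?G) \<le> ennreal (c1 * fact q * c2)"
    using c by (simp add: ennreal_mult)
  \<comment> \<open>The smallest value that a vector contracted to \<open>T\<close> can force on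
    \<open>S\<close>; the proof that such matrices lie in \<open>E\<close> recovers exactly this
    constant.\<close>
  define a where "a = fact q * mp / (T + e) ^ p"
  have a: "a > 0" using c T e by (simp add: a_def)
  define E where "E = {B \<in> space ?G. 1 \<le> ennreal (1 / a) * S B}"
  have E: "E \<in> sets ?G" unfolding E_def by measurable
  have "emeasure ?G E \<le> ennreal (1 / a) * (\<integral>\<^sup>+B. S B * indicator (space ?G) B \<partial>?G)"
    using nn_integral_Markov_inequality[of S "space ?G" ?G "ennreal (1 / a)"]
    by (simp add: E_def)
  also have "(\<integral>\<^sup>+B. S B * indicator (space ?G) B \<partial>?G) = (\<integral>\<^sup>+B. S B \<partial>?G)"
    by (intro nn_integral_cong) simp
  also have "ennreal (1 / a) * (\<integral>\<^sup>+B. S B \<partial>?G) \<le> ennreal (1 / a) * ennreal (c1 * fact q * c2)"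
    by (intro mult_left_mono S_le) auto
  also have "\<dots> = ennreal (c1 * fact q * c2 / a)"
    using c a by (simp add: ennreal_mult[symmetric])
  also have "c1 * fact q * c2 / a = c2 * c1 * (T + e) ^ p / mp"
    using T e by (simp add: a_def)
  also have "ennreal (c2 * c1 * (T + e) ^ p / mp) \<le> ennreal (c2 * c1 * (T + e) ^ p / c3)"
    using c T e by (intro ennreal_leI divide_left_mono mult_nonneg_nonneg mult_pos_pos) auto
  finally have E_le: "emeasure ?G E \<le> ennreal (c2 * c1 * (T + e) ^ p / c3)" .
  have "B \<in> E" if B: "B \<in> space ?G" and v: "sqsum J v > 0"
    and le: "matsq I J B v \<le> T * sqsum J v" for B v
  proof -
    define V where "V = (T + e) * sqsum J v"
    have V: "V > 0" using T e v by (simp add: V_def)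
    have pt: "ennreal (fact q / V ^ p) * ennreal ((\<Sum>j\<in>J. v j * x j) ^ (2 * p)) \<le> ennreal (nrm x ^ p) * K B x" for x
    proof (cases "(\<Sum>j\<in>J. v j * x j) = 0")
      case True
      then show ?thesis using p by (simp add: zero_power)
    next
      case False
      define t where "t = (\<Sum>j\<in>J. v j * x j)"
      have t: "t \<noteq> 0" using False by (simp add: t_def)
      have "nrm x \<noteq> 0"
      proof
        assume "nrm x = 0"
        then have "x j = 0" if "j \<in> J" for j
          using J that by (simp add: nrm_def sum_nonneg_eq_0_iff)
        then show False using False by simp
      qed
      then have r: "nrm x > 0" using nrm_nonneg[of x] by simp
      \<comment> \<open>\<open>y\<close> is \<open>v\<close> rescaled so that its inner product with
        the unit vector along \<open>x\<close> is one, as the ratio bound requires.\<close>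
      define y where "y j = v j * (sqrt (nrm x) / t)" for j
      have y1: "(\<Sum>j\<in>J. u x j * y j) = 1"
      proof -
        have "(\<Sum>j\<in>J. u x j * y j) = (\<Sum>j\<in>J. v j * x j / t)"
          using r t by (intro sum.cong refl) (simp add: u_def y_def)
        then show ?thesis using t by (simp add: sum_divide_distrib[symmetric] t_def)
      qed
      define Y where "Y = V * (nrm x / t\<^sup>2)"
      have Y: "Y > 0" using V r t by (simp add: Y_def)
      have sc: "matsq I J B y + e * sqsum J y \<le> Y"
      proof -
        have By: "(\<Sum>j\<in>J. B (i, j) * y j) = (\<Sum>j\<in>J. B (i, j) * v j) * (sqrt (nrm x) / t)" for i
          unfolding y_def sum_distrib_right by (intro sum.cong refl) simp
        have sq: "(sqrt (nrm x) / t)\<^sup>2 = nrm x / t\<^sup>2"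
          using r by (simp add: power_divide)
        have "matsq I J B y = (matsq I J B v) * (nrm x / t\<^sup>2)"
          by (simp only: By power_mult_distrib sq sum_distrib_right[symmetric])
        moreover have "sqsum J y = (sqsum J v) * (nrm x / t\<^sup>2)"
          by (simp only: y_def power_mult_distrib sq sum_distrib_right[symmetric])
        ultimately have "matsq I J B y + e * (sqsum J y)
           = ((matsq I J B v) + e * (sqsum J v)) * (nrm x / t\<^sup>2)"
          by (simp only: distrib_right mult.assoc)
        also have "\<dots> \<le> V * (nrm x / t\<^sup>2)"
          using le r by (intro mult_right_mono) (auto simp: V_def distrib_right)
        finally show ?thesis by (simp add: Y_def)
      qed
      have "ennreal (fact q / Y ^ Suc q) = (\<integral>\<^sup>+s. ennreal (s ^ q) * indicator {0<..} s * ennreal (exp (- s * Y)) \<partial>lborel)"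
        by (rule nn_integral_power_exp[OF Y, symmetric])
      also have "\<dots> \<le> K B x"
        unfolding K_def
      proof (rule nn_integral_mono)
        fix s :: real
        show "ennreal (s ^ q) * indicator {0<..} s * ennreal (exp (- s * Y)) \<le> ennreal (s ^ q) * indicator {0<..} s * R s x B"
        proof (cases "s > 0")
          case True
          have "ennreal (exp (- s * Y)) \<le> ennreal (exp (- s * ((matsq I J B y) + e * (sqsum J y))))"
            using sc True by (intro ennreal_leI) simp
          also have "\<dots> \<le> R s x B"
            unfolding R_def by (rule fibre_ratio_ge[OF J(1) u[OF r] y1 True e])
          finally show ?thesis by (intro mult_left_mono) auto
        qed simp
      qed
      finally have "ennreal (nrm x ^ p) * ennreal (fact q / Y ^ Suc q) \<le> ennreal (nrm x ^ p) * K B x"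
        by (intro mult_left_mono) auto
      \<comment> \<open>The weight \<open>nrm x ^ p\<close> in \<open>S\<close> is there to cancel
        the power of the norm in \<open>Y\<close>, leaving a pure even power of the linear form
        \<open>t\<close>.\<close>
      moreover have "nrm x ^ p * (fact q / Y ^ Suc q) = fact q / V ^ p * t ^ (2 * p)"
        using r t V unfolding Y_def p_def[symmetric] power_mult_distrib power_divide power_mult[symmetric]
        by (simp add: field_simps)
      ultimately show ?thesis
        using r Y V by (simp add: ennreal_mult[symmetric] t_def)
    qed
    have "ennreal a = ennreal (fact q / V ^ p) * ennreal ((sqsum J v) ^ p * mp)"
    proof -
      have "a = fact q / V ^ p * ((sqsum J v) ^ p * mp)"
        using v T e by (simp add: a_def V_def power_mult_distrib)
      then show ?thesis using V c v by (simp add: ennreal_mult[symmetric])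
    qed
    also have "\<dots> = ennreal (fact q / V ^ p) * (\<integral>\<^sup>+x. ennreal ((\<Sum>j\<in>J. v j * x j) ^ (2 * p)) \<partial>?H)"
      using J p by (simp add: nn_integral_gauss_linear_power mp_def)
    also have "\<dots> = (\<integral>\<^sup>+x. ennreal (fact q / V ^ p) * ennreal ((\<Sum>j\<in>J. v j * x j) ^ (2 * p)) \<partial>?H)"
      by (intro nn_integral_cmult[symmetric]) measurable
    also have "\<dots> \<le> S B"
      unfolding S_def by (intro nn_integral_mono pt)
    finally have "ennreal (1 / a) * ennreal a \<le> ennreal (1 / a) * S B"
      by (intro mult_left_mono) auto
    moreover have "ennreal (1 / a) * ennreal a = 1"
      using a by (subst ennreal_mult[symmetric]) auto
    ultimately show ?thesis using B by (simp add: E_def)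
  qed
  then show ?thesis
    using E E_le unfolding c1_def c2_def c3_def m_def p_def by blast
qed

section \<open>Restricted isometry constants\<close>

text \<open>\<open>LEAST\<close> on the reals is informative only if a minimum exists. Closedness
  and the lower bound put the infimum into the set.\<close>

lemma Least_closed_real:
  fixes P :: "real \<Rightarrow> bool"
  assumes "closed {c. P c}" "\<exists>c. P c" "\<And>c. P c \<Longrightarrow> b \<le> c"
  shows "P (LEAST c. P c)" "P c \<Longrightarrow> (LEAST c. P c) \<le> c"
proof -
  have bdd: "bdd_below {c. P c}" using assms(3) by (auto intro!: bdd_belowI[of _ b])
  have Inf: "P (Inf {c. P c})"
    using closed_contains_Inf[OF _ bdd assms(1)] assms(2) by auto
  have "(LEAST c. P c) = Inf {c. P c}"
    using Inf bdd by (intro Least_equality) (auto intro: cInf_lower)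
  then show "P (LEAST c. P c)" "P c \<Longrightarrow> (LEAST c. P c) \<le> c"
    using Inf bdd by (auto intro: cInf_lower)
qed

lemma l2_norm_sq: "(l2_norm x)\<^sup>2 = (\<Sum>j<dim_vec x. (x $ j)\<^sup>2)"
  by (simp add: l2_norm_def L2_set_def sum_nonneg)

lemma l2_norm_mult_mat_vec_sq:
  assumes "A \<in> carrier_mat n N" "x \<in> carrier_vec N"
  shows "(l2_norm (A *\<^sub>v x))\<^sup>2 = (\<Sum>i<n. (\<Sum>j<N. A $$ (i, j) * x $ j)\<^sup>2)"
proof -
  have "(A *\<^sub>v x) $ i = (\<Sum>j<N. A $$ (i, j) * x $ j)" if "i < n" for i
    using assms that by (auto simp: scalar_prod_def atLeast0LessThan intro!: sum.cong)
  then show ?thesis using assms by (simp add: l2_norm_sq)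
qed

text \<open>The sign \<open>s = 1\<close> gives the condition defining \<open>rip_L\<close>, and \<open>s = -1\<close> the one defining \<open>rip_U\<close>.\<close>

definition rip_ok :: "real \<Rightarrow> nat \<Rightarrow> real mat \<Rightarrow> real \<Rightarrow> bool" where
  "rip_ok s k A c \<longleftrightarrow> 0 \<le> c \<and>
     (\<forall>x\<in>sparse_vecs (dim_col A) k. 0 \<le> s * (l2_norm (A *\<^sub>v x))\<^sup>2 + (c - s) * (l2_norm x)\<^sup>2)"

definition rip_const :: "real \<Rightarrow> nat \<Rightarrow> real mat \<Rightarrow> real" where
  "rip_const s k A = (LEAST c. rip_ok s k A c)"

lemma rip_L_eq: "rip_L = rip_const 1"
  by (simp add: fun_eq_iff rip_L_def rip_const_def rip_ok_def algebra_simps)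

lemma rip_U_eq: "rip_U = rip_const (-1)"
  by (simp add: fun_eq_iff rip_U_def rip_const_def rip_ok_def algebra_simps)

lemma rip_ok_mono:
  assumes "rip_ok s k A c" "c \<le> d"
  shows "rip_ok s k A d"
proof -
  have "(c - s) * (l2_norm x)\<^sup>2 \<le> (d - s) * (l2_norm x)\<^sup>2" for x
    using assms(2) by (intro mult_right_mono) auto
  with assms show ?thesis
    unfolding rip_ok_def by (meson add_left_mono order_trans)
qed

text \<open>By Cauchy-Schwarz, |A x|^2 is at most the squared Frobenius norm \<open>?F\<close> times
  |x|^2, and the level \<open>?F + 1\<close> serves both signs.\<close>

lemma ex_rip_ok:
  assumes "\<bar>s\<bar> = 1"
  shows "\<exists>c. rip_ok s k A c"
proof -
  define n N where "n = dim_row A" and "N = dim_col A"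
  have A: "A \<in> carrier_mat n N" by (simp add: n_def N_def)
  let ?F = "\<Sum>i<n. \<Sum>j<N. (A $$ (i, j))\<^sup>2"
  have F: "?F \<ge> 0" by (intro sum_nonneg) auto
  have "0 \<le> s * (l2_norm (A *\<^sub>v x))\<^sup>2 + (?F + 1 - s) * (l2_norm x)\<^sup>2" if x: "x \<in> carrier_vec N" for x
  proof -
    have "(l2_norm (A *\<^sub>v x))\<^sup>2 \<le> (\<Sum>i<n. (\<Sum>j<N. (A $$ (i, j))\<^sup>2) * (\<Sum>j<N. (x $ j)\<^sup>2))"
      unfolding l2_norm_mult_mat_vec_sq[OF A x] by (intro sum_mono Cauchy_Schwarz_ineq_sum)
    also have "\<dots> = ?F * (l2_norm x)\<^sup>2"
      using x by (simp add: l2_norm_sq sum_distrib_right)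
    finally have le: "(l2_norm (A *\<^sub>v x))\<^sup>2 \<le> ?F * (l2_norm x)\<^sup>2" .
    have "0 \<le> ?F * (l2_norm x)\<^sup>2" using F by (intro mult_nonneg_nonneg) auto
    moreover from assms have "s = 1 \<or> s = -1" by linarith
    then have "s * (l2_norm (A *\<^sub>v x))\<^sup>2 + (?F + 1 - s) * (l2_norm x)\<^sup>2 = (l2_norm (A *\<^sub>v x))\<^sup>2 + ?F * (l2_norm x)\<^sup>2
      \<or> s * (l2_norm (A *\<^sub>v x))\<^sup>2 + (?F + 1 - s) * (l2_norm x)\<^sup>2 = 2 * (l2_norm x)\<^sup>2 + (?F * (l2_norm x)\<^sup>2 - (l2_norm (A *\<^sub>v x))\<^sup>2)"
      by (elim disjE) (simp_all add: distrib_right)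
    ultimately show ?thesis
      using le zero_le_power2[of "l2_norm x"] zero_le_power2[of "l2_norm (A *\<^sub>v x)"] by linarith
  qed
  with F have "rip_ok s k A (?F + 1)"
    by (auto simp: rip_ok_def sparse_vecs_def N_def[symmetric])
  then show ?thesis ..
qed

text \<open>Each vector imposes a closed condition on \<open>c\<close>, so the admissible levels
  form a closed set bounded below by zero and the constant is a true minimum.\<close>

lemma rip_const_least:
  assumes "\<bar>s\<bar> = 1"
  shows "rip_ok s k A (rip_const s k A)" "rip_ok s k A c \<Longrightarrow> rip_const s k A \<le> c"
proof -
  have "{c. rip_ok s k A c} = {0..} \<inter> (\<Inter>x\<in>sparse_vecs (dim_col A) k.
      {c. 0 \<le> s * (l2_norm (A *\<^sub>v x))\<^sup>2 + (c - s) * (l2_norm x)\<^sup>2})"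
    by (auto simp: rip_ok_def)
  also have "closed \<dots>"
    by (intro closed_Int closed_INT ballI closed_Collect_le continuous_intros)
  finally have cl: "closed {c. rip_ok s k A c}" .
  have nonneg: "rip_ok s k A c \<Longrightarrow> 0 \<le> c" for c
    by (simp add: rip_ok_def)
  show "rip_ok s k A (rip_const s k A)"
    unfolding rip_const_def by (rule Least_closed_real(1)[OF cl ex_rip_ok[OF assms] nonneg])
  show "rip_ok s k A c \<Longrightarrow> rip_const s k A \<le> c"
    unfolding rip_const_def by (rule Least_closed_real(2)[OF cl ex_rip_ok[OF assms] nonneg])
qed

text \<open>At \<open>c = 1\<close> the condition reads 0 \<le> |A x|^2. This settles every
  threshold above one, including the case \<rho> = 1.\<close>

lemma rip_L_le_one: "rip_L k A \<le> 1"
  unfolding rip_L_eq by (rule rip_const_least) (simp_all add: rip_ok_def)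

text \<open>Admissible levels are upward closed, so a rational level can be inserted below
  \<open>c\<close>. The event then becomes a countable union.\<close>

lemma rip_const_less_iff:
  assumes "\<bar>s\<bar> = 1"
  shows "rip_const s k A < c \<longleftrightarrow> (\<exists>q\<in>\<rat>. q < c \<and> rip_ok s k A q)"
proof
  assume "rip_const s k A < c"
  then obtain q where "q \<in> \<rat>" "rip_const s k A < q" "q < c" using Rats_dense_in_real by blast
  then show "\<exists>q\<in>\<rat>. q < c \<and> rip_ok s k A q"
    using rip_ok_mono[OF rip_const_least(1)[OF assms]] by (meson less_imp_le)
next
  assume "\<exists>q\<in>\<rat>. q < c \<and> rip_ok s k A q"
  then obtain q where "q < c" "rip_ok s k A q" by blast
  then show "rip_const s k A < c" using rip_const_least(2)[OF assms, of k A q] by simp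
qed

section \<open>Measurability of the restricted isometry events\<close>

definition rat_sparse_vecs :: "nat \<Rightarrow> nat \<Rightarrow> real vec set" where
  "rat_sparse_vecs N k = {x \<in> sparse_vecs N k. \<forall>j<N. x $ j \<in> \<rat>}"

lemma countable_rat_sparse_vecs: "countable (rat_sparse_vecs N k)"
proof -
  have "rat_sparse_vecs N k \<subseteq> vec N ` ({..<N} \<rightarrow>\<^sub>E \<rat>)"
  proof
    fix x assume "x \<in> rat_sparse_vecs N k"
    then have x: "x \<in> carrier_vec N" "\<And>j. j < N \<Longrightarrow> x $ j \<in> \<rat>"
      by (auto simp: rat_sparse_vecs_def sparse_vecs_def)
    have "x = vec N (\<lambda>j\<in>{..<N}. x $ j)"
      using x(1) by (intro eq_vecI) auto
    then show "x \<in> vec N ` ({..<N} \<rightarrow>\<^sub>E \<rat>)"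
      using x(2) by (intro image_eqI[where x = "\<lambda>j\<in>{..<N}. x $ j"]) auto
  qed
  moreover have "countable (vec N ` ({..<N} \<rightarrow>\<^sub>E \<rat>) :: real vec set)"
    by (intro countable_image countable_PiE) (auto simp: countable_rat)
  ultimately show ?thesis by (rule countable_subset)
qed

lemma tendsto_floor_mult_div:
  fixes x :: real
  shows "(\<lambda>r. of_int \<lfloor>real (Suc r) * x\<rfloor> / real (Suc r)) \<longlonglongrightarrow> x"
proof (rule tendsto_sandwich)
  show "(\<lambda>r. x - 1 / real (Suc r)) \<longlonglongrightarrow> x"
    using tendsto_diff[OF tendsto_const LIMSEQ_inverse_real_of_nat, of x] by (simp add: divide_inverse)
  show "\<forall>\<^sub>F r in sequentially. x - 1 / real (Suc r) \<le> of_int \<lfloor>real (Suc r) * x\<rfloor> / real (Suc r)"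
  proof (intro always_eventually allI)
    fix r
    have "real (Suc r) * x - 1 \<le> of_int \<lfloor>real (Suc r) * x\<rfloor>" by linarith
    then have "(real (Suc r) * x - 1) / real (Suc r) \<le> of_int \<lfloor>real (Suc r) * x\<rfloor> / real (Suc r)"
      by (intro divide_right_mono) auto
    then show "x - 1 / real (Suc r) \<le> of_int \<lfloor>real (Suc r) * x\<rfloor> / real (Suc r)"
      by (simp add: diff_divide_distrib)
  qed
  show "\<forall>\<^sub>F r in sequentially. of_int \<lfloor>real (Suc r) * x\<rfloor> / real (Suc r) \<le> x"
  proof (intro always_eventually allI)
    fix r
    have "of_int \<lfloor>real (Suc r) * x\<rfloor> / real (Suc r) \<le> (real (Suc r) * x) / real (Suc r)"
      by (intro divide_right_mono of_int_floor_le) auto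
    then show "of_int \<lfloor>real (Suc r) * x\<rfloor> / real (Suc r) \<le> x" by simp
  qed
qed simp

text \<open>Rounding to multiples of \<open>1 / (r + 1)\<close> by the floor function keeps zero entries, hence sparsity.\<close>

lemma rat_sparse_vecs_dense:
  fixes x :: "real vec"
  assumes x: "x \<in> sparse_vecs N k"
  shows "\<exists>X. (\<forall>r. X r \<in> rat_sparse_vecs N k) \<and> (\<forall>j<N. (\<lambda>r. X r $ j) \<longlonglongrightarrow> x $ j)"
proof (intro exI conjI allI impI)
  define X where "X r = vec N (\<lambda>j. of_int \<lfloor>real (Suc r) * x $ j\<rfloor> / real (Suc r))" for r
  show "(\<lambda>r. X r $ j) \<longlonglongrightarrow> x $ j" if "j < N" for j
    using that tendsto_floor_mult_div[of "x $ j"] by (simp add: X_def)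
  show "X r \<in> rat_sparse_vecs N k" for r
  proof -
    have "{i. i < N \<and> X r $ i \<noteq> 0} \<subseteq> {i. i < dim_vec x \<and> x $ i \<noteq> 0}"
      using x by (auto simp: X_def sparse_vecs_def)
    then have "card {i. i < N \<and> X r $ i \<noteq> 0} \<le> card {i. i < dim_vec x \<and> x $ i \<noteq> 0}"
      by (intro card_mono) auto
    moreover have "dim_vec (X r) = N" by (simp add: X_def)
    ultimately have "l0_norm (X r) \<le> k" using x by (auto simp: sparse_vecs_def l0_norm_def)
    then show ?thesis by (auto simp: rat_sparse_vecs_def sparse_vecs_def X_def)
  qed
qed

text \<open>The form is continuous in the coordinates and rational sparse vectors are dense among
  sparse ones, so an uncountable intersection of events reduces to a countable one.\<close>

lemma quadratic_ineq_sparse_iff_rat: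
  fixes a b :: real
  assumes A: "A \<in> carrier_mat n N"
  shows "(\<forall>x\<in>sparse_vecs N k. 0 \<le> a * (l2_norm (A *\<^sub>v x))\<^sup>2 + b * (l2_norm x)\<^sup>2)
    \<longleftrightarrow> (\<forall>x\<in>rat_sparse_vecs N k. 0 \<le> a * (l2_norm (A *\<^sub>v x))\<^sup>2 + b * (l2_norm x)\<^sup>2)"
proof
  let ?F = "\<lambda>x. a * (l2_norm (A *\<^sub>v x))\<^sup>2 + b * (l2_norm x)\<^sup>2"
  have F: "?F x = a * (\<Sum>i<n. (\<Sum>j<N. A $$ (i, j) * x $ j)\<^sup>2) + b * (\<Sum>j<N. (x $ j)\<^sup>2)" if "x \<in> carrier_vec N" for x
    using that by (simp only: l2_norm_mult_mat_vec_sq[OF A that]) (simp add: l2_norm_sq)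
  assume R: "\<forall>x\<in>rat_sparse_vecs N k. 0 \<le> ?F x"
  show "\<forall>x\<in>sparse_vecs N k. 0 \<le> ?F x"
  proof
    fix x assume x: "x \<in> sparse_vecs N k"
    obtain X where X: "\<And>r. X r \<in> rat_sparse_vecs N k" "\<And>j. j < N \<Longrightarrow> (\<lambda>r. X r $ j) \<longlonglongrightarrow> x $ j"
      using rat_sparse_vecs_dense[OF x] by auto
    have c: "X r \<in> carrier_vec N" "x \<in> carrier_vec N" for r
      using X(1)[of r] x by (auto simp: rat_sparse_vecs_def sparse_vecs_def)
    have "(\<lambda>r. ?F (X r)) \<longlonglongrightarrow> ?F x"
      unfolding F[OF c(1)] F[OF c(2)] by (intro tendsto_intros X(2)) auto
    then show "0 \<le> ?F x"
      using R X(1) by (intro LIMSEQ_le_const) auto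
  qed
qed (auto simp: rat_sparse_vecs_def)

lemma quadratic_ineq_sets:
  assumes carr: "\<And>\<omega>. \<omega> \<in> space M \<Longrightarrow> A \<omega> \<in> carrier_mat n N"
    and meas: "\<And>i j. i < n \<Longrightarrow> j < N \<Longrightarrow> (\<lambda>\<omega>. A \<omega> $$ (i, j)) \<in> borel_measurable M"
  shows "{\<omega> \<in> space M. \<forall>x\<in>sparse_vecs N k. 0 \<le> a * (l2_norm (A \<omega> *\<^sub>v x))\<^sup>2 + b * (l2_norm x)\<^sup>2} \<in> sets M"
proof -
  have "{\<omega> \<in> space M. \<forall>x\<in>sparse_vecs N k. 0 \<le> a * (l2_norm (A \<omega> *\<^sub>v x))\<^sup>2 + b * (l2_norm x)\<^sup>2}
     = {\<omega> \<in> space M. \<forall>x\<in>rat_sparse_vecs N k. 0 \<le> a * (\<Sum>i<n. (\<Sum>j<N. A \<omega> $$ (i, j) * x $ j)\<^sup>2) + b * (l2_norm x)\<^sup>2}"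
  proof (intro Collect_cong conj_cong refl)
    fix \<omega> assume "\<omega> \<in> space M"
    note A = carr[OF this]
    show "(\<forall>x\<in>sparse_vecs N k. 0 \<le> a * (l2_norm (A \<omega> *\<^sub>v x))\<^sup>2 + b * (l2_norm x)\<^sup>2)
      \<longleftrightarrow> (\<forall>x\<in>rat_sparse_vecs N k. 0 \<le> a * (\<Sum>i<n. (\<Sum>j<N. A \<omega> $$ (i, j) * x $ j)\<^sup>2) + b * (l2_norm x)\<^sup>2)"
      unfolding quadratic_ineq_sparse_iff_rat[OF A]
      by (intro ball_cong refl) (simp add: l2_norm_mult_mat_vec_sq[OF A] rat_sparse_vecs_def sparse_vecs_def)
  qed
  also have "\<dots> = space M - (\<Union>x\<in>rat_sparse_vecs N k. space M -
      {\<omega> \<in> space M. 0 \<le> a * (\<Sum>i<n. (\<Sum>j<N. A \<omega> $$ (i, j) * x $ j)\<^sup>2) + b * (l2_norm x)\<^sup>2})"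
    by auto
  also have "\<dots> \<in> sets M"
  proof (intro sets.Diff sets.top sets.countable_UN'' countable_rat_sparse_vecs)
    fix x :: "real vec"
    have [measurable]: "(\<lambda>\<omega>. a * (\<Sum>i<n. (\<Sum>j<N. A \<omega> $$ (i, j) * x $ j)\<^sup>2) + b * (l2_norm x)\<^sup>2) \<in> borel_measurable M"
      by (intro borel_measurable_add borel_measurable_times borel_measurable_sum borel_measurable_power meas) auto
    show "{\<omega> \<in> space M. 0 \<le> a * (\<Sum>i<n. (\<Sum>j<N. A \<omega> $$ (i, j) * x $ j)\<^sup>2) + b * (l2_norm x)\<^sup>2} \<in> sets M"
      by measurable
  qed
  finally show ?thesis .
qed

lemma rip_const_less_sets:
  assumes s: "\<bar>s\<bar> = 1"
    and carr: "\<And>\<omega>. \<omega> \<in> space M \<Longrightarrow> A \<omega> \<in> carrier_mat n N"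
    and meas: "\<And>i j. i < n \<Longrightarrow> j < N \<Longrightarrow> (\<lambda>\<omega>. A \<omega> $$ (i, j)) \<in> borel_measurable M"
  shows "{\<omega> \<in> space M. rip_const s k (A \<omega>) < c} \<in> sets M"
proof -
  have ok: "{\<omega> \<in> space M. rip_ok s k (A \<omega>) q} \<in> sets M" for q
  proof -
    have "{\<omega> \<in> space M. rip_ok s k (A \<omega>) q} = (if 0 \<le> q then
        {\<omega> \<in> space M. \<forall>x\<in>sparse_vecs N k. 0 \<le> s * (l2_norm (A \<omega> *\<^sub>v x))\<^sup>2 + (q - s) * (l2_norm x)\<^sup>2} else {})"
      using carr by (force simp: rip_ok_def)
    then show ?thesis using quadratic_ineq_sets[OF carr meas, of k s "q - s"] by auto
  qed
  have "{\<omega> \<in> space M. rip_const s k (A \<omega>) < c} = (\<Union>q\<in>{q\<in>\<rat>. q < c}. {\<omega> \<in> space M. rip_ok s k (A \<omega>) q})"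
    by (auto simp: rip_const_less_iff[OF s])
  also have "\<dots> \<in> sets M"
  proof (rule sets.countable_UN'')
    show "countable {q \<in> \<rat>. q < c}" by (rule countable_subset[OF _ countable_rat]) blast
  qed (rule ok)
  finally show ?thesis .
qed

text \<open>A support has at most \<open>min k N\<close> elements and is padded to exactly
  \<open>k'\<close>, so that the union bound runs over index sets of a single size.\<close>

lemma sparse_vec_support:
  fixes x :: "real vec"
  assumes "x \<in> sparse_vecs N k" "min k N \<le> k'" "k' \<le> N"
  obtains K where "K \<subseteq> {..<N}" "card K = k'" "\<And>j. j < N \<Longrightarrow> j \<notin> K \<Longrightarrow> x $ j = 0"
proof -
  let ?S = "{i. i < dim_vec x \<and> x $ i \<noteq> 0}"
  have x: "dim_vec x = N" "card ?S \<le> k" using assms by (auto simp: sparse_vecs_def l0_norm_def)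
  have "card ?S \<le> card {..<N}" using x by (intro card_mono) auto
  then have "card ?S \<le> k'" using x assms by simp
  then obtain K where K: "?S \<subseteq> K" "K \<subseteq> {..<N}" "card K = k'"
    using exists_subset_between[of ?S k' "{..<N}"] assms x by auto
  show ?thesis
    by (rule that[OF K(2,3)]) (use K(1) x(1) in blast)
qed

lemma sparse_vec_sums:
  fixes x :: "real vec"
  assumes A: "A \<in> carrier_mat n N" and x: "x \<in> carrier_vec N"
    and K: "K \<subseteq> {..<N}" "\<And>j. j < N \<Longrightarrow> j \<notin> K \<Longrightarrow> x $ j = 0"
  shows "(l2_norm x)\<^sup>2 = (\<Sum>j\<in>K. (x $ j)\<^sup>2)"
    and "(l2_norm (A *\<^sub>v x))\<^sup>2 = (\<Sum>i<n. (\<Sum>j\<in>K. A $$ (i, j) * x $ j)\<^sup>2)"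
proof -
  show "(l2_norm x)\<^sup>2 = (\<Sum>j\<in>K. (x $ j)\<^sup>2)"
    using x K by (auto simp: l2_norm_sq intro!: sum.mono_neutral_right)
  have "(\<Sum>j<N. A $$ (i, j) * x $ j) = (\<Sum>j\<in>K. A $$ (i, j) * x $ j)" for i
    using K by (intro sum.mono_neutral_right) auto
  then show "(l2_norm (A *\<^sub>v x))\<^sup>2 = (\<Sum>i<n. (\<Sum>j\<in>K. A $$ (i, j) * x $ j)\<^sup>2)"
    by (simp add: l2_norm_mult_mat_vec_sq[OF A x])
qed

section \<open>The exponents and their zeros\<close>

text \<open>Since \<open>ln 0 = 0\<close>, the value \<open>xlnx 0 = 0\<close> is the limit of
  \<open>x * ln x\<close> at zero. Exponents written with \<open>xlnx\<close> therefore pass to the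
  limit even when a ratio tends to zero.\<close>

lemma continuous_on_xlnx: "continuous_on {0..} xlnx"
  unfolding continuous_on_def
proof
  fix x :: real assume "x \<in> {0..}"
  then consider "x = 0" | "x > 0" by fastforce
  then show "(xlnx \<longlongrightarrow> xlnx x) (at x within {0..})"
  proof cases
    case 1
    have "((\<lambda>x::real. x * ln x) \<longlongrightarrow> 0) (at_right 0)" by real_asymp
    then have "(xlnx \<longlongrightarrow> 0) (at 0 within {0<..})" by (simp add: xlnx_def[abs_def])
    moreover have "at 0 within {0..} = at (0::real) within {0<..}"
      by (rule at_within_nhd[of _ UNIV]) auto
    ultimately show ?thesis using 1 by (simp add: xlnx_def)
  next
    case 2
    then have "isCont xlnx x"
      unfolding xlnx_def[abs_def] by (intro continuous_intros) auto
    then show ?thesis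
      using continuous_at_imp_continuous_at_within continuous_within by blast
  qed
qed

lemma tendsto_xlnx:
  assumes "(f \<longlongrightarrow> a) F" "a \<ge> 0" "\<forall>\<^sub>F x in F. f x \<ge> 0"
  shows "((\<lambda>x. xlnx (f x)) \<longlongrightarrow> xlnx a) F"
  using continuous_on_tendsto_compose[OF continuous_on_xlnx assms(1)] assms(2,3) by auto

lemma xlnx_nonpos: "0 \<le> x \<Longrightarrow> x \<le> 1 \<Longrightarrow> xlnx x \<le> 0"
  by (cases "x = 0") (auto simp: xlnx_def mult_nonneg_nonpos)

text \<open>Homogeneity up to a multiple of \<open>ln n\<close>. In the tail exponents these
  multiples nearly cancel, and functions of the ratios remain.\<close>

lemma xlnx_scaled:
  assumes "a \<ge> 0" "n > 0"
  shows "xlnx a = n * xlnx (a / n) + a * ln n"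
  using assms by (cases "a = 0") (auto simp: xlnx_def ln_div field_simps)

lemma shannon_entropy_eq_xlnx:
  assumes "0 \<le> p" "p \<le> 1"
  shows "shannon_entropy p = - xlnx p - xlnx (1 - p)"
  using assms by (cases "p = 0"; cases "p = 1") (auto simp: shannon_entropy_def xlnx_def ln_div)

lemma shannon_entropy_nonneg: "0 \<le> p \<Longrightarrow> p \<le> 1 \<Longrightarrow> 0 \<le> shannon_entropy p"
  using xlnx_nonpos[of p] xlnx_nonpos[of "1 - p"] by (simp add: shannon_entropy_eq_xlnx)

text \<open>With \<open>p = k / N\<close>, one term of the expansion of
  \<open>(p + (1 - p)) ^ N = 1\<close> is at most one.\<close>

lemma binomial_le_exp_entropy:
  assumes "k \<le> N" "N > 0"
  shows "real (N choose k) \<le> exp (real N * shannon_entropy (real k / real N))"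
proof (cases "k = 0 \<or> k = N")
  case True
  then show ?thesis using assms by (auto simp: shannon_entropy_def)
next
  case False
  then have k: "0 < k" "k < N" using assms by auto
  define p where "p = real k / real N"
  have p: "0 < p" "p < 1" using k by (auto simp: p_def)
  have pos: "p ^ k * (1 - p) ^ (N - k) > 0" using p by simp
  have "real (N choose k) * p ^ k * (1 - p) ^ (N - k) \<le> (\<Sum>i\<le>N. real (N choose i) * p ^ i * (1 - p) ^ (N - i))"
    using p assms by (intro member_le_sum) auto
  also have "\<dots> = (p + (1 - p)) ^ N" by (rule binomial_ring[symmetric])
  finally have "real (N choose k) * (p ^ k * (1 - p) ^ (N - k)) \<le> 1" by (simp add: mult.assoc)
  then have "real (N choose k) \<le> 1 / (p ^ k * (1 - p) ^ (N - k))"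
    using pos by (simp add: pos_le_divide_eq)
  also have "\<dots> = exp (- (real k * ln p + real (N - k) * ln (1 - p)))"
  proof -
    have "exp (real k * ln p) = p ^ k" "exp (real (N - k) * ln (1 - p)) = (1 - p) ^ (N - k)"
      using p by (simp_all add: exp_of_nat_mult del: of_nat_diff)
    then show ?thesis by (simp only: exp_minus exp_add inverse_eq_divide)
  qed
  also have "- (real k * ln p + real (N - k) * ln (1 - p)) = real N * shannon_entropy p"
  proof -
    have "real k = real N * p" "real (N - k) = real N * (1 - p)"
      using k by (auto simp: p_def field_simps)
    then show ?thesis using p by (simp add: shannon_entropy_eq_xlnx xlnx_def algebra_simps)
  qed
  finally show ?thesis by (simp add: p_def)
qed

section \<open>Monotonicity of the exponents and their unique zeros\<close>

lemma psi_max_strict_decreasing: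
  assumes "0 \<le> \<nu>" "1 + \<nu> \<le> l" "l < l'"
  shows "psi_max l' \<nu> < psi_max l \<nu>"
proof -
  have l: "l > 0" using assms by simp
  \<comment> \<open>\<open>ln t < t - 1\<close> holds strictly for positive \<open>t\<close> other
    than one. Multiplied by \<open>1 + \<nu>\<close>, which is at most \<open>l\<close>, it yields
    the decrease without derivatives.\<close>
  have "ln (l' / l) < l' / l - 1"
    using assms l ln_eq_minus_one[of "l' / l"] ln_le_minus_one[of "l' / l"] by (fastforce simp: order_less_le)
  then have "(1 + \<nu>) * (ln l' - ln l) < (1 + \<nu>) * ((l' - l) / l)"
    using assms l by (intro mult_strict_left_mono) (auto simp: ln_div diff_divide_distrib)
  also have "\<dots> \<le> l * ((l' - l) / l)"
    using assms l by (intro mult_right_mono) auto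
  finally have "(1 + \<nu>) * (ln l' - ln l) < l' - l" using l by simp
  then show ?thesis by (simp add: psi_max_def algebra_simps)
qed

lemma psi_min_strict_increasing:
  assumes "\<rho> < 1" "0 < l" "l < l'" "l' \<le> 1 - \<rho>"
  shows "psi_min l \<rho> < psi_min l' \<rho>"
proof -
  have "ln (l / l') < l / l' - 1"
    using assms ln_eq_minus_one[of "l / l'"] ln_le_minus_one[of "l / l'"] by (fastforce simp: order_less_le)
  then have "ln l - ln l' < - ((l' - l) / l')"
    using assms by (simp add: ln_div diff_divide_distrib)
  then have "(1 - \<rho>) * (ln l - ln l') < (1 - \<rho>) * (- ((l' - l) / l'))"
    using assms by (intro mult_strict_left_mono) auto
  also have "\<dots> \<le> l' * (- ((l' - l) / l'))"
    using assms by (intro mult_right_mono_neg) auto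
  finally have "(1 - \<rho>) * (ln l - ln l') < l - l'" using assms by simp
  then show ?thesis by (simp add: psi_min_def algebra_simps)
qed

text \<open>The union-bound exponent per ambient dimension: \<open>n * psi_max\<close> from one
  support plus \<open>N\<close> times the entropy from the number of supports, divided by
  \<open>N\<close> in the limit.\<close>

definition gap_max :: "real \<Rightarrow> real \<Rightarrow> real \<Rightarrow> real" where
  "gap_max \<delta> \<nu> l = \<delta> * psi_max l \<nu> + shannon_entropy (\<nu> * \<delta>)"

definition gap_min :: "real \<Rightarrow> real \<Rightarrow> real \<Rightarrow> real" where
  "gap_min \<delta> \<rho> l = \<delta> * psi_min l \<rho> + shannon_entropy (\<rho> * \<delta>)"

lemma gap_max_strict_decreasing:
  assumes "\<delta> > 0" "0 \<le> \<nu>" "1 + \<nu> \<le> l" "l < l'"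
  shows "gap_max \<delta> \<nu> l' < gap_max \<delta> \<nu> l"
  using assms psi_max_strict_decreasing[of \<nu> l l'] by (simp add: gap_max_def)

lemma gap_min_strict_increasing:
  assumes "\<delta> > 0" "\<rho> < 1" "0 < l" "l < l'" "l' \<le> 1 - \<rho>"
  shows "gap_min \<delta> \<rho> l < gap_min \<delta> \<rho> l'"
  using assms psi_min_strict_increasing[of \<rho> l l'] by (simp add: gap_min_def)

text \<open>At \<open>l = 1 + \<nu>\<close> the linear terms of \<open>psi_max\<close> cancel and
  the gap is nonnegative; for large \<open>l\<close> the linear term dominates and it is negative.
  Strict monotonicity gives uniqueness.\<close>

lemma lambda_max_ex1:
  assumes \<delta>: "0 < \<delta>" "\<delta> \<le> 1" and \<nu>: "0 \<le> \<nu>" "\<nu> \<le> 1"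
  shows "\<exists>!l. 1 + \<nu> \<le> l \<and> gap_max \<delta> \<nu> l = 0"
proof -
  have "psi_max (1 + \<nu>) \<nu> = 1/2 * ((1 + \<nu>) * ln (1 + \<nu>) - xlnx \<nu>)"
    by (simp add: psi_max_def xlnx_def)
  also have "\<dots> \<ge> 0"
  proof -
    have "0 \<le> (1 + \<nu>) * ln (1 + \<nu>)" using \<nu> by (intro mult_nonneg_nonneg) auto
    then show ?thesis using xlnx_nonpos[OF \<nu>] by simp
  qed
  finally have "gap_max \<delta> \<nu> (1 + \<nu>) \<ge> 0"
    unfolding gap_max_def using \<delta> \<nu> by (intro add_nonneg_nonneg mult_nonneg_nonneg shannon_entropy_nonneg mult_le_one) auto
  moreover have "\<forall>\<^sub>F l in at_top. gap_max \<delta> \<nu> l < 0"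
  proof -
    have "filterlim (\<lambda>l. (1 + \<nu>) * ln l - l) at_bot at_top" using \<nu> by real_asymp
    then have "\<forall>\<^sub>F l in at_top. (1 + \<nu>) * ln l - l < - (1 + \<nu> - xlnx \<nu>) - 2 * shannon_entropy (\<nu> * \<delta>) / \<delta>"
      by (simp add: filterlim_at_bot_dense)
    then show ?thesis
    proof eventually_elim
      case (elim l)
      then have "\<delta> * ((1 + \<nu>) * ln l - l) < \<delta> * (- (1 + \<nu> - xlnx \<nu>) - 2 * shannon_entropy (\<nu> * \<delta>) / \<delta>)"
        using \<delta> by (intro mult_strict_left_mono) auto
      also have "\<dots> = - (\<delta> * (1 + \<nu> - xlnx \<nu>)) - 2 * shannon_entropy (\<nu> * \<delta>)"
        using \<delta> by (simp add: field_simps)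
      finally show ?case by (simp add: gap_max_def psi_max_def xlnx_def algebra_simps)
    qed
  qed
  then have "\<forall>\<^sub>F l in at_top. gap_max \<delta> \<nu> l < 0 \<and> 1 + \<nu> \<le> l"
    by (intro eventually_conj eventually_ge_at_top)
  then obtain b where b: "gap_max \<delta> \<nu> b < 0" "1 + \<nu> \<le> b"
    unfolding eventually_at_top_linorder by blast
  moreover have "continuous_on {1 + \<nu>..b} (gap_max \<delta> \<nu>)"
    unfolding gap_max_def psi_max_def using \<nu> by (intro continuous_intros) auto
  ultimately obtain l where "1 + \<nu> \<le> l" "l \<le> b" "gap_max \<delta> \<nu> l = 0"
    using IVT2'[of "gap_max \<delta> \<nu>" b 0 "1 + \<nu>"] by auto
  then show ?thesis
    using gap_max_strict_decreasing[OF \<delta>(1) \<nu>(1)] by (metis less_irrefl linorder_neqE_linordered_idom)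
qed

lemma lambda_max_props:
  assumes "0 < \<delta>" "\<delta> \<le> 1" "0 \<le> \<nu>" "\<nu> \<le> 1"
  shows "1 + \<nu> \<le> lambda_max \<delta> \<nu>" "gap_max \<delta> \<nu> (lambda_max \<delta> \<nu>) = 0"
    "1 + \<nu> \<le> l \<Longrightarrow> gap_max \<delta> \<nu> l = 0 \<Longrightarrow> lambda_max \<delta> \<nu> = l"
proof -
  have eq: "lambda_max \<delta> \<nu> = (THE l. 1 + \<nu> \<le> l \<and> gap_max \<delta> \<nu> l = 0)"
    by (simp add: lambda_max_def gap_max_def)
  show "1 + \<nu> \<le> lambda_max \<delta> \<nu>" "gap_max \<delta> \<nu> (lambda_max \<delta> \<nu>) = 0"
    unfolding eq using theI'[OF lambda_max_ex1[OF assms]] by auto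
  show "1 + \<nu> \<le> l \<Longrightarrow> gap_max \<delta> \<nu> l = 0 \<Longrightarrow> lambda_max \<delta> \<nu> = l"
    unfolding eq by (intro the1_equality lambda_max_ex1[OF assms]) auto
qed

text \<open>The minimum over \<open>\<nu>\<close> is attained because the zero set of \<open>gap_max\<close> is compact; no
  continuity of \<open>lambda_max\<close> is needed.\<close>

lemma bound_U_attained:
  assumes \<delta>: "0 < \<delta>" "\<delta> \<le> 1" and \<rho>: "0 \<le> \<rho>" "\<rho> \<le> 1"
  obtains \<nu> where "\<rho> \<le> \<nu>" "\<nu> \<le> 1" "bound_U \<delta> \<rho> = lambda_max \<delta> \<nu> - 1"
proof -
  \<comment> \<open>The value at \<nu> = 1 caps the search for the minimum, so only a compact
    rectangle of pairs \<open>(l, \<nu>)\<close> matters.\<close>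
  define b where "b = lambda_max \<delta> 1"
  \<comment> \<open>\<open>g\<close> is \<open>gap_max\<close> rewritten through
    \<open>xlnx\<close>, so that continuity also holds where \<nu> = 0 or \<nu> * \<delta> =
    1.\<close>
  define g where "g z = \<delta> * (1/2 * ((1 + snd z) * ln (fst z) + 1 + snd z - xlnx (snd z) - fst z))
      + (- xlnx (snd z * \<delta>) - xlnx (1 - snd z * \<delta>))" for z :: "real \<times> real"
  define B where "B = {1..b} \<times> {\<rho>..1}"
  have in01: "0 \<le> \<nu> * \<delta>" "\<nu> * \<delta> \<le> 1" if "\<nu> \<in> {\<rho>..1}" for \<nu>
    using that \<delta> \<rho> by (auto intro: mult_le_one)
  have g_eq: "g (l, \<nu>) = gap_max \<delta> \<nu> l" if "\<nu> \<in> {\<rho>..1}" for l \<nu>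
    using in01[OF that] by (simp add: g_def gap_max_def psi_max_def shannon_entropy_eq_xlnx xlnx_def)
  have xl: "continuous_on B (\<lambda>z. xlnx (h z))" if "continuous_on B h" "\<And>z. z \<in> B \<Longrightarrow> h z \<ge> 0" for h
    using that(2) by (intro continuous_on_compose2[OF continuous_on_xlnx that(1)] image_subsetI) simp
  have "continuous_on B g"
    unfolding g_def using in01 \<rho>
    by (intro continuous_intros xl) (auto simp: B_def)
  moreover have "compact B" unfolding B_def by (intro compact_Times compact_Icc)
  moreover have "continuous_on B (\<lambda>z. fst z - 1 - snd z)" by (intro continuous_intros)
  ultimately have "closed {z \<in> B. g z = 0}" "closed {z \<in> B. 0 \<le> fst z - 1 - snd z}"
    using continuous_closed_preimage[of B g "{0}"] continuous_closed_preimage[of B "\<lambda>z. fst z - 1 - snd z" "{0..}"]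
    by (auto simp: compact_imp_closed vimage_def Int_def)
  then have "compact (B \<inter> ({z \<in> B. g z = 0} \<inter> {z \<in> B. 0 \<le> fst z - 1 - snd z}))"
    using \<open>compact B\<close> by (intro compact_Int_closed closed_Int)
  then have "compact (fst ` (B \<inter> ({z \<in> B. g z = 0} \<inter> {z \<in> B. 0 \<le> fst z - 1 - snd z})))" (is "compact ?S")
    by (intro compact_continuous_image continuous_intros)
  have S: "l \<in> ?S \<longleftrightarrow> l \<in> lambda_max \<delta> ` {\<rho>..1} \<and> l \<le> b" for l
  proof
    assume "l \<in> ?S"
    then obtain \<nu> where \<nu>: "\<nu> \<in> {\<rho>..1}" "l \<le> b" "g (l, \<nu>) = 0" "1 + \<nu> \<le> l"
      by (auto simp: B_def)
    then have "lambda_max \<delta> \<nu> = l"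
      using \<rho> g_eq[of \<nu> l] by (intro lambda_max_props \<delta>) auto
    then show "l \<in> lambda_max \<delta> ` {\<rho>..1} \<and> l \<le> b" using \<nu> by auto
  next
    assume "l \<in> lambda_max \<delta> ` {\<rho>..1} \<and> l \<le> b"
    then obtain \<nu> where \<nu>: "\<nu> \<in> {\<rho>..1}" "l \<le> b" "l = lambda_max \<delta> \<nu>" by auto
    then have "1 + \<nu> \<le> l" "g (l, \<nu>) = 0"
      using \<rho> lambda_max_props(1,2)[OF \<delta>, of \<nu>] g_eq[of \<nu> l] by auto
    then show "l \<in> ?S" using \<nu> \<rho> by (intro image_eqI[where x = "(l, \<nu>)"]) (auto simp: B_def)
  qed
  have "b \<in> ?S" using \<rho> by (subst S) (auto simp: b_def)
  then obtain s where s: "s \<in> ?S" "\<And>t. t \<in> ?S \<Longrightarrow> s \<le> t"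
    using compact_attains_inf[OF \<open>compact ?S\<close>] by blast
  have "s \<le> t" if "t \<in> lambda_max \<delta> ` {\<rho>..1}" for t
    using s S that by (meson le_cases order_trans)
  then have "(LEAST l. l \<in> lambda_max \<delta> ` {\<rho>..1}) = s"
    using s(1) S by (intro Least_equality) auto
  moreover obtain \<nu> where "\<nu> \<in> {\<rho>..1}" "s = lambda_max \<delta> \<nu>" using s(1) S by auto
  ultimately show ?thesis using that[of \<nu>] by (simp add: bound_U_def)
qed

text \<open>At \<open>l = 1 - \<rho>\<close> the exponent \<open>psi_min\<close> equals half the
  entropy of \<rho>, hence is nonnegative; near zero the logarithm has the positive coefficient
  \<open>1 - \<rho>\<close> and drives the gap to minus infinity.\<close>

lemma lambda_min_ex1:
  assumes \<delta>: "0 < \<delta>" "\<delta> \<le> 1" and \<rho>: "0 \<le> \<rho>" "\<rho> < 1"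
  shows "\<exists>!l. 0 < l \<and> l \<le> 1 - \<rho> \<and> gap_min \<delta> \<rho> l = 0"
proof -
  have "psi_min (1 - \<rho>) \<rho> = 1/2 * shannon_entropy \<rho>"
    using \<rho> by (simp add: psi_min_def shannon_entropy_eq_xlnx xlnx_def algebra_simps)
  also have "\<dots> \<ge> 0" using shannon_entropy_nonneg[of \<rho>] \<rho> by simp
  finally have "gap_min \<delta> \<rho> (1 - \<rho>) \<ge> 0"
    unfolding gap_min_def using \<delta> \<rho>
    by (intro add_nonneg_nonneg mult_nonneg_nonneg shannon_entropy_nonneg mult_le_one) auto
  moreover have "\<forall>\<^sub>F l in at_right 0. gap_min \<delta> \<rho> l < 0"
  proof -
    define r where "r = 1 - \<rho>"
    have r: "r > 0" using \<rho> by (simp add: r_def)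
    have "filterlim (\<lambda>l. r * ln l - l) at_bot (at_right 0)" using r by real_asymp
    then have "\<forall>\<^sub>F l in at_right 0. (1 - \<rho>) * ln l - l < - (2 * shannon_entropy \<rho> + 1 - \<rho> + xlnx \<rho>) - 2 * shannon_entropy (\<rho> * \<delta>) / \<delta>"
      by (simp add: filterlim_at_bot_dense r_def)
    then show ?thesis
    proof eventually_elim
      case (elim l)
      then have "\<delta> * ((1 - \<rho>) * ln l - l) < \<delta> * (- (2 * shannon_entropy \<rho> + 1 - \<rho> + xlnx \<rho>) - 2 * shannon_entropy (\<rho> * \<delta>) / \<delta>)"
        using \<delta> by (intro mult_strict_left_mono) auto
      also have "\<dots> = - (\<delta> * (2 * shannon_entropy \<rho> + 1 - \<rho> + xlnx \<rho>)) - 2 * shannon_entropy (\<rho> * \<delta>)"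
        using \<delta> by (simp add: field_simps)
      finally show ?case by (simp add: gap_min_def psi_min_def xlnx_def algebra_simps)
    qed
  qed
  moreover have "\<forall>\<^sub>F l in at_right 0. l \<in> {0<..<1 - \<rho>}"
    using \<rho> by (intro eventually_at_right_real) auto
  ultimately obtain a where a: "gap_min \<delta> \<rho> a < 0" "0 < a" "a < 1 - \<rho>" "gap_min \<delta> \<rho> (1 - \<rho>) \<ge> 0"
    using eventually_happens'[OF _ eventually_conj[of _ "at_right (0::real)"]] by (metis (no_types, lifting) greaterThanLessThan_iff trivial_limit_at_right_real)
  moreover have "continuous_on {a..1 - \<rho>} (gap_min \<delta> \<rho>)"
    unfolding gap_min_def psi_min_def using a(2) by (intro continuous_intros) auto
  ultimately obtain l where "a \<le> l" "l \<le> 1 - \<rho>" "gap_min \<delta> \<rho> l = 0"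
    using IVT'[of "gap_min \<delta> \<rho>" a 0 "1 - \<rho>"] by auto
  moreover have "l = l'" if "0 < l" "l \<le> 1 - \<rho>" "gap_min \<delta> \<rho> l = 0" "0 < l'" "l' \<le> 1 - \<rho>" "gap_min \<delta> \<rho> l' = 0" for l l'
    using gap_min_strict_increasing[OF \<delta>(1) \<rho>(2), of l l'] gap_min_strict_increasing[OF \<delta>(1) \<rho>(2), of l' l] that
    by (cases l l' rule: linorder_cases) auto
  ultimately show ?thesis using a(2) by (metis less_le_trans)
qed

lemma lambda_min_props:
  assumes "0 < \<delta>" "\<delta> \<le> 1" "0 \<le> \<rho>" "\<rho> < 1"
  shows "0 < lambda_min \<delta> \<rho>" "lambda_min \<delta> \<rho> \<le> 1 - \<rho>" "gap_min \<delta> \<rho> (lambda_min \<delta> \<rho>) = 0"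
proof -
  have eq: "lambda_min \<delta> \<rho> = (THE l. 0 < l \<and> l \<le> 1 - \<rho> \<and> gap_min \<delta> \<rho> l = 0)"
    using assms by (simp add: lambda_min_def gap_min_def)
  show "0 < lambda_min \<delta> \<rho>" "lambda_min \<delta> \<rho> \<le> 1 - \<rho>" "gap_min \<delta> \<rho> (lambda_min \<delta> \<rho>) = 0"
    unfolding eq using theI'[OF lambda_min_ex1[OF assms]] by auto
qed

section \<open>Comparison of the limiting moment exponents with the exponents of the theorem\<close>

lemma exponent_le_psi_max:
  fixes l \<nu> :: real
  assumes "l > 1" "0 \<le> \<nu>" "\<nu> \<le> 1"
  shows "(xlnx l + xlnx (\<nu> + (l - 1)) - xlnx \<nu> - xlnx (l - 1)) / 2 - (l - 1) / 2 - (l - 1) / 2 * ln l \<le> psi_max l \<nu>"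
proof -
  define a where "a = l - 1"
  have a: "a > 0" using assms by (simp add: a_def)
  \<comment> \<open>The tangent bound for \<open>ln\<close> at one. It is one of two places where
    something is lost; the other is replacing \<open>a + \<nu>\<close> by \<open>l\<close>, which
    uses \<nu> \<le> 1.\<close>
  have "a * ln ((a + \<nu>) / a) \<le> a * ((a + \<nu>) / a - 1)"
    using a assms by (intro mult_left_mono ln_le_minus_one) auto
  then have "a * (ln (a + \<nu>) - ln a) \<le> \<nu>"
    using a assms by (simp add: ln_div field_simps)
  moreover have "\<nu> * ln (a + \<nu>) \<le> \<nu> * ln l"
    using a assms by (intro mult_left_mono) (auto simp: a_def)
  ultimately have "xlnx (\<nu> + a) - xlnx a \<le> \<nu> * ln l + \<nu>"
    by (simp add: xlnx_def algebra_simps)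
  moreover have "(l - 1) / 2 * ln l = (xlnx l - ln l) / 2"
    by (simp add: xlnx_def left_diff_distrib)
  moreover have "psi_max l \<nu> = (ln l + \<nu> * ln l + 1 + \<nu> - xlnx \<nu> - l) / 2"
    by (simp add: psi_max_def xlnx_def distrib_right)
  ultimately show ?thesis
    unfolding a_def by argo
qed

text \<open>The claim reduces to
  \<open>xlnx (1 - l) + xlnx (1 - \<rho>) \<le> xlnx (1 - \<rho> - l)\<close>. This is convexity:
  \<open>1 - l\<close> and \<open>1 - \<rho>\<close> lie between \<open>1 - \<rho> - l\<close> and
  \<open>1\<close>, have the same sum as these, and \<open>xlnx 1 = 0\<close>.\<close>

lemma exponent_le_psi_min:
  fixes l \<rho> :: real
  assumes "0 < l" "l < 1 - \<rho>" "0 \<le> \<rho>"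
  shows "(xlnx (1 - l) - xlnx \<rho> + xlnx l - xlnx (1 - \<rho>) - xlnx (1 - \<rho> - l)) / 2
    + (1 - \<rho> - l) / 2 + (1 - \<rho> - l) / 2 * ln l \<le> psi_min l \<rho>"
proof -
  define x where "x = 1 - \<rho> - l"
  have x: "x > 0" "x + \<rho> > 0" "x + l > 0" using assms by (auto simp: x_def)
  have "x * ln ((x + \<rho>) * (x + l) / x) + \<rho> * ln (x + \<rho>) + l * ln (x + l)
      \<le> x * ((x + \<rho>) * (x + l) / x - 1) + \<rho> * (x + \<rho> - 1) + l * (x + l - 1)"
    using x assms by (intro add_mono mult_left_mono ln_le_minus_one) auto
  \<comment> \<open>The weights \<open>x\<close>, \<rho> and \<open>l\<close> sum to one, so the
    tangent bounds add up to \<open>- \<rho> * l\<close>.\<close>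
  also have "\<dots> = (x + \<rho> + l)\<^sup>2 - (x + \<rho> + l) - \<rho> * l"
    using x by (simp add: power2_eq_square field_simps)
  also have "\<dots> \<le> 0" using assms by (simp add: x_def)
  finally have "x * ln ((x + \<rho>) * (x + l) / x) + \<rho> * ln (x + \<rho>) + l * ln (x + l) \<le> 0" .
  moreover have "ln ((x + \<rho>) * (x + l) / x) = ln (x + \<rho>) + ln (x + l) - ln x"
    using x by (simp only: ln_div ln_mult mult_pos_pos less_imp_neq[symmetric] simp_thms if_True)
  ultimately have "x * (ln (x + \<rho>) + ln (x + l) - ln x) + \<rho> * ln (x + \<rho>) + l * ln (x + l) \<le> 0"
    by (simp only:)
  then have "xlnx (x + \<rho>) + xlnx (x + l) - xlnx x \<le> 0"
    by (simp add: xlnx_def algebra_simps)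
  moreover have "x + \<rho> = 1 - l" "x + l = 1 - \<rho>" by (auto simp: x_def)
  ultimately have "xlnx (1 - l) + xlnx (1 - \<rho>) - xlnx (1 - \<rho> - l) \<le> 0" by (simp add: x_def)
  moreover have "psi_min l \<rho> = - xlnx \<rho> / 2 - xlnx (1 - \<rho>) + ((1 - \<rho>) * ln l + 1 - \<rho> - l) / 2"
    using assms by (simp add: psi_min_def shannon_entropy_eq_xlnx xlnx_def field_simps)
  moreover have "(1 - \<rho> - l) / 2 * ln l + xlnx l / 2 = (1 - \<rho>) * ln l / 2"
    by (simp add: xlnx_def field_simps)
  ultimately show ?thesis by argo
qed

section \<open>Union bound over supports\<close>

text \<open>The columns in \<open>K\<close>, rescaled to unit variance, are distributed as the fixed
  Gaussian product measure. This carries the tail events over to an arbitrary probability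
  space.\<close>

lemma gaussian_ensemble_distr:
  assumes GE: "gaussian_ensemble M n N A" and n: "n > 0" and K: "K \<subseteq> {..<N}" "K \<noteq> {}"
  defines "\<Phi> \<equiv> \<lambda>\<omega>. \<lambda>ij\<in>{..<n} \<times> K. sqrt (real n) * A \<omega> $$ ij"
  shows "\<Phi> \<in> measurable M (gauss_PiM ({..<n} \<times> K))"
    and "distr M (gauss_PiM ({..<n} \<times> K)) \<Phi> = gauss_PiM ({..<n} \<times> K)"
proof -
  let ?I = "{..<n} \<times> K"
  interpret prob_space M using GE by (simp add: gaussian_ensemble_def)
  have I: "?I \<noteq> {}" "?I \<subseteq> {..<n} \<times> {..<N}" using n K by auto
  have ind: "indep_vars (\<lambda>_. borel) (\<lambda>ij \<omega>. sqrt (real n) * A \<omega> $$ ij) ?I"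
  proof (rule indep_vars_compose2[where Y = "\<lambda>_ y. sqrt (real n) * y"])
    show "indep_vars (\<lambda>_. borel) (\<lambda>ij \<omega>. A \<omega> $$ ij) ?I"
      using GE by (intro indep_vars_subset[OF _ I(2)]) (simp add: gaussian_ensemble_def)
  qed simp
  have dist: "distributed M lborel (\<lambda>\<omega>. sqrt (real n) * A \<omega> $$ ij) std_normal_density" if "ij \<in> ?I" for ij
  proof -
    obtain i j where ij: "ij = (i, j)" "i < n" "j < N" using \<open>ij \<in> ?I\<close> K by auto
    then have "distributed M lborel (\<lambda>\<omega>. A \<omega> $$ ij) (normal_density 0 (sqrt (1 / real n)))"
      using GE by (simp add: gaussian_ensemble_def)
    then have "distributed M lborel (\<lambda>\<omega>. (A \<omega> $$ ij - 0) / sqrt (1 / real n)) std_normal_density"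
      using n by (subst (asm) normal_standard_normal_convert) auto
    then show ?thesis using n by (simp add: real_sqrt_divide mult.commute)
  qed
  then have rv: "random_variable borel (\<lambda>\<omega>. sqrt (real n) * A \<omega> $$ ij)" if "ij \<in> ?I" for ij
    using that distributed_measurable by fastforce
  have d: "distr M borel (\<lambda>\<omega>. sqrt (real n) * A \<omega> $$ ij) = std_gauss" if "ij \<in> ?I" for ij
    using dist[OF that] by (metis distr_cong distributed_distr_eq_density sets_lborel std_gauss_def)
  show "\<Phi> \<in> measurable M (PiM ?I (\<lambda>_. std_gauss))"
    unfolding \<Phi>_def using rv by (intro measurable_restrict) (auto cong: measurable_cong_sets)
  have "distr M (PiM ?I (\<lambda>_. std_gauss)) \<Phi> = distr M (PiM ?I (\<lambda>_. borel)) \<Phi>"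
    by (intro distr_cong sets_PiM_cong) auto
  also have "\<dots> = PiM ?I (\<lambda>ij. distr M borel (\<lambda>\<omega>. sqrt (real n) * A \<omega> $$ ij))"
    unfolding \<Phi>_def using ind by (subst (asm) indep_vars_iff_distr_eq_PiM'[OF I(1) rv]) auto
  also have "\<dots> = PiM ?I (\<lambda>_. std_gauss)"
    by (intro PiM_cong refl d)
  finally show "distr M (PiM ?I (\<lambda>_. std_gauss)) \<Phi> = PiM ?I (\<lambda>_. std_gauss)" .
qed

text \<open>Every bad outcome lies in the preimage of \<open>E K\<close> for some \<open>K\<close>.
  Each preimage has the Gaussian measure of \<open>E K\<close>, and there are
  \<open>N choose k\<close> of them.\<close>

lemma gaussian_ensemble_union_bound:
  assumes GE: "gaussian_ensemble M n N A" and n: "n > 0" and k: "1 \<le> k" "k \<le> N" and c: "c \<ge> 0"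
    and E: "\<And>K. K \<subseteq> {..<N} \<Longrightarrow> card K = k \<Longrightarrow> E K \<in> sets (gauss_PiM ({..<n} \<times> K))"
    and E_le: "\<And>K. K \<subseteq> {..<N} \<Longrightarrow> card K = k \<Longrightarrow> emeasure (gauss_PiM ({..<n} \<times> K)) (E K) \<le> ennreal c"
    and F: "\<And>\<omega>. \<omega> \<in> F \<Longrightarrow> \<omega> \<in> space M \<and> (\<exists>K\<subseteq>{..<N}. card K = k \<and> (\<lambda>ij\<in>{..<n} \<times> K. sqrt (real n) * A \<omega> $$ ij) \<in> E K)"
  shows "measure M F \<le> real (N choose k) * c"
proof -
  interpret prob_space M using GE by (simp add: gaussian_ensemble_def)
  define \<Phi> where "\<Phi> K \<omega> = (\<lambda>ij\<in>{..<n} \<times> K. sqrt (real n) * A \<omega> $$ ij)" for K \<omega>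
  define S where "S = {K. K \<subseteq> {..<N} \<and> card K = k}"
  have S: "finite S" "card S = N choose k"
    using n_subsets[of "{..<N}" k] by (auto simp: S_def)
  have ne: "K \<noteq> {}" if "K \<in> S" for K using that k by (auto simp: S_def)
  have meas: "\<Phi> K \<in> measurable M (gauss_PiM ({..<n} \<times> K))" if "K \<in> S" for K
    using gaussian_ensemble_distr(1)[OF GE n _ ne[OF that]] that by (auto simp: \<Phi>_def[abs_def] S_def)
  have ev: "\<Phi> K -` E K \<inter> space M \<in> sets M" if "K \<in> S" for K
    using measurable_sets[OF meas[OF that] E] that by (auto simp: S_def)
  have le: "emeasure M (\<Phi> K -` E K \<inter> space M) \<le> ennreal c" if "K \<in> S" for K
  proof -
    have K: "K \<subseteq> {..<N}" "card K = k" using that by (auto simp: S_def)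
    have "emeasure M (\<Phi> K -` E K \<inter> space M) = emeasure (distr M (gauss_PiM ({..<n} \<times> K)) (\<Phi> K)) (E K)"
      by (rule emeasure_distr[OF meas[OF that] E[OF K], symmetric])
    also have "distr M (gauss_PiM ({..<n} \<times> K)) (\<Phi> K) = gauss_PiM ({..<n} \<times> K)"
      using gaussian_ensemble_distr(2)[OF GE n K(1) ne[OF that]] by (simp add: \<Phi>_def[abs_def])
    finally show ?thesis using E_le[OF K] by simp
  qed
  have "emeasure M F \<le> emeasure M (\<Union>K\<in>S. \<Phi> K -` E K \<inter> space M)"
  proof (rule emeasure_mono)
    show "F \<subseteq> (\<Union>K\<in>S. \<Phi> K -` E K \<inter> space M)"
    proof
      fix \<omega> assume "\<omega> \<in> F"
      from F[OF this] obtain K where "\<omega> \<in> space M" "K \<in> S" "\<Phi> K \<omega> \<in> E K"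
        unfolding S_def \<Phi>_def by blast
      then show "\<omega> \<in> (\<Union>K\<in>S. \<Phi> K -` E K \<inter> space M)" by blast
    qed
    show "(\<Union>K\<in>S. \<Phi> K -` E K \<inter> space M) \<in> sets M"
      using S(1) ev by (intro sets.finite_UN)
  qed
  also have "\<dots> \<le> (\<Sum>K\<in>S. emeasure M (\<Phi> K -` E K \<inter> space M))"
    using S ev by (intro emeasure_subadditive_finite) auto
  also have "\<dots> \<le> (\<Sum>K\<in>S. ennreal c)" by (intro sum_mono le)
  also have "\<dots> = ennreal (real (N choose k) * c)"
    using c S by (simp add: ennreal_mult ennreal_of_nat_eq_real_of_nat)
  finally show ?thesis using c by (simp add: emeasure_eq_measure)
qed

text \<open>Logarithm of the upper tail bound for an \<open>n\<close> by \<open>k\<close> matrix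
  with moment order \<open>p\<close> and \<open>T = n * l\<close>.\<close>

definition upper_exponent :: "nat \<Rightarrow> nat \<Rightarrow> nat \<Rightarrow> real \<Rightarrow> real" where
  "upper_exponent n k p l = (xlnx (real n + 2 * real p) - xlnx (real n)) / 2 - real p
     + ((xlnx (real k + 2 * real p) - xlnx (real k)) / 2 - real p)
     - real p * ln (real n * l) - (xlnx (2 * real p) / 2 - real p) + ln (2 * real p + 1)"

text \<open>Logarithm of the lower tail bound for an \<open>n\<close> by \<open>k\<close> matrix
  with moment order \<open>Suc q\<close> and \<open>T + e = n * l\<close>.\<close>

definition lower_exponent :: "nat \<Rightarrow> nat \<Rightarrow> nat \<Rightarrow> real \<Rightarrow> real" where
  "lower_exponent n k q l = (xlnx (real k + 2 * real (Suc q)) - xlnx (real k)) / 2 - real (Suc q)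
     + (ln (1 / 2) + ((xlnx (real n - real k - 2 * real q - 4) - xlnx (real n - real k - 4)) / 2 + real q))
     + real (Suc q) * ln (real n * l) - (xlnx (2 * real (Suc q)) / 2 - real (Suc q)) + ln (2 * real (Suc q) + 1)"

text \<open>If the constant is not below \<open>c'\<close>, the smaller level \<open>c\<close> is
  inadmissible, and a violating vector is supported on some \<open>K\<close> of size
  \<open>k'\<close>. The factor \<open>sqrt n\<close> turns the violation into one for a standard
  Gaussian matrix. The sign \<open>s\<close> treats expansion and contraction together.\<close>

lemma gaussian_ensemble_sparse_tail:
  assumes GE: "gaussian_ensemble M n N A" and n: "n > 0" and k': "1 \<le> k'" "k' \<le> N" "min k N \<le> k'"
    and b: "b \<ge> 0" and s: "\<bar>s\<bar> = 1" and c: "0 \<le> c" "c < c'"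
    and tail: "\<And>K. K \<subseteq> {..<N} \<Longrightarrow> card K = k' \<Longrightarrow> \<exists>E\<in>sets (gauss_PiM ({..<n} \<times> K)).
      emeasure (gauss_PiM ({..<n} \<times> K)) E \<le> ennreal b \<and>
      (\<forall>B\<in>space (gauss_PiM ({..<n} \<times> K)). \<forall>v. sqsum K v > 0 \<longrightarrow>
        s * matsq {..<n} K B v + (c - s) * (real n * sqsum K v) \<le> 0 \<longrightarrow> B \<in> E)"
  shows "measure M {\<omega> \<in> space M. \<not> rip_const s k (A \<omega>) < c'} \<le> real (N choose k') * b"
proof -
  let ?G = "\<lambda>K. gauss_PiM ({..<n} \<times> K)"
  define good where "good K E \<longleftrightarrow> E \<in> sets (?G K) \<and> emeasure (?G K) E \<le> ennreal b \<and>
     (\<forall>B\<in>space (?G K). \<forall>v. sqsum K v > 0 \<longrightarrow>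
        s * matsq {..<n} K B v + (c - s) * (real n * sqsum K v) \<le> 0 \<longrightarrow> B \<in> E)" for K :: "nat set" and E
  \<comment> \<open>One tail event is fixed for each \<open>K\<close>, since the union bound needs a
    family of sets.\<close>
  define E where "E K = (SOME E. good K E)" for K
  have E: "good K (E K)" if "K \<subseteq> {..<N}" "card K = k'" for K
    unfolding E_def by (rule someI_ex) (use tail[OF that] in \<open>unfold good_def, blast\<close>)
  show ?thesis
  proof (rule gaussian_ensemble_union_bound[OF GE n k'(1,2) b, of E])
    fix \<omega> assume "\<omega> \<in> {\<omega> \<in> space M. \<not> rip_const s k (A \<omega>) < c'}"
    then have \<omega>: "\<omega> \<in> space M" "\<not> rip_const s k (A \<omega>) < c'" by auto
    have A: "A \<omega> \<in> carrier_mat n N" using GE \<omega> by (simp add: gaussian_ensemble_def)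
    have "\<not> rip_ok s k (A \<omega>) c"
      using rip_const_least(2)[OF s, of k "A \<omega>" c] \<omega> c by auto
    then obtain x where x: "x \<in> sparse_vecs N k" "s * (l2_norm (A \<omega> *\<^sub>v x))\<^sup>2 + (c - s) * (l2_norm x)\<^sup>2 < 0"
      using A c by (auto simp: rip_ok_def not_le)
    have xc: "x \<in> carrier_vec N" using x by (simp add: sparse_vecs_def)
    \<comment> \<open>A zero vector would give zero on both sides, contradicting the strict
      violation.\<close>
    have pos: "0 < (l2_norm x)\<^sup>2"
    proof (rule ccontr)
      assume "\<not> 0 < (l2_norm x)\<^sup>2"
      then have 0: "(l2_norm x)\<^sup>2 = 0" by simp
      then have "(\<Sum>j<N. (x $ j)\<^sup>2) = 0"
        by (simp only: l2_norm_sq carrier_vecD[OF xc])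
      then have "x $ j = 0" if "j < N" for j
        using that by (simp add: sum_nonneg_eq_0_iff)
      then have "(l2_norm (A \<omega> *\<^sub>v x))\<^sup>2 = 0" by (simp add: l2_norm_mult_mat_vec_sq[OF A xc])
      with x(2) 0 show False by simp
    qed
    obtain K where K: "K \<subseteq> {..<N}" "card K = k'" "\<And>j. j < N \<Longrightarrow> j \<notin> K \<Longrightarrow> x $ j = 0"
      using sparse_vec_support[OF x(1) k'(3,2)] by metis
    note sums = sparse_vec_sums[OF A xc K(1,3)]
    define \<Phi> where "\<Phi> = (\<lambda>ij\<in>{..<n} \<times> K. sqrt (real n) * A \<omega> $$ ij)"
    have "(\<Sum>i<n. (\<Sum>j\<in>K. \<Phi> (i, j) * x $ j)\<^sup>2) = (\<Sum>i<n. (sqrt (real n) * (\<Sum>j\<in>K. A \<omega> $$ (i, j) * x $ j))\<^sup>2)"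
      unfolding \<Phi>_def by (intro sum.cong refl arg_cong[where f = "\<lambda>x. x\<^sup>2"]) (simp add: sum_distrib_left mult_ac)
    also have "\<dots> = real n * (\<Sum>i<n. (\<Sum>j\<in>K. A \<omega> $$ (i, j) * x $ j)\<^sup>2)"
      by (simp only: power_mult_distrib sum_distrib_left[symmetric] real_sqrt_pow2 of_nat_0_le_iff)
    also have "\<dots> = real n * (l2_norm (A \<omega> *\<^sub>v x))\<^sup>2"
      by (simp add: sums(2))
    finally have "(\<Sum>i<n. (\<Sum>j\<in>K. \<Phi> (i, j) * x $ j)\<^sup>2) = real n * (l2_norm (A \<omega> *\<^sub>v x))\<^sup>2" .
    moreover have "(\<Sum>j\<in>K. (x $ j)\<^sup>2) = (l2_norm x)\<^sup>2" by (simp add: sums(1))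
    moreover have "\<Phi> \<in> space (?G K)" by (simp add: \<Phi>_def space_PiM)
    moreover have "s * (real n * (l2_norm (A \<omega> *\<^sub>v x))\<^sup>2) + (c - s) * (real n * (l2_norm x)\<^sup>2) \<le> 0"
    proof -
      have "real n * (s * (l2_norm (A \<omega> *\<^sub>v x))\<^sup>2 + (c - s) * (l2_norm x)\<^sup>2) \<le> 0"
        using x(2) by (intro mult_nonneg_nonpos) auto
      then show ?thesis by (simp add: algebra_simps)
    qed
    ultimately have "\<Phi> \<in> E K"
      using E[OF K(1,2), unfolded good_def, THEN conjunct2, THEN conjunct2, rule_format, of \<Phi> "\<lambda>j. x $ j"] pos
      by simp
    then show "\<omega> \<in> space M \<and> (\<exists>K\<subseteq>{..<N}. card K = k' \<and> (\<lambda>ij\<in>{..<n} \<times> K. sqrt (real n) * A \<omega> $$ ij) \<in> E K)"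
      using \<omega> K unfolding \<Phi>_def by blast
  qed (use E in \<open>auto simp: good_def\<close>)
qed

lemma rip_U_tail:
  assumes GE: "gaussian_ensemble M n N A" and n: "n > 0" and k': "1 \<le> k'" "k' \<le> N" "min k N \<le> k'"
    and p: "p > 0" and c: "0 \<le> c" "c < c'"
  shows "measure M {\<omega> \<in> space M. \<not> rip_U k (A \<omega>) < c'} \<le> real (N choose k') * exp (upper_exponent n k' p (1 + c))"
proof -
  define T where "T = real n * (1 + c)"
  have T: "T > 0" using n c by (simp add: T_def)
  let ?b = "chi_moment n p
          * chi_moment k' p
          / (T ^ p * (normal_moment p))"
  have b: "?b = exp (upper_exponent n k' p (1 + c))"
  proof -
    define a1 where "a1 = (xlnx (real n + 2 * real p) - xlnx (real n)) / 2 - real p"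
    define a2 where "a2 = (xlnx (real k' + 2 * real p) - xlnx (real k')) / 2 - real p"
    define a3 where "a3 = xlnx (2 * real p) / 2 - real p"
    have "exp (real p * ln T) = T ^ p"
      using T by (simp add: exp_of_nat_mult)
    moreover have "upper_exponent n k' p (1 + c) = a1 + a2 - real p * ln T - a3 + ln (2 * real p + 1)"
      by (simp add: upper_exponent_def a1_def a2_def a3_def T_def)
    ultimately have "exp (upper_exponent n k' p (1 + c)) = exp a1 * exp a2 / T ^ p / exp a3 * (2 * real p + 1)"
      by (simp only: exp_add exp_diff) simp
    also have "\<dots> = exp a1 * exp a2 / (T ^ p * (exp a3 / (2 * real p + 1)))"
      by simp
    finally show ?thesis by (simp only: a1_def a2_def a3_def)
  qed
  show ?thesis
    unfolding rip_U_eq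
  proof (rule gaussian_ensemble_sparse_tail[OF GE n k' _ _ c])
    fix K assume K: "K \<subseteq> {..<N}" "card K = k'"
    then have "finite K" "K \<noteq> {}" using k' by (auto intro: finite_subset)
    have quad: "-1 * b + (c - -1) * (real n * a) \<le> 0 \<longleftrightarrow> T * a \<le> b" for a b
      by (simp add: T_def algebra_simps)
    show "\<exists>E\<in>sets (gauss_PiM ({..<n} \<times> K)). emeasure (gauss_PiM ({..<n} \<times> K)) E \<le> ennreal (exp (upper_exponent n k' p (1 + c))) \<and>
      (\<forall>B\<in>space (gauss_PiM ({..<n} \<times> K)). \<forall>v. sqsum K v > 0 \<longrightarrow>
        -1 * matsq {..<n} K B v + (c - -1) * (real n * sqsum K v) \<le> 0 \<longrightarrow> B \<in> E)"
      using gauss_matrix_upper_tail[of "{..<n}" K p T] \<open>finite K\<close> \<open>K \<noteq> {}\<close> n p T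
      unfolding card_lessThan K(2) b quad by (auto simp: lessThan_empty_iff)
  qed simp_all
qed

text \<open>The lower tail needs a positive regularisation. It is fed by the room between
  \<open>1 - c\<close> and \<open>l\<close>, so the final bound depends on \<open>l\<close>
  only.\<close>

lemma rip_L_tail:
  assumes GE: "gaussian_ensemble M n N A" and n: "n > 0" and k': "1 \<le> k'" "k' \<le> N" "min k N \<le> k'"
    and q: "k' + 2 * q + 4 \<le> n" and c: "0 \<le> c" "c < c'" and l: "0 < 1 - c" "1 - c < l"
  shows "measure M {\<omega> \<in> space M. \<not> rip_L k (A \<omega>) < c'} \<le> real (N choose k') * exp (lower_exponent n k' q l)"
proof -
  define T where "T = real n * (1 - c)"
  \<comment> \<open>This value makes \<open>T + e\<close> equal to \<open>n * l\<close>.\<close>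
  define e where "e = real n * (l - (1 - c))"
  have "real n * (l - (1 - c)) > 0" using n l by (intro mult_pos_pos) auto
  then have T: "T > 0" "e > 0" "T + e = real n * l"
    using n l unfolding e_def T_def by (auto simp flip: distrib_left)
  let ?b = "chi_moment k' (Suc q)
          * (1 / 2 * exp ((xlnx (real n - real k' - 2 * real q - 4) - xlnx (real n - real k' - 4)) / 2 + real q))
          * (T + e) ^ Suc q / (normal_moment (Suc q))"
  have b: "?b = exp (lower_exponent n k' q l)"
  proof -
    define a1 where "a1 = (xlnx (real k' + 2 * real (Suc q)) - xlnx (real k')) / 2 - real (Suc q)"
    define a2 where "a2 = (xlnx (real n - real k' - 2 * real q - 4) - xlnx (real n - real k' - 4)) / 2 + real q"
    define a3 where "a3 = xlnx (2 * real (Suc q)) / 2 - real (Suc q)"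
    define a4 where "a4 = 2 * real (Suc q) + 1"
    have "exp (real (Suc q) * ln (T + e)) = (T + e) ^ Suc q"
      using T by (subst exp_of_nat_mult) auto
    moreover have "lower_exponent n k' q l = a1 + (ln (1 / 2) + a2) + real (Suc q) * ln (T + e) - a3 + ln a4"
      by (simp only: lower_exponent_def a1_def a2_def a3_def a4_def T(3))
    moreover have "a4 > 0" by (simp add: a4_def)
    ultimately have "exp (lower_exponent n k' q l) = exp a1 * (1 / 2 * exp a2) * (T + e) ^ Suc q / exp a3 * a4"
      by (simp only: exp_add exp_diff exp_ln zero_less_divide_1_iff zero_less_numeral)
    also have "\<dots> = exp a1 * (1 / 2 * exp a2) * (T + e) ^ Suc q / (exp a3 / a4)"
      by (simp only: divide_divide_eq_right times_divide_eq_left)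
    finally show ?thesis by (simp only: a1_def a2_def a3_def a4_def)
  qed
  show ?thesis
    unfolding rip_L_eq
  proof (rule gaussian_ensemble_sparse_tail[OF GE n k' _ _ c])
    fix K assume K: "K \<subseteq> {..<N}" "card K = k'"
    then have "finite K" "K \<noteq> {}" using k' by (auto intro: finite_subset)
    have quad: "1 * b + (c - 1) * (real n * a) \<le> 0 \<longleftrightarrow> b \<le> T * a" for a b
      by (simp add: T_def algebra_simps)
    show "\<exists>E\<in>sets (gauss_PiM ({..<n} \<times> K)). emeasure (gauss_PiM ({..<n} \<times> K)) E \<le> ennreal (exp (lower_exponent n k' q l)) \<and>
      (\<forall>B\<in>space (gauss_PiM ({..<n} \<times> K)). \<forall>v. sqsum K v > 0 \<longrightarrow>
        1 * matsq {..<n} K B v + (c - 1) * (real n * sqsum K v) \<le> 0 \<longrightarrow> B \<in> E)"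
      using gauss_matrix_lower_tail[of "{..<n}" K T e q] \<open>finite K\<close> \<open>K \<noteq> {}\<close> T q
      unfolding card_lessThan K(2) b quad by (auto simp: lessThan_empty_iff)
  qed simp_all
qed

section \<open>Proportional growth\<close>

text \<open>An eventual bound becomes a bound for all \<open>m\<close>: the constant
  \<open>C\<close> absorbs the finitely many early indices, where the distance to one is at most
  one.\<close>

lemma converges_exponentially_one:
  assumes p: "\<And>m. 0 \<le> p m" "\<And>m. p m \<le> 1" and \<beta>: "\<beta> > 0"
    and ev: "\<forall>\<^sub>F m in sequentially. 1 - p m \<le> exp (- (real (n m) * \<beta>))"
  shows "converges_exponentially n p 1"
proof -
  obtain m0 where m0: "\<And>m. m \<ge> m0 \<Longrightarrow> 1 - p m \<le> exp (- (real (n m) * \<beta>))"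
    using ev unfolding eventually_sequentially by blast
  define C where "C = 1 + (\<Sum>m<m0. exp (real (n m) * \<beta>))"
  have "\<bar>p m - 1\<bar> \<le> C * exp (- (real (n m) * \<beta>))" for m
  proof (cases "m \<ge> m0")
    case True
    have "\<bar>p m - 1\<bar> \<le> 1 * exp (- (real (n m) * \<beta>))" using m0[OF True] p[of m] by simp
    also have "\<dots> \<le> C * exp (- (real (n m) * \<beta>))"
      by (intro mult_right_mono) (auto simp: C_def intro: sum_nonneg)
    finally show ?thesis .
  next
    case False
    have "exp (real (n m) * \<beta>) \<le> (\<Sum>m<m0. exp (real (n m) * \<beta>))"
      using False by (intro member_le_sum[of m "{..<m0}" "\<lambda>m. exp (real (n m) * \<beta>)"]) auto
    then have "exp (real (n m) * \<beta>) \<le> C" by (simp add: C_def)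
    then have "exp (real (n m) * \<beta>) * exp (- (real (n m) * \<beta>)) \<le> C * exp (- (real (n m) * \<beta>))"
      by (intro mult_right_mono) auto
    then have "1 \<le> C * exp (- (real (n m) * \<beta>))" by (simp add: exp_minus)
    then show ?thesis using p[of m] by simp
  qed
  then show ?thesis unfolding converges_exponentially_def using \<beta> by blast
qed

lemma eventually_pos_seq:
  fixes n :: "nat \<Rightarrow> nat"
  assumes "filterlim n at_top sequentially"
  shows "\<forall>\<^sub>F m in sequentially. n m > 0"
proof -
  have "\<forall>\<^sub>F m in sequentially. 1 \<le> n m" using assms unfolding filterlim_at_top by blast
  then show ?thesis by eventually_elim simp
qed

section \<open>Limits of the normalised exponents\<close>

lemma tendsto_nat_floor_div:
  assumes n: "filterlim n at_top sequentially" and c: "c \<ge> 0"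
  shows "(\<lambda>m. real (nat \<lfloor>c * real (n m)\<rfloor>) / real (n m)) \<longlonglongrightarrow> c"
proof (rule tendsto_sandwich)
  have inv: "(\<lambda>m. 1 / real (n m)) \<longlonglongrightarrow> 0"
    using filterlim_compose[OF lim_1_over_n n] by simp
  show "(\<lambda>m. c - 1 / real (n m)) \<longlonglongrightarrow> c"
    using tendsto_diff[OF tendsto_const inv, of c] by simp
  have n_pos: "\<forall>\<^sub>F m in sequentially. n m > 0"
    by (rule eventually_pos_seq[OF n])
  show "\<forall>\<^sub>F m in sequentially. c - 1 / real (n m) \<le> real (nat \<lfloor>c * real (n m)\<rfloor>) / real (n m)"
    using n_pos
  proof eventually_elim
    case (elim m)
    have "c * real (n m) - 1 \<le> real (nat \<lfloor>c * real (n m)\<rfloor>)" by linarith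
    then have "(c * real (n m) - 1) / real (n m) \<le> real (nat \<lfloor>c * real (n m)\<rfloor>) / real (n m)"
      by (intro divide_right_mono) auto
    then show ?case using elim by (simp add: diff_divide_distrib)
  qed
  show "\<forall>\<^sub>F m in sequentially. real (nat \<lfloor>c * real (n m)\<rfloor>) / real (n m) \<le> c"
    using n_pos
  proof eventually_elim
    case (elim m)
    have "real (nat \<lfloor>c * real (n m)\<rfloor>) \<le> c * real (n m)" using c by simp
    then have "real (nat \<lfloor>c * real (n m)\<rfloor>) / real (n m) \<le> c * real (n m) / real (n m)"
      by (intro divide_right_mono) auto
    then show ?case using elim by simp
  qed
qed simp

text \<open>The multiples of \<open>ln n\<close> produced by the \<open>xlnx\<close> terms add up to
  \<open>p * ln n\<close> and cancel against the one in \<open>p * ln (n * l)\<close>, leaving only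
  ratios and a vanishing term.\<close>

lemma upper_exponent_scaled:
  assumes "n > 0" "p > 0" "l > 0"
  shows "upper_exponent n k p l / real n
    = (xlnx (1 + 2 * (real p / real n)) + xlnx (real k / real n + 2 * (real p / real n)) - xlnx (real k / real n)
        - xlnx (2 * (real p / real n))) / 2 - real p / real n - real p / real n * ln l
      + ln (2 * real p + 1) / real n"
proof -
  define N P K where "N = real n" and "P = real p" and "K = real k"
  have pos: "N > 0" "P > 0" "K \<ge> 0" using assms by (auto simp: N_def P_def K_def)
  have "xlnx (N + 2 * P) = N * xlnx ((N + 2 * P) / N) + (N + 2 * P) * ln N"
    "xlnx (K + 2 * P) = N * xlnx ((K + 2 * P) / N) + (K + 2 * P) * ln N"
    "xlnx K = N * xlnx (K / N) + K * ln N" "xlnx (2 * P) = N * xlnx (2 * P / N) + 2 * P * ln N"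
    using pos by (intro xlnx_scaled; simp)+
  moreover have "xlnx N = N * ln N" by (simp add: xlnx_def)
  moreover have "ln (N * l) = ln N + ln l" using pos assms by (simp add: ln_mult)
  ultimately have "upper_exponent n k p l = N * ((xlnx ((N + 2 * P) / N) + xlnx ((K + 2 * P) / N) - xlnx (K / N)
        - xlnx (2 * P / N)) / 2) - P - P * ln l + ln (2 * P + 1)"
    unfolding upper_exponent_def N_def[symmetric] P_def[symmetric] K_def[symmetric]
    by (simp add: field_simps)
  moreover have "(N + 2 * P) / N = 1 + 2 * (P / N)" "(K + 2 * P) / N = K / N + 2 * (P / N)" "2 * P / N = 2 * (P / N)"
    using pos by (simp_all add: add_divide_distrib)
  moreover have "(N * X - P - P * c + E) / N = X - P / N - P / N * c + E / N" for X c E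
    using pos by (simp add: add_divide_distrib diff_divide_distrib)
  ultimately show ?thesis
    unfolding N_def[symmetric] P_def[symmetric] K_def[symmetric] by (simp only:)
qed

text \<open>As above, except that the numbers \<open>2 * p + 2\<close> and \<open>4\<close>
  subtracted from \<open>n - k\<close> leave one uncancelled \<open>ln n\<close>; it still vanishes
  after division by \<open>n\<close>.\<close>

lemma lower_exponent_scaled:
  assumes n: "k + 2 * q + 4 \<le> n" and l: "l > 0"
  defines "p \<equiv> Suc q"
  shows "lower_exponent n k q l / real n
    = (xlnx (real k / real n + 2 * (real p / real n)) - xlnx (real k / real n) - xlnx (2 * (real p / real n))
        + xlnx (1 - real k / real n - 2 * (real p / real n) - 2 / real n) - xlnx (1 - real k / real n - 4 / real n)) / 2
      + real p / real n + real p / real n * ln l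
      + (ln (2 * real p + 1) / real n + (ln (1 / 2) - 1) / real n + ln (real n) / real n)"
proof -
  define N P K where "N = real n" and "P = real p" and "K = real k"
  have q: "real q = P - 1" by (simp add: P_def p_def)
  have "real (k + 2 * q + 4) \<le> real n" using n by (simp only: of_nat_le_iff)
  then have pos: "N > 0" "P > 0" "K \<ge> 0" "N - K - 2 * P - 2 \<ge> 0" "N - K - 4 \<ge> 0"
    using n by (auto simp: N_def P_def K_def p_def)
  have "xlnx (N - K - 2 * P - 2) = N * xlnx ((N - K - 2 * P - 2) / N) + (N - K - 2 * P - 2) * ln N"
    "xlnx (N - K - 4) = N * xlnx ((N - K - 4) / N) + (N - K - 4) * ln N"
    "xlnx (K + 2 * P) = N * xlnx ((K + 2 * P) / N) + (K + 2 * P) * ln N"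
    "xlnx K = N * xlnx (K / N) + K * ln N" "xlnx (2 * P) = N * xlnx (2 * P / N) + 2 * P * ln N"
    using pos by (intro xlnx_scaled; simp)+
  moreover have "ln (N * l) = ln N + ln l" using pos l by (simp add: ln_mult)
  moreover have "N - K - 2 * (P - 1) - 4 = N - K - 2 * P - 2" by simp
  ultimately have "lower_exponent n k q l = N * ((xlnx ((K + 2 * P) / N) - xlnx (K / N)
        - xlnx (2 * P / N) + xlnx ((N - K - 2 * P - 2) / N) - xlnx ((N - K - 4) / N)) / 2) + P + P * ln l + (ln (2 * P + 1) + (ln (1 / 2) - 1) + ln N)"
    unfolding lower_exponent_def p_def[symmetric] N_def[symmetric] P_def[symmetric] K_def[symmetric] q
    by (simp add: field_simps)
  moreover have "(N - K - 2 * P - 2) / N = 1 - K / N - 2 * (P / N) - 2 / N" "(N - K - 4) / N = 1 - K / N - 4 / N"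
    "(K + 2 * P) / N = K / N + 2 * (P / N)" "2 * P / N = 2 * (P / N)"
    using pos by (simp_all add: add_divide_distrib diff_divide_distrib)
  moreover have "(N * X + P + P * c + (E1 + E2 + E3)) / N = X + P / N + P / N * c + (E1 / N + E2 / N + E3 / N)" for X c E1 E2 E3
    using pos by (simp add: add_divide_distrib)
  ultimately show ?thesis
    unfolding N_def[symmetric] P_def[symmetric] K_def[symmetric] by (simp only:)
qed

lemma tendsto_inverse_seq:
  assumes "filterlim n at_top sequentially"
  shows "(\<lambda>m. c / real (n m)) \<longlonglongrightarrow> 0"
  using tendsto_mult[OF tendsto_const filterlim_compose[OF lim_1_over_n assms], of c] by simp

lemma tendsto_ln_div_seq:
  assumes "filterlim n at_top sequentially"
  shows "(\<lambda>m. ln (real (n m)) / real (n m)) \<longlonglongrightarrow> 0"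
proof -
  have "((\<lambda>x::real. ln x / x) \<longlongrightarrow> 0) at_top" by real_asymp
  then show ?thesis
    by (rule filterlim_compose[OF _ filterlim_compose[OF filterlim_real_sequentially assms]])
qed

text \<open>\<open>ln n\<close> is split off, so that the remaining logarithm converges and is
  divided by \<open>n\<close>.\<close>

lemma tendsto_ln_linear_div_seq:
  fixes p n :: "nat \<Rightarrow> nat"
  assumes n: "filterlim n at_top sequentially" and p: "(\<lambda>m. real (p m) / real (n m)) \<longlonglongrightarrow> t" and t: "t > 0"
  shows "(\<lambda>m. ln (2 * real (p m) + 1) / real (n m)) \<longlonglongrightarrow> 0"
proof -
  have inner: "(\<lambda>m. 2 * (real (p m) / real (n m)) + 1 / real (n m)) \<longlonglongrightarrow> 2 * t + 0"
    by (intro tendsto_intros p tendsto_inverse_seq n)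
  have "(\<lambda>m. ln (2 * (real (p m) / real (n m)) + 1 / real (n m)) * (1 / real (n m)) + ln (real (n m)) / real (n m))
      \<longlonglongrightarrow> ln (2 * t + 0) * 0 + 0"
    using t by (intro tendsto_add[OF tendsto_mult[OF tendsto_ln[OF inner]]] tendsto_inverse_seq tendsto_ln_div_seq n) auto
  then have lim: "(\<lambda>m. ln (2 * (real (p m) / real (n m)) + 1 / real (n m)) * (1 / real (n m)) + ln (real (n m)) / real (n m)) \<longlonglongrightarrow> 0"
    by simp
  have "\<forall>\<^sub>F m in sequentially. n m > 0"
    by (rule eventually_pos_seq[OF n])
  then have "\<forall>\<^sub>F m in sequentially. ln (2 * (real (p m) / real (n m)) + 1 / real (n m)) * (1 / real (n m)) + ln (real (n m)) / real (n m)
      = ln (2 * real (p m) + 1) / real (n m)"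
  proof eventually_elim
    case (elim m)
    have "2 * (real (p m) / real (n m)) + 1 / real (n m) = (2 * real (p m) + 1) / real (n m)"
      by (simp add: add_divide_distrib)
    then have "ln (2 * (real (p m) / real (n m)) + 1 / real (n m)) = ln (2 * real (p m) + 1) - ln (real (n m))"
      using elim by (simp add: ln_div)
    then show ?case by (simp add: diff_divide_distrib)
  qed
  then show ?thesis using lim by (rule Lim_transform_eventually[rotated])
qed

lemma upper_exponent_tendsto:
  fixes n k p :: "nat \<Rightarrow> nat"
  assumes n: "filterlim n at_top sequentially" and k: "(\<lambda>m. real (k m) / real (n m)) \<longlonglongrightarrow> \<nu>"
    and p: "(\<lambda>m. real (p m) / real (n m)) \<longlonglongrightarrow> (l - 1) / 2" "\<And>m. p m > 0" and l: "l > 1" and \<nu>: "\<nu> \<ge> 0"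
  shows "(\<lambda>m. upper_exponent (n m) (k m) (p m) l / real (n m))
    \<longlonglongrightarrow> (xlnx l + xlnx (\<nu> + (l - 1)) - xlnx \<nu> - xlnx (l - 1)) / 2 - (l - 1) / 2 - (l - 1) / 2 * ln l"
proof -
  have p2: "(\<lambda>m. 2 * (real (p m) / real (n m))) \<longlonglongrightarrow> l - 1"
  proof -
    have "2 * ((l - 1) / 2) = l - 1" by simp
    with tendsto_mult[OF tendsto_const p(1), of 2] show ?thesis by (simp only:)
  qed
  have 1: "(\<lambda>m. xlnx (1 + 2 * (real (p m) / real (n m)))) \<longlonglongrightarrow> xlnx l"
    using tendsto_add[OF tendsto_const p2, of 1] l by (intro tendsto_xlnx) auto
  have 2: "(\<lambda>m. xlnx (real (k m) / real (n m) + 2 * (real (p m) / real (n m)))) \<longlonglongrightarrow> xlnx (\<nu> + (l - 1))"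
    using l \<nu> by (intro tendsto_xlnx tendsto_add k p2) auto
  have 3: "(\<lambda>m. xlnx (real (k m) / real (n m))) \<longlonglongrightarrow> xlnx \<nu>"
    using \<nu> by (intro tendsto_xlnx k) auto
  have 4: "(\<lambda>m. xlnx (2 * (real (p m) / real (n m)))) \<longlonglongrightarrow> xlnx (l - 1)"
    using l by (intro tendsto_xlnx p2) auto
  have 5: "(\<lambda>m. ln (2 * real (p m) + 1) / real (n m)) \<longlonglongrightarrow> 0"
    using l by (intro tendsto_ln_linear_div_seq[OF n p(1)]) auto
  let ?g = "\<lambda>m. (xlnx (1 + 2 * (real (p m) / real (n m))) + xlnx (real (k m) / real (n m) + 2 * (real (p m) / real (n m)))
      - xlnx (real (k m) / real (n m)) - xlnx (2 * (real (p m) / real (n m)))) / 2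
      - real (p m) / real (n m) - real (p m) / real (n m) * ln l + ln (2 * real (p m) + 1) / real (n m)"
  have lim: "?g
    \<longlonglongrightarrow> (xlnx l + xlnx (\<nu> + (l - 1)) - xlnx \<nu> - xlnx (l - 1)) / 2 - (l - 1) / 2 - (l - 1) / 2 * ln l + 0"
    by (intro tendsto_add tendsto_diff tendsto_divide tendsto_mult tendsto_const 1 2 3 4 5 p(1)) simp
  have "\<forall>\<^sub>F m in sequentially. n m > 0"
    by (rule eventually_pos_seq[OF n])
  then have "\<forall>\<^sub>F m in sequentially. ?g m
      = upper_exponent (n m) (k m) (p m) l / real (n m)"
  proof eventually_elim
    case (elim m)
    show ?case using l by (intro upper_exponent_scaled[OF elim p(2), symmetric]) simp
  qed
  then show ?thesis using Lim_transform_eventually[OF lim] by (simp only: add_0_right)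
qed

text \<open>The size condition of the lower tail holds eventually because
  \<open>(k + 2 * q + 4) / n\<close> tends to \<open>1 - l\<close>, which is less than one. It also
  keeps the arguments of \<open>xlnx\<close> nonnegative.\<close>

lemma lower_exponent_tendsto:
  fixes n k q :: "nat \<Rightarrow> nat"
  assumes n: "filterlim n at_top sequentially" and k: "(\<lambda>m. real (k m) / real (n m)) \<longlonglongrightarrow> \<rho>"
    and q: "(\<lambda>m. real (q m) / real (n m)) \<longlonglongrightarrow> (1 - \<rho> - l) / 2" and l: "0 < l" "l < 1 - \<rho>" and \<rho>: "\<rho> \<ge> 0"
  shows "(\<lambda>m. lower_exponent (n m) (k m) (q m) l / real (n m))
    \<longlonglongrightarrow> (xlnx (1 - l) - xlnx \<rho> + xlnx l - xlnx (1 - \<rho>) - xlnx (1 - \<rho> - l)) / 2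
      + (1 - \<rho> - l) / 2 + (1 - \<rho> - l) / 2 * ln l" (is "_ \<longlonglongrightarrow> ?L")
    and "\<forall>\<^sub>F m in sequentially. k m + 2 * q m + 4 \<le> n m"
proof -
  let ?N = "\<lambda>m. real (n m)" and ?K = "\<lambda>m. real (k m) / real (n m)" and ?P = "\<lambda>m. real (Suc (q m)) / real (n m)"
  have n_pos: "\<forall>\<^sub>F m in sequentially. n m > 0"
    by (rule eventually_pos_seq[OF n])
  have P: "?P \<longlonglongrightarrow> (1 - \<rho> - l) / 2"
    using tendsto_add[OF q tendsto_inverse_seq[OF n, of 1]] by (simp add: add_divide_distrib add.commute)
  have P2: "(\<lambda>m. 2 * ?P m) \<longlonglongrightarrow> 1 - \<rho> - l"
  proof -
    have "2 * ((1 - \<rho> - l) / 2) = 1 - \<rho> - l" by simp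
    with tendsto_mult[OF tendsto_const P, of 2] show ?thesis by (simp only:)
  qed
  have "(\<lambda>m. ?K m + 2 * (real (q m) / ?N m) + 4 / ?N m) \<longlonglongrightarrow> \<rho> + 2 * ((1 - \<rho> - l) / 2) + 0"
    by (intro tendsto_intros k q tendsto_inverse_seq n)
  moreover have "\<rho> + 2 * ((1 - \<rho> - l) / 2) + 0 = 1 - l" by argo
  ultimately have "(\<lambda>m. ?K m + 2 * (real (q m) / ?N m) + 4 / ?N m) \<longlonglongrightarrow> 1 - l"
    by (simp only:)
  then have "\<forall>\<^sub>F m in sequentially. ?K m + 2 * (real (q m) / ?N m) + 4 / ?N m < 1"
    using l by (intro order_tendstoD(2)) auto
  with n_pos show size: "\<forall>\<^sub>F m in sequentially. k m + 2 * q m + 4 \<le> n m"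
  proof eventually_elim
    case (elim m)
    then have "(real (k m) + 2 * real (q m) + 4) / ?N m < 1" by (simp add: add_divide_distrib)
    then have "real (k m + 2 * q m + 4) < real (n m)" using elim(1) by simp
    then show ?case by linarith
  qed
  have nonneg: "0 \<le> 1 - ?K m - 2 * ?P m - 2 / ?N m" "0 \<le> 1 - ?K m - 4 / ?N m" if "k m + 2 * q m + 4 \<le> n m" for m
  proof -
    have le: "real (k m) + 2 * real (q m) + 4 \<le> real (n m)"
      using that by (metis of_nat_add of_nat_le_iff of_nat_mult of_nat_numeral)
    then have "0 \<le> (real (n m) - real (k m) - 2 * real (Suc (q m)) - 2) / ?N m" "0 \<le> (real (n m) - real (k m) - 4) / ?N m"
      by (auto intro!: divide_nonneg_nonneg)
    moreover have "?N m > 0" using that by simp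
    then have "1 - ?K m - 2 * ?P m - 2 / ?N m = (real (n m) - real (k m) - 2 * real (Suc (q m)) - 2) / ?N m"
      "1 - ?K m - 4 / ?N m = (real (n m) - real (k m) - 4) / ?N m"
      by (simp_all add: diff_divide_distrib del: of_nat_Suc)
    ultimately show "0 \<le> 1 - ?K m - 2 * ?P m - 2 / ?N m" "0 \<le> 1 - ?K m - 4 / ?N m"
      by (simp_all only:)
  qed
  have l1: "(\<lambda>m. 1 - ?K m - 2 * ?P m - 2 / ?N m) \<longlonglongrightarrow> l"
    using tendsto_diff[OF tendsto_diff[OF tendsto_diff[OF tendsto_const k] P2] tendsto_inverse_seq[OF n, of 2], of 1] by simp
  have l2: "(\<lambda>m. 1 - ?K m - 4 / ?N m) \<longlonglongrightarrow> 1 - \<rho>"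
    using tendsto_diff[OF tendsto_diff[OF tendsto_const k] tendsto_inverse_seq[OF n, of 4], of 1] by simp
  have l3: "(\<lambda>m. ?K m + 2 * ?P m) \<longlonglongrightarrow> 1 - l"
    using tendsto_add[OF k P2] by simp
  have 1: "(\<lambda>m. xlnx (1 - ?K m - 2 * ?P m - 2 / ?N m)) \<longlonglongrightarrow> xlnx l"
    by (rule tendsto_xlnx[OF l1 _ eventually_mono[OF size nonneg(1)]]) (use l \<rho> in simp)
  have 2: "(\<lambda>m. xlnx (1 - ?K m - 4 / ?N m)) \<longlonglongrightarrow> xlnx (1 - \<rho>)"
    by (rule tendsto_xlnx[OF l2 _ eventually_mono[OF size nonneg(2)]]) (use l \<rho> in simp)
  have 3: "(\<lambda>m. xlnx (?K m + 2 * ?P m)) \<longlonglongrightarrow> xlnx (1 - l)"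
    using l \<rho> by (intro tendsto_xlnx l3) auto
  have 4: "(\<lambda>m. xlnx (?K m)) \<longlonglongrightarrow> xlnx \<rho>"
    using \<rho> by (intro tendsto_xlnx k) auto
  have 5: "(\<lambda>m. xlnx (2 * ?P m)) \<longlonglongrightarrow> xlnx (1 - \<rho> - l)"
    using l by (intro tendsto_xlnx P2) auto
  have 6: "(\<lambda>m. ln (2 * real (Suc (q m)) + 1) / ?N m) \<longlonglongrightarrow> 0"
    using l by (intro tendsto_ln_linear_div_seq[OF n P]) auto
  let ?g = "\<lambda>m. (xlnx (?K m + 2 * ?P m) - xlnx (?K m) - xlnx (2 * ?P m)
        + xlnx (1 - ?K m - 2 * ?P m - 2 / ?N m) - xlnx (1 - ?K m - 4 / ?N m)) / 2
      + ?P m + ?P m * ln l + (ln (2 * real (Suc (q m)) + 1) / ?N m + (ln (1 / 2) - 1) / ?N m + ln (?N m) / ?N m)"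
  have lim: "?g
    \<longlonglongrightarrow> (xlnx (1 - l) - xlnx \<rho> - xlnx (1 - \<rho> - l) + xlnx l - xlnx (1 - \<rho>)) / 2
      + (1 - \<rho> - l) / 2 + (1 - \<rho> - l) / 2 * ln l + (0 + 0 + 0)"
    by (intro tendsto_add tendsto_diff tendsto_divide tendsto_mult tendsto_const 1 2 3 4 5 6 P
        tendsto_inverse_seq tendsto_ln_div_seq n) simp
  have "\<forall>\<^sub>F m in sequentially. ?g m
      = lower_exponent (n m) (k m) (q m) l / ?N m"
    using size
  proof eventually_elim
    case (elim m)
    show ?case by (rule lower_exponent_scaled[OF elim l(1), symmetric])
  qed
  then have "(\<lambda>m. lower_exponent (n m) (k m) (q m) l / ?N m) \<longlonglongrightarrow> (xlnx (1 - l) - xlnx \<rho> - xlnx (1 - \<rho> - l) + xlnx l - xlnx (1 - \<rho>)) / 2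
      + (1 - \<rho> - l) / 2 + (1 - \<rho> - l) / 2 * ln l + (0 + 0 + 0)"
    by (rule Lim_transform_eventually[OF lim])
  moreover have "(xlnx (1 - l) - xlnx \<rho> - xlnx (1 - \<rho> - l) + xlnx l - xlnx (1 - \<rho>)) / 2
      + (1 - \<rho> - l) / 2 + (1 - \<rho> - l) / 2 * ln l + (0 + 0 + 0) = ?L"
    by simp
  ultimately show "(\<lambda>m. lower_exponent (n m) (k m) (q m) l / ?N m) \<longlonglongrightarrow> ?L"
    by (simp only:)
qed

text \<open>Measured per row, the number of supports contributes \<open>N / n\<close>, tending to
  \<open>1 / \<delta>\<close>, times an entropy at \<open>k / N\<close>, tending to
  \<open>\<nu> * \<delta>\<close>.\<close>

lemma entropy_exponent_tendsto:
  fixes n k N :: "nat \<Rightarrow> nat"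
  assumes N: "(\<lambda>m. real (n m) / real (N m)) \<longlonglongrightarrow> \<delta>" and k: "(\<lambda>m. real (k m) / real (n m)) \<longlonglongrightarrow> \<nu>"
    and \<delta>: "0 < \<delta>" and \<nu>: "0 \<le> \<nu>" "\<nu> * \<delta> \<le> 1" and n: "\<forall>\<^sub>F m in sequentially. n m > 0"
    and kN: "\<forall>\<^sub>F m in sequentially. k m \<le> N m"
  shows "(\<lambda>m. real (N m) * shannon_entropy (real (k m) / real (N m)) / real (n m)) \<longlonglongrightarrow> shannon_entropy (\<nu> * \<delta>) / \<delta>"
proof -
  have inv: "(\<lambda>m. inverse (real (n m) / real (N m))) \<longlonglongrightarrow> inverse \<delta>"
    using \<delta> by (intro tendsto_inverse N) auto
  have "(\<lambda>m. real (k m) / real (n m) * (real (n m) / real (N m))) \<longlonglongrightarrow> \<nu> * \<delta>"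
    by (intro tendsto_mult k N)
  then have kN_lim: "(\<lambda>m. real (k m) / real (N m)) \<longlonglongrightarrow> \<nu> * \<delta>"
    by (rule Lim_transform_eventually) (use n in \<open>auto elim: eventually_mono\<close>)
  have le1: "\<forall>\<^sub>F m in sequentially. real (k m) / real (N m) \<le> 1"
    using kN by eventually_elim (auto simp: divide_le_eq_1)
  have "(\<lambda>m. - xlnx (real (k m) / real (N m)) - xlnx (1 - real (k m) / real (N m)))
      \<longlonglongrightarrow> - xlnx (\<nu> * \<delta>) - xlnx (1 - \<nu> * \<delta>)"
    using \<delta> \<nu> le1
    by (intro tendsto_diff tendsto_minus tendsto_xlnx kN_lim tendsto_const) (auto elim: eventually_mono)
  then have "(\<lambda>m. shannon_entropy (real (k m) / real (N m))) \<longlonglongrightarrow> - xlnx (\<nu> * \<delta>) - xlnx (1 - \<nu> * \<delta>)"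
    by (rule Lim_transform_eventually) (use le1 in \<open>auto elim!: eventually_mono simp: shannon_entropy_eq_xlnx\<close>)
  then have "(\<lambda>m. shannon_entropy (real (k m) / real (N m))) \<longlonglongrightarrow> shannon_entropy (\<nu> * \<delta>)"
    using \<delta> \<nu> by (simp add: shannon_entropy_eq_xlnx)
  from tendsto_mult[OF inv this] show ?thesis by (simp add: divide_inverse mult_ac)
qed

text \<open>The exponent per row tends to the negative number \<open>S\<close>. Half of it is given
  up to pass from the limit to an eventual bound, and the other half is the rate \<beta>.\<close>

lemma eventually_union_bound_le:
  fixes n k N :: "nat \<Rightarrow> nat" and L :: "nat \<Rightarrow> real"
  assumes n: "filterlim n at_top sequentially"
    and N: "(\<lambda>m. real (n m) / real (N m)) \<longlonglongrightarrow> \<delta>" and k: "(\<lambda>m. real (k m) / real (n m)) \<longlonglongrightarrow> \<nu>"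
    and \<delta>: "0 < \<delta>" and \<nu>: "0 \<le> \<nu>" "\<nu> * \<delta> \<le> 1"
    and kN: "\<forall>\<^sub>F m in sequentially. 1 \<le> k m \<and> k m \<le> N m"
    and L: "(\<lambda>m. L m / real (n m)) \<longlonglongrightarrow> a" and neg: "\<delta> * a + shannon_entropy (\<nu> * \<delta>) < 0"
  shows "\<exists>\<beta>>0. \<forall>\<^sub>F m in sequentially. real (N m choose k m) * exp (L m) \<le> exp (- (real (n m) * \<beta>))"
proof -
  define S where "S = shannon_entropy (\<nu> * \<delta>) / \<delta> + a"
  have S: "S < 0" using neg \<delta> by (simp add: S_def field_simps)
  have n_pos: "\<forall>\<^sub>F m in sequentially. n m > 0"
    by (rule eventually_pos_seq[OF n])
  have "(\<lambda>m. real (N m) * shannon_entropy (real (k m) / real (N m)) / real (n m) + L m / real (n m)) \<longlonglongrightarrow> S"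
    unfolding S_def
    by (intro tendsto_add L entropy_exponent_tendsto[OF N k \<delta> \<nu> n_pos]) (use kN in \<open>auto elim: eventually_mono\<close>)
  then have "\<forall>\<^sub>F m in sequentially. real (N m) * shannon_entropy (real (k m) / real (N m)) / real (n m) + L m / real (n m) < S / 2"
    using S by (intro order_tendstoD(2)) auto
  with n_pos kN have "\<forall>\<^sub>F m in sequentially. real (N m choose k m) * exp (L m) \<le> exp (- (real (n m) * (- S / 2)))"
  proof eventually_elim
    case (elim m)
    have "real (N m choose k m) * exp (L m) \<le> exp (real (N m) * shannon_entropy (real (k m) / real (N m))) * exp (L m)"
      using elim by (intro mult_right_mono binomial_le_exp_entropy) auto
    also have "\<dots> = exp (real (N m) * shannon_entropy (real (k m) / real (N m)) + L m)"
      by (simp add: exp_add)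
    also have "\<dots> \<le> exp (- (real (n m) * (- S / 2)))"
    proof -
      have "(real (N m) * shannon_entropy (real (k m) / real (N m)) + L m) / real (n m) \<le> S / 2"
        using elim by (simp add: add_divide_distrib)
      then show ?thesis using elim by (simp add: pos_divide_le_eq mult.commute)
    qed
    finally show ?case .
  qed
  then show ?thesis using S by (intro exI[of _ "- S / 2"]) auto
qed

lemma tendsto_ambient_ratio:
  fixes n N :: "nat \<Rightarrow> nat"
  assumes "filterlim n at_top sequentially" "(\<lambda>m. real (n m) / real (N m)) \<longlonglongrightarrow> \<delta>" "\<delta> > 0"
  shows "(\<lambda>m. real (N m) / real (n m)) \<longlonglongrightarrow> 1 / \<delta>" "\<forall>\<^sub>F m in sequentially. 1 \<le> N m"
proof -
  show "(\<lambda>m. real (N m) / real (n m)) \<longlonglongrightarrow> 1 / \<delta>"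
    using tendsto_inverse[OF assms(2)] assms(3) by (simp add: inverse_eq_divide)
  have "\<forall>\<^sub>F m in sequentially. 0 < real (n m) / real (N m)"
    using assms(2,3) by (intro order_tendstoD(1)) auto
  then show "\<forall>\<^sub>F m in sequentially. 1 \<le> N m"
    by eventually_elim (simp add: zero_less_divide_iff)
qed

text \<open>Rounding \<open>\<nu> * n\<close> and clamping it to \<open>[max k 1, N]\<close> gives a sparsity level for which the union
  bound over supports of exactly that size covers all \<open>k\<close>-sparse vectors.\<close>

definition sparsity_level :: "real \<Rightarrow> nat \<Rightarrow> nat \<Rightarrow> nat \<Rightarrow> nat" where
  "sparsity_level \<nu> n N k = max 1 (min (max k (nat \<lfloor>\<nu> * real n\<rfloor>)) N)"

lemma sparsity_level_bounds:
  assumes "1 \<le> N"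
  shows "1 \<le> sparsity_level \<nu> n N k" "sparsity_level \<nu> n N k \<le> N" "min k N \<le> sparsity_level \<nu> n N k"
  using assms by (auto simp: sparsity_level_def)

lemma sparsity_level_tendsto:
  fixes n N k :: "nat \<Rightarrow> nat"
  assumes n: "filterlim n at_top sequentially" and N: "(\<lambda>m. real (n m) / real (N m)) \<longlonglongrightarrow> \<delta>"
    and k: "(\<lambda>m. real (k m) / real (n m)) \<longlonglongrightarrow> \<rho>" and \<delta>: "0 < \<delta>" "\<delta> \<le> 1"
    and \<nu>: "0 \<le> \<rho>" "\<rho> \<le> \<nu>" "\<nu> \<le> 1"
  shows "(\<lambda>m. real (sparsity_level \<nu> (n m) (N m) (k m)) / real (n m)) \<longlonglongrightarrow> \<nu>"
proof -
  have "(\<lambda>m. max (1 / real (n m)) (min (max (real (k m) / real (n m)) (real (nat \<lfloor>\<nu> * real (n m)\<rfloor>) / real (n m)))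
      (real (N m) / real (n m)))) \<longlonglongrightarrow> max 0 (min (max \<rho> \<nu>) (1 / \<delta>))"
    using \<nu> by (intro tendsto_max tendsto_min tendsto_inverse_seq n k tendsto_nat_floor_div tendsto_ambient_ratio(1)[OF n N \<delta>(1)]) auto
  \<comment> \<open>Hence none of the clamps is felt in the limit.\<close>
  moreover have "\<nu> \<le> 1 / \<delta>" using \<delta> \<nu> by (simp add: pos_le_divide_eq mult_le_one)
  then have "max 0 (min (max \<rho> \<nu>) (1 / \<delta>)) = \<nu>" using \<nu> by simp
  moreover have "real (sparsity_level \<nu> (n m) (N m) (k m)) / real (n m)
     = max (1 / real (n m)) (min (max (real (k m) / real (n m)) (real (nat \<lfloor>\<nu> * real (n m)\<rfloor>) / real (n m)))
      (real (N m) / real (n m)))" for m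
    by (simp only: sparsity_level_def of_nat_max of_nat_min of_nat_1 max_divide_distrib_right min_divide_distrib_right of_nat_0_le_iff if_True)
  ultimately show ?thesis by simp
qed

section \<open>Assembly of the two convergence statements\<close>

lemma converges_exponentially_of_bad_events:
  fixes M :: "nat \<Rightarrow> 'w measure"
  assumes GE: "\<And>m. gaussian_ensemble (M m) (n m) (N m) (A m)"
    and sets: "\<And>m. {\<omega> \<in> space (M m). P m \<omega>} \<in> sets (M m)"
    and \<beta>: "\<beta> > 0"
    and bad: "\<forall>\<^sub>F m in sequentially. measure (M m) {\<omega> \<in> space (M m). \<not> P m \<omega>} \<le> exp (- (real (n m) * \<beta>))"
  shows "converges_exponentially n (\<lambda>m. measure (M m) {\<omega> \<in> space (M m). P m \<omega>}) 1"
proof (rule converges_exponentially_one[OF _ _ \<beta>])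
  have ps: "prob_space (M m)" for m using GE by (simp add: gaussian_ensemble_def)
  show "measure (M m) {\<omega> \<in> space (M m). P m \<omega>} \<le> 1" for m
    using prob_space.prob_le_1[OF ps] .
  have "1 - measure (M m) {\<omega> \<in> space (M m). P m \<omega>} = measure (M m) {\<omega> \<in> space (M m). \<not> P m \<omega>}" for m
  proof -
    have "space (M m) - {\<omega> \<in> space (M m). P m \<omega>} = {\<omega> \<in> space (M m). \<not> P m \<omega>}" by auto
    then show ?thesis using prob_space.prob_compl[OF ps[of m] sets[of m]] by (simp only:)
  qed
  with bad show "\<forall>\<^sub>F m in sequentially. 1 - measure (M m) {\<omega> \<in> space (M m). P m \<omega>} \<le> exp (- (real (n m) * \<beta>))"
    by simp
qed simp

lemma gaussian_ensemble_rip_sets: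
  assumes "gaussian_ensemble M n N A"
  shows "{\<omega> \<in> space M. rip_L k (A \<omega>) < c} \<in> sets M" "{\<omega> \<in> space M. rip_U k (A \<omega>) < c} \<in> sets M"
proof -
  have carr: "A \<omega> \<in> carrier_mat n N" if "\<omega> \<in> space M" for \<omega>
    using assms that by (simp add: gaussian_ensemble_def)
  have meas: "(\<lambda>\<omega>. A \<omega> $$ (i, j)) \<in> borel_measurable M" if "i < n" "j < N" for i j
  proof -
    have "distributed M lborel (\<lambda>\<omega>. A \<omega> $$ (i, j)) (normal_density 0 (sqrt (1 / real n)))"
      using assms that unfolding gaussian_ensemble_def by blast
    then show ?thesis using distributed_measurable by fastforce
  qed
  show "{\<omega> \<in> space M. rip_L k (A \<omega>) < c} \<in> sets M" "{\<omega> \<in> space M. rip_U k (A \<omega>) < c} \<in> sets M"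
    unfolding rip_L_eq rip_U_eq by (rule rip_const_less_sets[OF _ carr meas]; simp)+
qed

text \<open>The minimising \<nu> may exceed \<rho>: \<open>k\<close>-sparse vectors are covered by
  larger supports as well, and a larger size can give a better exponent because it may leave fewer
  supports to count.\<close>

lemma rip_U_converges:
  fixes M :: "nat \<Rightarrow> 'w measure"
  assumes \<epsilon>: "\<epsilon> > 0" and \<delta>: "0 < \<delta>" "\<delta> \<le> 1" and \<rho>: "0 \<le> \<rho>" "\<rho> \<le> 1"
    and n: "filterlim n at_top sequentially" and N: "(\<lambda>m. real (n m) / real (N m)) \<longlonglongrightarrow> \<delta>"
    and k: "(\<lambda>m. real (k m) / real (n m)) \<longlonglongrightarrow> \<rho>"
    and GE: "\<And>m. gaussian_ensemble (M m) (n m) (N m) (A m)"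
  shows "converges_exponentially n (\<lambda>m. measure (M m) {\<omega> \<in> space (M m). rip_U (k m) (A m \<omega>) < bound_U \<delta> \<rho> + \<epsilon>}) 1"
proof -
  have sets: "{\<omega> \<in> space (M m). rip_U (k m) (A m \<omega>) < bound_U \<delta> \<rho> + \<epsilon>} \<in> sets (M m)" for m
    by (rule gaussian_ensemble_rip_sets(2)[OF GE])
  obtain \<nu> where \<nu>: "\<rho> \<le> \<nu>" "\<nu> \<le> 1" "bound_U \<delta> \<rho> = lambda_max \<delta> \<nu> - 1"
    by (rule bound_U_attained[OF \<delta> \<rho>])
  have \<nu>0: "0 \<le> \<nu>" using \<nu> \<rho> by simp
  note lm = lambda_max_props(1,2)[OF \<delta> \<nu>0 \<nu>(2)]
  \<comment> \<open>Half of \<epsilon> moves \<open>l\<close> beyond the zero and makes the gap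
    strictly negative; the other half keeps \<open>l - 1\<close> strictly below the
    threshold.\<close>
  define l where "l = lambda_max \<delta> \<nu> + \<epsilon> / 2"
  have l: "1 < l" "1 + \<nu> \<le> l" using lm(1) \<nu>0 \<epsilon> by (auto simp: l_def)
  have gap: "gap_max \<delta> \<nu> l < 0"
    using gap_max_strict_decreasing[OF \<delta>(1) \<nu>0 lm(1), of l] lm(2) \<epsilon> by (simp add: l_def)
  define a where "a = (xlnx l + xlnx (\<nu> + (l - 1)) - xlnx \<nu> - xlnx (l - 1)) / 2 - (l - 1) / 2 - (l - 1) / 2 * ln l"
  have "\<delta> * a \<le> \<delta> * psi_max l \<nu>"
    unfolding a_def using \<delta> exponent_le_psi_max[OF l(1) \<nu>0 \<nu>(2)] by (intro mult_left_mono) auto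
  then have neg: "\<delta> * a + shannon_entropy (\<nu> * \<delta>) < 0"
    using gap by (simp add: gap_max_def)
  \<comment> \<open>The successor keeps the order positive for every \<open>m\<close> without
    changing the limit.\<close>
  define p where "p m = Suc (nat \<lfloor>(l - 1) / 2 * real (n m)\<rfloor>)" for m
  have p: "(\<lambda>m. real (p m) / real (n m)) \<longlonglongrightarrow> (l - 1) / 2"
    using tendsto_add[OF tendsto_inverse_seq[OF n, of 1] tendsto_nat_floor_div[OF n, of "(l - 1) / 2"]] l
    by (simp add: p_def add_divide_distrib)
  define kk where "kk m = sparsity_level \<nu> (n m) (N m) (k m)" for m
  have kk: "(\<lambda>m. real (kk m) / real (n m)) \<longlonglongrightarrow> \<nu>"
    unfolding kk_def by (rule sparsity_level_tendsto[OF n N k \<delta> \<rho>(1) \<nu>(1,2)])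
  have N1: "\<forall>\<^sub>F m in sequentially. 1 \<le> N m" by (rule tendsto_ambient_ratio(2)[OF n N \<delta>(1)])
  then have kkN: "\<forall>\<^sub>F m in sequentially. 1 \<le> kk m \<and> kk m \<le> N m"
    unfolding kk_def by eventually_elim (intro conjI sparsity_level_bounds)
  have lim: "(\<lambda>m. upper_exponent (n m) (kk m) (p m) l / real (n m)) \<longlonglongrightarrow> a"
    unfolding a_def by (rule upper_exponent_tendsto[OF n kk p _ l(1) \<nu>0]) (simp add: p_def)
  have "\<nu> * \<delta> \<le> 1" using \<delta> \<nu> \<nu>0 by (intro mult_le_one) auto
  from eventually_union_bound_le[OF n N kk \<delta>(1) \<nu>0 this kkN lim neg]
  obtain \<beta> where \<beta>: "\<beta> > 0" "\<forall>\<^sub>F m in sequentially. real (N m choose kk m) * exp (upper_exponent (n m) (kk m) (p m) l) \<le> exp (- (real (n m) * \<beta>))"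
    by blast
  show ?thesis
  proof (rule converges_exponentially_of_bad_events[OF GE sets \<beta>(1)])
    show "\<forall>\<^sub>F m in sequentially. measure (M m) {\<omega> \<in> space (M m). \<not> rip_U (k m) (A m \<omega>) < bound_U \<delta> \<rho> + \<epsilon>}
        \<le> exp (- (real (n m) * \<beta>))"
      using \<beta>(2) N1 eventually_pos_seq[OF n]
    proof eventually_elim
      case (elim m)
      have "0 \<le> l - 1" "l - 1 < bound_U \<delta> \<rho> + \<epsilon>" using l \<nu>(3) \<epsilon> by (auto simp: l_def)
      then have "measure (M m) {\<omega> \<in> space (M m). \<not> rip_U (k m) (A m \<omega>) < bound_U \<delta> \<rho> + \<epsilon>}
          \<le> real (N m choose kk m) * exp (upper_exponent (n m) (kk m) (p m) (1 + (l - 1)))"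
        unfolding kk_def using elim
        by (intro rip_U_tail[OF GE] sparsity_level_bounds) (auto simp: p_def)
      then show ?case using elim(1) by simp
    qed
  qed
qed

text \<open>A threshold above one is never reached. Otherwise \<rho> < 1 and
  \<open>lambda_min\<close> is at least \<epsilon>, which leaves room for two levels between zero
  and \<open>lambda_min\<close>.\<close>

lemma rip_L_converges:
  fixes M :: "nat \<Rightarrow> 'w measure"
  assumes \<epsilon>: "\<epsilon> > 0" and \<delta>: "0 < \<delta>" "\<delta> \<le> 1" and \<rho>: "0 \<le> \<rho>" "\<rho> \<le> 1"
    and n: "filterlim n at_top sequentially" and N: "(\<lambda>m. real (n m) / real (N m)) \<longlonglongrightarrow> \<delta>"
    and k: "(\<lambda>m. real (k m) / real (n m)) \<longlonglongrightarrow> \<rho>"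
    and GE: "\<And>m. gaussian_ensemble (M m) (n m) (N m) (A m)"
  shows "converges_exponentially n (\<lambda>m. measure (M m) {\<omega> \<in> space (M m). rip_L (k m) (A m \<omega>) < bound_L \<delta> \<rho> + \<epsilon>}) 1"
proof -
  have sets: "{\<omega> \<in> space (M m). rip_L (k m) (A m \<omega>) < bound_L \<delta> \<rho> + \<epsilon>} \<in> sets (M m)" for m
    by (rule gaussian_ensemble_rip_sets(1)[OF GE])
  show ?thesis
  proof (cases "bound_L \<delta> \<rho> + \<epsilon> > 1")
    case True
    then have "rip_L (k m) (A m \<omega>) < bound_L \<delta> \<rho> + \<epsilon>" for m \<omega>
      using rip_L_le_one[of "k m" "A m \<omega>"] by simp
    then have "measure (M m) {\<omega> \<in> space (M m). \<not> rip_L (k m) (A m \<omega>) < bound_L \<delta> \<rho> + \<epsilon>} = 0" for m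
      by simp
    then show ?thesis
      by (intro converges_exponentially_of_bad_events[where \<beta> = 1, OF GE sets]) simp_all
  next
    case False
    then have "\<rho> \<noteq> 1" using \<epsilon> by (auto simp: bound_L_def lambda_min_def)
    then have \<rho>1: "\<rho> < 1" using \<rho> by simp
    define lm where "lm = lambda_min \<delta> \<rho>"
    note lm = lambda_min_props[OF \<delta> \<rho>(1) \<rho>1, folded lm_def]
    have lm_ge: "\<epsilon> \<le> lm" using False by (simp add: bound_L_def lm_def)
    \<comment> \<open>In thirds of \<epsilon>: \<open>1 - c = lm - 2 * \<epsilon> / 3\<close> lies
      below \<open>l\<close>, which feeds the regularisation; \<open>l\<close> lies below
      \<open>lm\<close>, which makes the gap negative; and \<open>c\<close> lies below the
      threshold.\<close>
    define l where "l = lm - \<epsilon> / 3"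
    define c where "c = 1 - lm + 2 * \<epsilon> / 3"
    have l: "0 < l" "l < 1 - \<rho>" using lm lm_ge \<epsilon> by (auto simp: l_def)
    have c: "0 \<le> c" "c < bound_L \<delta> \<rho> + \<epsilon>" "0 < 1 - c" "1 - c < l"
      using lm lm_ge \<epsilon> \<rho> by (auto simp: c_def l_def bound_L_def lm_def[symmetric])
    have gap: "gap_min \<delta> \<rho> l < 0"
      using gap_min_strict_increasing[OF \<delta>(1) \<rho>1 l(1), of lm] lm \<epsilon> by (simp add: l_def)
    define a where "a = (xlnx (1 - l) - xlnx \<rho> + xlnx l - xlnx (1 - \<rho>) - xlnx (1 - \<rho> - l)) / 2
        + (1 - \<rho> - l) / 2 + (1 - \<rho> - l) / 2 * ln l"
    have "\<delta> * a \<le> \<delta> * psi_min l \<rho>"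
      unfolding a_def using \<delta> exponent_le_psi_min[OF l \<rho>(1)] by (intro mult_left_mono) auto
    then have neg: "\<delta> * a + shannon_entropy (\<rho> * \<delta>) < 0"
      using gap by (simp add: gap_min_def)
    define q where "q m = nat \<lfloor>(1 - \<rho> - l) / 2 * real (n m)\<rfloor>" for m
    have q: "(\<lambda>m. real (q m) / real (n m)) \<longlonglongrightarrow> (1 - \<rho> - l) / 2"
      unfolding q_def using l by (intro tendsto_nat_floor_div n) auto
    define kk where "kk m = sparsity_level \<rho> (n m) (N m) (k m)" for m
    have kk: "(\<lambda>m. real (kk m) / real (n m)) \<longlonglongrightarrow> \<rho>"
      unfolding kk_def by (rule sparsity_level_tendsto[OF n N k \<delta> \<rho>(1) order_refl \<rho>(2)])
    have N1: "\<forall>\<^sub>F m in sequentially. 1 \<le> N m" by (rule tendsto_ambient_ratio(2)[OF n N \<delta>(1)])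
    then have kkN: "\<forall>\<^sub>F m in sequentially. 1 \<le> kk m \<and> kk m \<le> N m"
      unfolding kk_def by eventually_elim (intro conjI sparsity_level_bounds)
    have lim: "(\<lambda>m. lower_exponent (n m) (kk m) (q m) l / real (n m)) \<longlonglongrightarrow> a"
      unfolding a_def by (rule lower_exponent_tendsto(1)[OF n kk q l \<rho>(1)])
    have size: "\<forall>\<^sub>F m in sequentially. kk m + 2 * q m + 4 \<le> n m"
      by (rule lower_exponent_tendsto(2)[OF n kk q l \<rho>(1)])
    have "\<rho> * \<delta> \<le> 1" using \<delta> \<rho> by (intro mult_le_one) auto
    from eventually_union_bound_le[OF n N kk \<delta>(1) \<rho>(1) this kkN lim neg]
    obtain \<beta> where \<beta>: "\<beta> > 0" "\<forall>\<^sub>F m in sequentially. real (N m choose kk m) * exp (lower_exponent (n m) (kk m) (q m) l) \<le> exp (- (real (n m) * \<beta>))"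
      by blast
    show ?thesis
    proof (rule converges_exponentially_of_bad_events[OF GE sets \<beta>(1)])
      show "\<forall>\<^sub>F m in sequentially. measure (M m) {\<omega> \<in> space (M m). \<not> rip_L (k m) (A m \<omega>) < bound_L \<delta> \<rho> + \<epsilon>}
          \<le> exp (- (real (n m) * \<beta>))"
        using \<beta>(2) N1 eventually_pos_seq[OF n] size
      proof eventually_elim
        case (elim m)
        have "measure (M m) {\<omega> \<in> space (M m). \<not> rip_L (k m) (A m \<omega>) < bound_L \<delta> \<rho> + \<epsilon>}
            \<le> real (N m choose kk m) * exp (lower_exponent (n m) (kk m) (q m) l)"
          using elim(2) unfolding kk_def
          by (intro rip_L_tail[OF GE elim(3) _ _ _ elim(4)[unfolded kk_def] c] sparsity_level_bounds)
        then show ?case using elim(1) by simp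
      qed
    qed
  qed
qed

theorem theorem2p3:
  fixes \<epsilon> \<delta> \<rho> :: real
    and k n N :: "nat \<Rightarrow> nat"
    and M :: "nat \<Rightarrow> 'w measure"
    and A :: "nat \<Rightarrow> 'w \<Rightarrow> real mat"
  assumes "\<epsilon> > 0"
    and "0 < \<delta>" "\<delta> \<le> 1" "0 \<le> \<rho>" "\<rho> \<le> 1"
    and "filterlim n at_top sequentially"
    and "(\<lambda>m. real (n m) / real (N m)) \<longlonglongrightarrow> \<delta>"
    and "(\<lambda>m. real (k m) / real (n m)) \<longlonglongrightarrow> \<rho>"
    and "\<And>m. gaussian_ensemble (M m) (n m) (N m) (A m)"
  shows "converges_exponentially n
           (\<lambda>m. measure (M m) {\<omega> \<in> space (M m). rip_L (k m) (A m \<omega>) < bound_L \<delta> \<rho> + \<epsilon>}) 1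
       \<and> converges_exponentially n
           (\<lambda>m. measure (M m) {\<omega> \<in> space (M m). rip_U (k m) (A m \<omega>) < bound_U \<delta> \<rho> + \<epsilon>}) 1"
  using rip_L_converges[OF assms] rip_U_converges[OF assms] by blast

end
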